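(* Let $G$ be a finite simple connected graph, let $K$ be a field, and let $w$ be an even closed walk of $G$ with $B_w\neq 0$. Then $B_w$ is a minimal binomial of the toric ideal $I_G$ if and only if $w$ is strongly primitive, all the chords of $w$ are odd, no two chords of $w$ cross strongly effectively in $w$, and no odd chord of $w$ crosses an $F_4$ of $w$.
   Context: Toric ideal. Let $V(G)=\{v_1,\ldots,v_n\}$ and $E(G)=\{e_1,\ldots,e_m\}$; the edges are also the variables of $K[e_1,\ldots,e_m]$. To $e=\{v_i,v_j\}$ associate $a_e=v_i+v_j$ in the free abelian group on $V(G)$. The toric ideal $I_G\subset K[e_1,\ldots,e_m]$ is generated by all binomials $\mathbf{e}^{\mathbf{u}}-\mathbf{e}^{\mathbf{v}}$ with $\sum_k u_k a_{e_k}=\sum_k v_k a_{e_k}$. A binomial $B\in I_G$ is minimal if it belongs to a minimal system of binomial generators of $I_G$. Walks. A walk is a finite sequence of edges $w=(\{v_{i_1},v_{i_2}\},\{v_{i_2},v_{i_3}\},\ldots,\{v_{i_q},v_{i_{q+1}}\})$ of $G$, $q\ge1$; its length is $q$, it is even/odd according to $q$, and closed if $v_{i_{q+1}}=v_{i_1}$. Edges may be repeated. A closed walk may be rewritten starting at another of its vertices. For a walk $w$, $-w$ denotes the reversed walk. A walk $w'=(e_{j_1},\ldots,e_{j_t})$ is a subwalk of $w=(e_{i_1},\ldots,e_{i_q})$ if $e_{j_1}\cdots e_{j_t}$ divides $e_{i_1}\cdots e_{i_q}$. For an even closed walk $w=(e_{i_1},\ldots,e_{i_{2q}})$ put $E^+(w)=\prod_{k=1}^{q}e_{i_{2k-1}}$,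 $E^-(w)=\prod_{k=1}^{q}e_{i_{2k}}$ and $B_w=E^+(w)-E^-(w)\in I_G$. The edges in odd (even) positions are the odd (even) edges of $w$. $w$ is primitive if there is no even closed subwalk $\xi$ of $w$ of smaller length with $E^+(\xi)\mid E^+(w)$ and $E^-(\xi)\mid E^-(w)$. Blocks and sinks. $\mathbf{w}$ denotes the subgraph of $G$ whose vertices and edges are those of $w$. A block of a graph is a maximal connected subgraph having no cut vertex of its own; a block that is a cycle is called cyclic. A sink of a block $B$ of $\mathbf{w}$ is a common vertex of two odd or of two even edges of $w$ (counted as occurrences in $w$) which belong to $B$. A strongly primitive walk is a primitive walk that does not have two sinks of the same cyclic block at distance one in that block. Chords. An edge $f\in E(G)$ is a chord of $w$ if both vertices of $f$ are vertices of $\mathbf{w}$ and $f\notin E(\mathbf{w})$. For $w=((v_1,v_2),(v_2,v_3),\ldots,(v_{2k},v_1))$ with $e_s=(v_s,v_{s+1})$ and $e_{2k}=(v_{2k},v_1)$, a chord $f=\{v_i,v_j\}$, $i<j$, breaks $w$ into the two walks $(e_1,\ldots,e_{i-1},f,e_j,\ldots,e_{2k})$ and $(e_i,\ldots,e_{j-1},f)$, which are both even or both odd. A chord $f=\{x,y\}$ of a primitive walk $w$ is a bridge of $w$ if there exist two different blocks $B_1,B_2$ of $\mathbf{w}$ with $x\in B_1$ and $y\in B_2$. A chord is even (respectively odd) if it is not a bridge and breaks $w$ into two even (respectively two odd) walks. Crossing. Let $w=((v_{i_1},v_{i_2}),(v_{i_2},v_{i_3}),\ldots,(v_{i_{2q}},v_{i_1}))$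 be primitive and let $f=\{v_{i_s},v_{i_j}\}$, $f'=\{v_{i_{s'}},v_{i_{j'}}\}$ be odd chords with $1\le s<j\le 2q$, $1\le s'<j'\le 2q$ (so $j-s$ and $j'-s'$ are even). They cross effectively in $w$ if $s'-s$ is odd and either $s<s'<j<j'$ or $s'<s<j'<j$. An $F_4$ of $w$ is a cycle $(e,f,e',f')$ of length four consisting of two edges $e,e'$ of $w$, both odd or both even, and two odd chords $f,f'$ of $w$ which cross effectively in $w$. Two odd chords cross strongly effectively in $w$ if they cross effectively and do not form an $F_4$ of $w$ (i.e. are not the two chords of any $F_4$ of $w$). Given an $F_4$, $(e_1,f_1,e_2,f_2)$, of $w$ with $e_1,e_2$ the edges of $w$, write $w=(w_1,e_1,w_2,e_2)$; the vertices of $\mathbf{w}$ are separated into the two parts $V(\mathbf{w}_1)$, $V(\mathbf{w}_2)$. An odd chord $f$ of $w$ crosses this $F_4$ if one vertex of $f$ is in $V(\mathbf{w}_1)$, the other in $V(\mathbf{w}_2)$, and $f$ is different from $f_1,f_2$. *)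

theory Defs
  imports "HOL-Library.Poly_Mapping" "HOL-Algebra.Ideal"
begin

section \<open>Graphs\<close>

text \<open>A graph is a pair of a vertex set and a set of edges, an edge being the set of its two
  end points.  The type is also used for subgraphs.\<close>

type_synonym 'v sgraph = "'v set \<times> 'v set set"

abbreviation verts :: "'v sgraph \<Rightarrow> 'v set" where "verts \<equiv> fst"
abbreviation edges :: "'v sgraph \<Rightarrow> 'v set set" where "edges \<equiv> snd"

definition finite_simple_graph :: "'v sgraph \<Rightarrow> bool" where
  "finite_simple_graph G \<longleftrightarrow> finite (verts G) \<and>
     (\<forall>e\<in>edges G. \<exists>x\<in>verts G. \<exists>y\<in>verts G. x \<noteq> y \<and> e = {x, y})"

definition subgraph :: "'v sgraph \<Rightarrow> 'v sgraph \<Rightarrow> bool" where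
  "subgraph H G \<longleftrightarrow> verts H \<subseteq> verts G \<and> edges H \<subseteq> edges G \<and> (\<forall>e\<in>edges H. e \<subseteq> verts H)"

definition linked :: "'v sgraph \<Rightarrow> 'v \<Rightarrow> 'v \<Rightarrow> bool" where
  "linked H x y \<longleftrightarrow> (x, y) \<in> {(a, b). {a, b} \<in> edges H}\<^sup>*"

definition connected_graph :: "'v sgraph \<Rightarrow> bool" where
  "connected_graph H \<longleftrightarrow> verts H \<noteq> {} \<and> (\<forall>x\<in>verts H. \<forall>y\<in>verts H. linked H x y)"

definition del_vertex :: "'v sgraph \<Rightarrow> 'v \<Rightarrow> 'v sgraph" where
  "del_vertex H v = (verts H - {v}, {e \<in> edges H. v \<notin> e})"

definition cut_vertex :: "'v sgraph \<Rightarrow> 'v \<Rightarrow> bool" where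
  "cut_vertex H v \<longleftrightarrow> v \<in> verts H \<and>
     (\<exists>x\<in>verts H - {v}. \<exists>y\<in>verts H - {v}. linked H x y \<and> \<not> linked (del_vertex H v) x y)"

definition block :: "'v sgraph \<Rightarrow> 'v sgraph \<Rightarrow> bool" where
  "block G B \<longleftrightarrow>
     subgraph B G \<and> connected_graph B \<and> (\<nexists>v. cut_vertex B v) \<and>
     (\<forall>B'. subgraph B' G \<and> connected_graph B' \<and> (\<nexists>v. cut_vertex B' v) \<and> subgraph B B'
        \<longrightarrow> B' = B)"

section \<open>Walks\<close>

text \<open>A walk is represented by the list of the vertices it visits, so that a walk of length
  \<open>q\<close> is a list of length \<open>q + 1\<close> and its first vertex is repeated at the end if it is closed.
  Positions are counted from 0; hence the odd edges (first, third, ...) are those at the even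
  list positions, and the even edges those at the odd list positions.\<close>

definition walk_edges :: "'v list \<Rightarrow> 'v set list" where
  "walk_edges w = map (\<lambda>i. {w ! i, w ! Suc i}) [0..<length w - 1]"

definition walk :: "'v sgraph \<Rightarrow> 'v list \<Rightarrow> bool" where
  "walk G w \<longleftrightarrow> 2 \<le> length w \<and> set (walk_edges w) \<subseteq> edges G"

definition even_walk :: "'v list \<Rightarrow> bool" where
  "even_walk w \<longleftrightarrow> even (length (walk_edges w))"

definition closed_walk :: "'v sgraph \<Rightarrow> 'v list \<Rightarrow> bool" where
  "closed_walk G w \<longleftrightarrow> walk G w \<and> hd w = last w"

definition even_closed_walk :: "'v sgraph \<Rightarrow> 'v list \<Rightarrow> bool" where
  "even_closed_walk G w \<longleftrightarrow> closed_walk G w \<and> even_walk w"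

definition walk_graph :: "'v list \<Rightarrow> 'v sgraph" where
  "walk_graph w = (set w, set (walk_edges w))"

definition is_cycle :: "'v sgraph \<Rightarrow> bool" where
  "is_cycle H \<longleftrightarrow>
     (\<exists>c. closed_walk H c \<and> 4 \<le> length c \<and> distinct (tl c) \<and> H = walk_graph c)"

section \<open>The toric ideal\<close>

text \<open>Monomials in the edges are identified with their exponent vectors.\<close>

type_synonym 'v edge_monom = "'v set \<Rightarrow>\<^sub>0 nat"
type_synonym ('v, 'k) edge_poly = "'v edge_monom \<Rightarrow>\<^sub>0 'k"

definition monom_dvd :: "'v edge_monom \<Rightarrow> 'v edge_monom \<Rightarrow> bool" where
  "monom_dvd u v \<longleftrightarrow> (\<exists>t. v = u + t)"

text \<open>The type \<open>('v, 'k) edge_poly\<close> has a variable for every set of vertices; the following is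
  the polynomial ring in the edges of \<open>G\<close> only.\<close>

definition edge_ring :: "'v sgraph \<Rightarrow> ('v, 'k::field) edge_poly ring" where
  "edge_ring G =
     \<lparr>carrier = {p. \<forall>u\<in>Poly_Mapping.keys p. Poly_Mapping.keys u \<subseteq> edges G},
      mult = (*), one = 1, zero = 0, add = (+)\<rparr>"

text \<open>The free abelian group on the vertices is \<open>'v \<Rightarrow>\<^sub>0 int\<close>.\<close>

definition edge_vector :: "'v set \<Rightarrow> 'v \<Rightarrow>\<^sub>0 int" where
  "edge_vector e = (\<Sum>v\<in>e. frag_of v)"

definition monom_degree :: "'v edge_monom \<Rightarrow> 'v \<Rightarrow>\<^sub>0 int" where
  "monom_degree u =
     (\<Sum>e\<in>Poly_Mapping.keys u. frag_cmul (int (Poly_Mapping.lookup u e)) (edge_vector e))"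

definition pure_binomial :: "'v edge_monom \<Rightarrow> 'v edge_monom \<Rightarrow> ('v, 'k::field) edge_poly" where
  "pure_binomial u v = Poly_Mapping.single u 1 - Poly_Mapping.single v 1"

definition toric_ideal :: "'v sgraph \<Rightarrow> ('v, 'k::field) edge_poly set" where
  "toric_ideal G = genideal (edge_ring G)
     {pure_binomial u v | u v. Poly_Mapping.keys u \<subseteq> edges G \<and> Poly_Mapping.keys v \<subseteq> edges G \<and>
        monom_degree u = monom_degree v}"

definition binomial_generators :: "'v sgraph \<Rightarrow> ('v, 'k::field) edge_poly set \<Rightarrow> bool" where
  "binomial_generators G S \<longleftrightarrow>
     (\<forall>B\<in>S. \<exists>u v. Poly_Mapping.keys u \<subseteq> edges G \<and> Poly_Mapping.keys v \<subseteq> edges G \<and>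
        B = pure_binomial u v) \<and>
     S \<subseteq> toric_ideal G \<and> genideal (edge_ring G) S = toric_ideal G"

text \<open>Minimality is with respect to inclusion.\<close>

definition minimal_binomial :: "'v sgraph \<Rightarrow> ('v, 'k::field) edge_poly \<Rightarrow> bool" where
  "minimal_binomial G B \<longleftrightarrow>
     (\<exists>S. binomial_generators G S \<and> (\<forall>T. T \<subset> S \<longrightarrow> \<not> binomial_generators G T) \<and> B \<in> S)"

section \<open>Primitive walks\<close>

definition edge_product :: "'v set list \<Rightarrow> 'v edge_monom" where
  "edge_product es = sum_list (map (\<lambda>e. Poly_Mapping.single e 1) es)"

definition E_plus :: "'v list \<Rightarrow> 'v edge_monom" where
  "E_plus w = edge_product (nths (walk_edges w) {i. even i})"

definition E_minus :: "'v list \<Rightarrow> 'v edge_monom" where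
  "E_minus w = edge_product (nths (walk_edges w) {i. odd i})"

definition walk_binomial :: "'v list \<Rightarrow> ('v, 'k::field) edge_poly" where
  "walk_binomial w = pure_binomial (E_plus w) (E_minus w)"

definition subwalk :: "'v list \<Rightarrow> 'v list \<Rightarrow> bool" where
  "subwalk w' w \<longleftrightarrow> monom_dvd (edge_product (walk_edges w')) (edge_product (walk_edges w))"

definition primitive_walk :: "'v sgraph \<Rightarrow> 'v list \<Rightarrow> bool" where
  "primitive_walk G w \<longleftrightarrow>
     even_closed_walk G w \<and>
     (\<nexists>z. even_closed_walk G z \<and> subwalk z w \<and>
        length (walk_edges z) < length (walk_edges w) \<and>
        monom_dvd (E_plus z) (E_plus w) \<and> monom_dvd (E_minus z) (E_minus w))"

text \<open>The two edges at \<open>v\<close> are different occurrences in \<open>w\<close>, possibly of the same edge.\<close>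

definition sink :: "'v list \<Rightarrow> 'v sgraph \<Rightarrow> 'v \<Rightarrow> bool" where
  "sink w B v \<longleftrightarrow>
     (\<exists>i j. i < length (walk_edges w) \<and> j < length (walk_edges w) \<and> i \<noteq> j \<and>
        (even i \<longleftrightarrow> even j) \<and>
        walk_edges w ! i \<in> edges B \<and> walk_edges w ! j \<in> edges B \<and>
        v \<in> walk_edges w ! i \<and> v \<in> walk_edges w ! j)"

definition strongly_primitive_walk :: "'v sgraph \<Rightarrow> 'v list \<Rightarrow> bool" where
  "strongly_primitive_walk G w \<longleftrightarrow>
     primitive_walk G w \<and>
     (\<nexists>B x y. block (walk_graph w) B \<and> is_cycle B \<and> sink w B x \<and> sink w B y \<and>
        x \<noteq> y \<and> {x, y} \<in> edges B)"

section \<open>Chords\<close>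

definition chord :: "'v sgraph \<Rightarrow> 'v list \<Rightarrow> 'v set \<Rightarrow> bool" where
  "chord G w f \<longleftrightarrow> f \<in> edges G \<and> f \<subseteq> set w \<and> f \<notin> set (walk_edges w)"

text \<open>The last entry of a closed walk repeats the first one and is not a position of its own.
  A vertex visited several times has several positions.  In a primitive walk it is then a cut
  vertex of the subgraph of the walk, so that a chord which is not a bridge has end points with
  a unique position; this is why the existential quantifiers over positions below are harmless.\<close>

definition chord_at :: "'v list \<Rightarrow> 'v set \<Rightarrow> nat \<Rightarrow> nat \<Rightarrow> bool" where
  "chord_at w f i j \<longleftrightarrow> i < j \<and> j < length w - 1 \<and> f = {w ! i, w ! j}"

definition outer_part :: "'v list \<Rightarrow> nat \<Rightarrow> nat \<Rightarrow> 'v list" where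
  "outer_part w i j = take (Suc i) w @ drop j w"

definition inner_part :: "'v list \<Rightarrow> nat \<Rightarrow> nat \<Rightarrow> 'v list" where
  "inner_part w i j = drop i (take (Suc j) w) @ [w ! i]"

definition bridge :: "'v sgraph \<Rightarrow> 'v list \<Rightarrow> 'v set \<Rightarrow> bool" where
  "bridge G w f \<longleftrightarrow> chord G w f \<and>
     (\<exists>x y B1 B2. f = {x, y} \<and> block (walk_graph w) B1 \<and> block (walk_graph w) B2 \<and>
        B1 \<noteq> B2 \<and> x \<in> verts B1 \<and> y \<in> verts B2)"

definition odd_chord :: "'v sgraph \<Rightarrow> 'v list \<Rightarrow> 'v set \<Rightarrow> bool" where
  "odd_chord G w f \<longleftrightarrow> chord G w f \<and> \<not> bridge G w f \<and>
     (\<exists>i j. chord_at w f i j \<and> \<not> even_walk (outer_part w i j) \<and> \<not> even_walk (inner_part w i j))"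

definition cross_effectively :: "'v sgraph \<Rightarrow> 'v list \<Rightarrow> 'v set \<Rightarrow> 'v set \<Rightarrow> bool" where
  "cross_effectively G w f f' \<longleftrightarrow> odd_chord G w f \<and> odd_chord G w f' \<and>
     (\<exists>s j s' j'. chord_at w f s j \<and> chord_at w f' s' j' \<and> odd (int s' - int s) \<and>
        (s < s' \<and> s' < j \<and> j < j' \<or> s' < s \<and> s < j' \<and> j' < j))"

definition F4 :: "'v sgraph \<Rightarrow> 'v list \<Rightarrow> 'v set \<Rightarrow> 'v set \<Rightarrow> 'v set \<Rightarrow> 'v set \<Rightarrow> bool" where
  "F4 G w e f e' f' \<longleftrightarrow>
     (\<exists>a b c d. distinct [a, b, c, d] \<and> e = {a, b} \<and> f = {b, c} \<and> e' = {c, d} \<and> f' = {d, a}) \<and>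
     (\<exists>i j. i < length (walk_edges w) \<and> j < length (walk_edges w) \<and> (even i \<longleftrightarrow> even j) \<and>
        e = walk_edges w ! i \<and> e' = walk_edges w ! j) \<and>
     cross_effectively G w f f'"

definition cross_strongly_effectively :: "'v sgraph \<Rightarrow> 'v list \<Rightarrow> 'v set \<Rightarrow> 'v set \<Rightarrow> bool" where
  "cross_strongly_effectively G w f f' \<longleftrightarrow>
     cross_effectively G w f f' \<and> (\<nexists>e e'. F4 G w e f e' f')"

text \<open>Rewriting \<open>w\<close> from another starting vertex as \<open>(w1, e1, w2, e2)\<close> makes
  \<open>w1 @ w2 @ [hd w1]\<close> its list of vertices.\<close>

definition crosses_F4 ::
  "'v sgraph \<Rightarrow> 'v list \<Rightarrow> 'v set \<Rightarrow> 'v set \<Rightarrow> 'v set \<Rightarrow> 'v set \<Rightarrow> 'v set \<Rightarrow> bool" where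
  "crosses_F4 G w f e1 f1 e2 f2 \<longleftrightarrow>
     F4 G w e1 f1 e2 f2 \<and> odd_chord G w f \<and> f \<noteq> f1 \<and> f \<noteq> f2 \<and>
     (\<exists>n w1 w2. rotate n (butlast w) = w1 @ w2 \<and> walk G w1 \<and> walk G w2 \<and>
        e1 = {last w1, hd w2} \<and> e2 = {last w2, hd w1} \<and>
        (\<exists>x y. f = {x, y} \<and> x \<in> set w1 \<and> y \<in> set w2))"

section \<open>Basic facts\<close>

lemma cring_edge_ring: "cring (edge_ring G :: ('v, 'k::field) edge_poly ring)"
proof (rule cringI)
  let ?R = "edge_ring G :: ('v, 'k) edge_poly ring"
  have add: "x + y \<in> carrier ?R" if "x \<in> carrier ?R" "y \<in> carrier ?R" for x y
    using that keys_add[of x y] unfolding edge_ring_def by (simp; blast)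
  have mult: "x * y \<in> carrier ?R" if xy: "x \<in> carrier ?R" "y \<in> carrier ?R" for x y
  proof -
    have "Poly_Mapping.keys u \<subseteq> edges G" if u: "u \<in> Poly_Mapping.keys (x * y)" for u
    proof -
      obtain a b where "a \<in> Poly_Mapping.keys x" "b \<in> Poly_Mapping.keys y" "u = a + b"
        using u keys_mult[of x y] by blast
      moreover from this have "Poly_Mapping.keys a \<subseteq> edges G" "Poly_Mapping.keys b \<subseteq> edges G"
        using xy by (simp_all add: edge_ring_def)
      ultimately show ?thesis using keys_add[of a b] by blast
    qed
    then show ?thesis by (simp add: edge_ring_def)
  qed
  have minus: "- x \<in> carrier ?R" if "x \<in> carrier ?R" for x
    using that by (simp add: edge_ring_def)
  have one: "1 \<in> carrier ?R" by (simp add: edge_ring_def)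
  have ops: "x \<oplus>\<^bsub>?R\<^esub> y = x + y" "x \<otimes>\<^bsub>?R\<^esub> y = x * y" "\<zero>\<^bsub>?R\<^esub> = 0" "\<one>\<^bsub>?R\<^esub> = 1" for x y
    by (simp_all add: edge_ring_def)
  have zero: "0 \<in> carrier ?R" by (simp add: edge_ring_def)
  show "abelian_group ?R"
    by (rule abelian_groupI; unfold ops)
      (simp_all add: zero add ac_simps, metis minus add.right_inverse)
  show "comm_monoid ?R"
    by (rule comm_monoidI; unfold ops) (simp_all add: one mult ac_simps)
  show "(x \<oplus>\<^bsub>?R\<^esub> y) \<otimes>\<^bsub>?R\<^esub> z = x \<otimes>\<^bsub>?R\<^esub> z \<oplus>\<^bsub>?R\<^esub> y \<otimes>\<^bsub>?R\<^esub> z" for x y z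
    by (simp add: edge_ring_def distrib_right)
qed

lemma ideal_toric_ideal: "ideal (toric_ideal G) (edge_ring G :: ('v, 'k::field) edge_poly ring)"
proof -
  interpret cring "edge_ring G :: ('v, 'k) edge_poly ring" by (rule cring_edge_ring)
  show ?thesis unfolding toric_ideal_def
  proof (rule genideal_ideal, safe)
    fix u v :: "'v edge_monom"
    assume "Poly_Mapping.keys u \<subseteq> edges G" "Poly_Mapping.keys v \<subseteq> edges G"
    then show "(pure_binomial u v :: ('v, 'k) edge_poly) \<in> carrier (edge_ring G)"
      using keys_diff[of "Poly_Mapping.single u (1::'k)" "Poly_Mapping.single v 1"]
      by (simp add: edge_ring_def pure_binomial_def subset_iff) blast
  qed
qed

end

theory Submission
  imports Defs
begin

text \<open>The binomial of \<open>w\<close> is minimal iff its two monomials lie in different components of the graph on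
  their fibre in which monomials with a common variable are adjacent.

  Read as a periodic sequence, a primitive walk visits a vertex at most twice, the two positions have
  opposite parity, and the pairs of positions with equal vertices do not cross.  The blocks of the
  walk are the regions cut out by this noncrossing matching, and the sinks of a cyclic block are its
  vertices that are visited twice.

  If one of the conditions fails, an explicit monomial is adjacent to both monomials of the walk (for a
  crossed \<open>F4\<close>, after one exchange): it takes the odd edges on some segments of the walk, the even
  edges on the others, and one or two chords.  Alternating sums of edge degrees telescope, so that its
  degree has to be compared at the ends of the segments only.

  If the conditions hold, a monomial of the fibre matches every position of the walk with a neighbouring
  position or with the other end of a chord, and an innermost chord forces the two chords of an \<open>F4\<close> to
  occur.  Undoing such exchanges one at a time shows that every monomial of the fibre arises by exchanges
  along \<open>F4\<close>s from one of the two monomials of \<open>w\<close>, and the two families have no variable in common.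
  The exception are walks of length four, whose fibre consists of pairwise coprime monomials.\<close>

text \<open>Positions rather than vertices carry the argument. The parity of a position is well
  defined because the period is even, but a vertex visited twice has positions of both parities, and
  a degree of two at that vertex does not tell how it is divided between the visits. A parity count
  repairs this: the variables that leave one side of the vertex are walk edges ending at it, and
  their total exponent is even, so one side receives both units and the other none. Chords that end
  at a repeated vertex or pass between its sides would spoil the count; they are the bridges. Strong
  primitivity excludes that both units fall on an edge traversed only once. The \<open>F4\<close>
  condition has a different role. A chord of an \<open>F4\<close> goes with the parity of the two
  walk edges that it replaces. This is ambiguous only if \<open>a - 1\<close>, \<open>a\<close>,
  \<open>a + 1\<close> are joined by chords to \<open>b - 1\<close>, \<open>b\<close>,
  \<open>b + 1\<close>, and then an outer chord crosses the \<open>F4\<close> of the other two. In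
  length four the two outer chords coincide, so nothing crosses and a separate argument is required.
  The field does not matter: membership of a binomial in an ideal generated by binomials is decided
  by chains of monomials.\<close>

abbreviation keys where "keys \<equiv> Poly_Mapping.keys"

section \<open>Degrees and fibres\<close>

definition vdeg :: "'v edge_monom \<Rightarrow> 'v \<Rightarrow> nat" where
  "vdeg u x = (\<Sum>e\<in>keys u. if x \<in> e then Poly_Mapping.lookup u e else 0)"

definition tdeg :: "'v edge_monom \<Rightarrow> nat" where
  "tdeg u = (\<Sum>e\<in>keys u. Poly_Mapping.lookup u e)"

lemma vdeg_add: "vdeg (u + v) x = vdeg u x + vdeg v x"
  unfolding vdeg_def by (rule setsum_keys_plus_distrib) auto

lemma tdeg_add: "tdeg (u + v) = tdeg u + tdeg v"
  unfolding tdeg_def by (rule setsum_keys_plus_distrib) auto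

lemma vdeg_0 [simp]: "vdeg 0 x = 0" and tdeg_0 [simp]: "tdeg 0 = 0"
  by (simp_all add: vdeg_def tdeg_def)

lemma vdeg_single [simp]: "vdeg (Poly_Mapping.single e k) x = (if x \<in> e then k else 0)"
  and tdeg_single [simp]: "tdeg (Poly_Mapping.single e k) = k"
  by (auto simp: vdeg_def tdeg_def)

lemma tdeg_eq_0_iff: "tdeg u = 0 \<longleftrightarrow> u = 0"
  by (auto simp: tdeg_def in_keys_iff intro!: poly_mapping_eqI)

lemma keys_add_nat: "keys (u + v) = keys u \<union> keys v"
  for u v :: "'a \<Rightarrow>\<^sub>0 nat"
  by (auto simp: in_keys_iff lookup_add)

lemma edge_finite: "finite_simple_graph G \<Longrightarrow> e \<in> edges G \<Longrightarrow> finite e \<and> card e = 2 \<and> e \<subseteq> verts G"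
  unfolding finite_simple_graph_def by fastforce

lemma lookup_edge_vector:
  assumes "finite e" shows "Poly_Mapping.lookup (edge_vector e) x = (if x \<in> e then 1 else 0)"
  using assms by (simp add: edge_vector_def lookup_sum)

lemma lookup_monom_degree:
  assumes "finite_simple_graph G" "keys u \<subseteq> edges G"
  shows "Poly_Mapping.lookup (monom_degree u) x = int (vdeg u x)"
proof -
  have "Poly_Mapping.lookup (monom_degree u) x =
      (\<Sum>e\<in>keys u. int (Poly_Mapping.lookup u e) * (if x \<in> e then 1 else 0))"
    unfolding monom_degree_def lookup_sum lookup_frag_cmul
    using assms(2) edge_finite[OF assms(1)] by (intro sum.cong) (auto simp: lookup_edge_vector)
  then show ?thesis by (simp add: vdeg_def of_nat_sum if_distrib cong: if_cong)
qed

lemma monom_degree_eq_iff: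
  assumes "finite_simple_graph G" "keys u \<subseteq> edges G" "keys v \<subseteq> edges G"
  shows "monom_degree u = monom_degree v \<longleftrightarrow> vdeg u = vdeg v"
  using lookup_monom_degree[OF assms(1,2)] lookup_monom_degree[OF assms(1,3)]
  by (metis ext of_nat_eq_iff poly_mapping_eqI)

lemma sum_vdeg:
  assumes "finite_simple_graph G" "keys u \<subseteq> edges G"
  shows "(\<Sum>x\<in>verts G. vdeg u x) = 2 * tdeg u"
proof -
  have fin: "finite (verts G)" using assms(1) by (simp add: finite_simple_graph_def)
  have "(\<Sum>x\<in>verts G. vdeg u x) =
      (\<Sum>e\<in>keys u. \<Sum>x\<in>verts G. if x \<in> e then Poly_Mapping.lookup u e else 0)"
    unfolding vdeg_def by (rule sum.swap)
  also have "\<dots> = (\<Sum>e\<in>keys u. 2 * Poly_Mapping.lookup u e)"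
  proof (rule sum.cong[OF refl])
    fix e assume "e \<in> keys u"
    then have "card e = 2" "e \<subseteq> verts G" using assms edge_finite by blast+
    then show "(\<Sum>x\<in>verts G. if x \<in> e then Poly_Mapping.lookup u e else 0) = 2 * Poly_Mapping.lookup u e"
      using fin by (simp add: sum.inter_restrict[symmetric] Int_absorb1)
  qed
  finally show ?thesis by (simp add: tdeg_def sum_distrib_left)
qed

text \<open>By the handshake count a fibre is homogeneous, which makes induction on the total degree
  possible.\<close>

lemma tdeg_eq:
  assumes "finite_simple_graph G" "keys u \<subseteq> edges G" "keys v \<subseteq> edges G"
    "vdeg u = vdeg v"
  shows "tdeg u = tdeg v"
  using sum_vdeg[OF assms(1,2)] sum_vdeg[OF assms(1,3)] assms(4) by simp

text \<open>The difference of two adjacent monomials is a variable times a binomial of smaller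
  degree, so it costs no generator of its own degree.\<close>

definition fiber_step :: "'v sgraph \<Rightarrow> ('v edge_monom \<times> 'v edge_monom) set" where
  "fiber_step G = {(u, v). keys u \<subseteq> edges G \<and> keys v \<subseteq> edges G \<and>
     vdeg u = vdeg v \<and> keys u \<inter> keys v \<noteq> {}}"

definition fiber_conn :: "'v sgraph \<Rightarrow> 'v edge_monom \<Rightarrow> 'v edge_monom \<Rightarrow> bool" where
  "fiber_conn G u v \<longleftrightarrow> (u, v) \<in> (fiber_step G)\<^sup>*"

lemma fiber_conn_refl [simp]: "fiber_conn G u u"
  by (simp add: fiber_conn_def)

lemma fiber_conn_trans: "fiber_conn G u v \<Longrightarrow> fiber_conn G v z \<Longrightarrow> fiber_conn G u z"
  by (simp add: fiber_conn_def)

lemma fiber_conn_sym: "fiber_conn G u v \<Longrightarrow> fiber_conn G v u"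
proof -
  have "sym (fiber_step G)" by (auto simp: sym_def fiber_step_def)
  then show "fiber_conn G u v \<Longrightarrow> fiber_conn G v u"
    unfolding fiber_conn_def by (meson sym_rtrancl symD)
qed

lemma fiber_connI:
  assumes "keys u \<subseteq> edges G" "keys v \<subseteq> edges G" "vdeg u = vdeg v"
    "e \<in> keys u" "e \<in> keys v"
  shows "fiber_conn G u v"
  using assms by (auto simp: fiber_conn_def fiber_step_def)

text \<open>The support condition is an implication because the empty chain gives no information on
  \<open>u\<close>.\<close>

lemma fiber_conn_degree:
  assumes "fiber_conn G u v"
  shows "vdeg u = vdeg v \<and> (keys u \<subseteq> edges G \<longrightarrow> keys v \<subseteq> edges G)"
  using assms unfolding fiber_conn_def
  by (induction rule: rtrancl_induct) (auto simp: fiber_step_def)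

section \<open>Membership in ideals generated by binomials\<close>

text \<open>A linear functional that vanishes on every binomial whose two monomials lie on the same
  side of \<open>C\<close>. Such functionals serve as certificates of non-membership in a binomial
  ideal.\<close>

definition class_sum :: "'a set \<Rightarrow> ('a \<Rightarrow>\<^sub>0 'k::field) \<Rightarrow> 'k" where
  "class_sum C p = (\<Sum>m\<in>keys p. if m \<in> C then Poly_Mapping.lookup p m else 0)"

lemma class_sum_add: "class_sum C (p + q) = class_sum C p + class_sum C q"
  unfolding class_sum_def by (rule setsum_keys_plus_distrib) auto

lemma class_sum_0 [simp]: "class_sum C 0 = 0"
  by (simp add: class_sum_def)

lemma class_sum_uminus: "class_sum C (- p) = - class_sum C p"
proof -
  have "class_sum C (- p) + class_sum C p = class_sum C (- p + p)"
    by (simp only: class_sum_add)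
  also have "\<dots> = 0" by simp
  finally show ?thesis by (simp add: eq_neg_iff_add_eq_0)
qed

lemma class_sum_diff: "class_sum C (p - q) = class_sum C p - class_sum C q"
  by (metis class_sum_add class_sum_uminus uminus_add_conv_diff add.commute)

lemma class_sum_single [simp]: "class_sum C (Poly_Mapping.single m k) = (if m \<in> C then k else 0)"
  by (auto simp: class_sum_def)

lemma class_sum_sum: "class_sum C (\<Sum>i\<in>I. f i) = (\<Sum>i\<in>I. class_sum C (f i))"
  by (induction I rule: infinite_finite_induct) (auto simp: class_sum_add)

lemma sum_singles: "p = (\<Sum>m\<in>keys p. Poly_Mapping.single m (Poly_Mapping.lookup p m))"
  by (rule poly_mapping_eqI) (auto simp: lookup_sum lookup_single when_def in_keys_iff)

text \<open>Multiplication by the monomial \<open>s\<close> pulls the class back along translation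
  by \<open>s\<close>. In this form the vanishing of class sums is seen to be inherited by
  multiples.\<close>

lemma class_sum_mult:
  fixes p q :: "'a::cancel_comm_monoid_add \<Rightarrow>\<^sub>0 'k::field"
  shows "class_sum C (p * q) =
    (\<Sum>s\<in>keys p. Poly_Mapping.lookup p s * class_sum {t. s + t \<in> C} q)"
proof -
  have "p * q = (\<Sum>s\<in>keys p. Poly_Mapping.single s (Poly_Mapping.lookup p s)) *
      (\<Sum>t\<in>keys q. Poly_Mapping.single t (Poly_Mapping.lookup q t))"
    using sum_singles[of p] sum_singles[of q] by simp
  also have "\<dots> = (\<Sum>s\<in>keys p. \<Sum>t\<in>keys q.
      Poly_Mapping.single (s + t) (Poly_Mapping.lookup p s * Poly_Mapping.lookup q t))"
    by (simp add: sum_product mult_single)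
  finally show ?thesis
    by (simp add: class_sum_sum class_sum_def[of _ q] sum_distrib_left if_distrib cong: if_cong)
qed

text \<open>Both orientations are included, which makes the relation symmetric. The supports of
  \<open>a\<close> and \<open>b\<close> are prescribed explicitly since the zero binomial does not
  determine its monomials.\<close>

definition moves :: "'v sgraph \<Rightarrow> ('v, 'k::field) edge_poly set \<Rightarrow> ('v edge_monom \<times> 'v edge_monom) set" where
  "moves G S = {(t + a, t + b) | t a b. keys t \<subseteq> edges G \<and>
     keys a \<subseteq> edges G \<and> keys b \<subseteq> edges G \<and>
     (pure_binomial a b \<in> S \<or> pure_binomial b a \<in> S)}"

definition saturated :: "('a \<times> 'a) set \<Rightarrow> 'a set \<Rightarrow> bool" where
  "saturated R C \<longleftrightarrow> (\<forall>(m, m') \<in> R. m \<in> C \<longleftrightarrow> m' \<in> C)"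

definition binomials :: "'v sgraph \<Rightarrow> ('v, 'k::field) edge_poly set" where
  "binomials G = {pure_binomial u v | u v. keys u \<subseteq> edges G \<and> keys v \<subseteq> edges G}"

lemma moves_translate:
  assumes "(m, m') \<in> moves G S" "keys t \<subseteq> edges G"
  shows "(t + m, t + m') \<in> moves G S"
proof -
  obtain s a b where *: "m = s + a" "m' = s + b" "keys s \<subseteq> edges G"
    "keys a \<subseteq> edges G" "keys b \<subseteq> edges G"
    "pure_binomial a b \<in> S \<or> pure_binomial b a \<in> S"
    using assms(1) by (auto simp: moves_def)
  have "t + m = (t + s) + a" "t + m' = (t + s) + b" "keys (t + s) \<subseteq> edges G"
    using * assms(2) by (simp_all add: add.assoc keys_add_nat)
  then show ?thesis using * unfolding moves_def by blast
qed

lemma moves_rtrancl_translate: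
  assumes "(m, m') \<in> (moves G S)\<^sup>*" "keys t \<subseteq> edges G"
  shows "(t + m, t + m') \<in> (moves G S)\<^sup>*"
  using assms(1) by (induction rule: rtrancl_induct)
    (auto intro: rtrancl.rtrancl_into_rtrancl moves_translate[OF _ assms(2)])

lemma moves_sym: "(m, m') \<in> (moves G S)\<^sup>* \<Longrightarrow> (m', m) \<in> (moves G S)\<^sup>*"
proof -
  have "sym (moves G S)" by (auto simp: sym_def moves_def)
  then show "(m, m') \<in> (moves G S)\<^sup>* \<Longrightarrow> (m', m) \<in> (moves G S)\<^sup>*"
    by (meson sym_rtrancl symD)
qed

lemma binomials_carrier: "(binomials G :: ('v, 'k::field) edge_poly set) \<subseteq> carrier (edge_ring G)"
proof
  fix p :: "('v, 'k) edge_poly" assume "p \<in> binomials G"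
  then obtain u v where "keys u \<subseteq> edges G" "keys v \<subseteq> edges G"
    "p = pure_binomial u v" by (auto simp: binomials_def)
  then show "p \<in> carrier (edge_ring G)"
    using keys_diff[of "Poly_Mapping.single u (1::'k)" "Poly_Mapping.single v 1"]
    by (simp add: edge_ring_def pure_binomial_def subset_iff) blast
qed

text \<open>The polynomials all of whose class sums over saturated sets vanish form an ideal that
  contains \<open>S\<close>. All saturated sets are taken at once, because multiplication by a
  monomial replaces one of them by another.\<close>

lemma genideal_imp_class_sum:
  fixes S :: "('v, 'k::field) edge_poly set"
  assumes S: "S \<subseteq> binomials G" and p: "p \<in> genideal (edge_ring G) S"
    and C: "saturated (moves G S) C"
  shows "class_sum C p = 0"
proof -
  let ?R = "edge_ring G :: ('v, 'k) edge_poly ring"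
  interpret cring ?R by (rule cring_edge_ring)
  let ?J = "{p \<in> carrier ?R. \<forall>C. saturated (moves G S) C \<longrightarrow> class_sum C p = 0}"
  have ops: "x \<oplus>\<^bsub>?R\<^esub> y = x + y" "x \<otimes>\<^bsub>?R\<^esub> y = x * y" "\<zero>\<^bsub>?R\<^esub> = 0" "\<one>\<^bsub>?R\<^esub> = 1" for x y
    by (simp_all add: edge_ring_def)
  have minus: "\<ominus>\<^bsub>?R\<^esub> x = - x" if x: "x \<in> carrier ?R" for x
  proof -
    have "- x \<in> carrier ?R" using x by (simp add: edge_ring_def)
    moreover have "- x \<oplus>\<^bsub>?R\<^esub> x = \<zero>\<^bsub>?R\<^esub>" by (simp add: ops)
    ultimately show ?thesis using x by (metis minus_equality)
  qed
  have mult: "class_sum C (x * a) = 0"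
    if a: "a \<in> ?J" and x: "x \<in> carrier ?R" and C: "saturated (moves G S) C" for a x C
  proof -
    have "class_sum {t. s + t \<in> C} a = 0" if "s \<in> keys x" for s
    proof -
      have "keys s \<subseteq> edges G" using x that by (auto simp: edge_ring_def)
      then have "saturated (moves G S) {t. s + t \<in> C}"
        using C moves_translate unfolding saturated_def by fast
      then show ?thesis using a by blast
    qed
    then show ?thesis by (simp add: class_sum_mult)
  qed
  have "ideal ?J ?R"
  proof (rule idealI)
    show "ring ?R" by (rule ring_axioms)
    have "subgroup ?J (add_monoid ?R)"
    proof (rule add.subgroupI)
      show "?J \<subseteq> carrier ?R" by blast
      have "0 \<in> ?J" using zero_closed by (simp add: ops)
      then show "?J \<noteq> {}" by blast
      show "\<ominus>\<^bsub>?R\<^esub> a \<in> ?J" if "a \<in> ?J" for a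
        using that a_inv_closed[of a] by (simp add: minus class_sum_uminus)
      show "a \<oplus>\<^bsub>?R\<^esub> b \<in> ?J" if "a \<in> ?J" "b \<in> ?J" for a b
        using that a_closed[of a b] by (simp add: ops class_sum_add)
    qed
    then show "subgroup ?J (add_monoid ?R)" .
    show l: "x \<otimes>\<^bsub>?R\<^esub> a \<in> ?J" if "a \<in> ?J" "x \<in> carrier ?R" for a x
      using that mult[OF that] m_closed[of x a] by (auto simp: ops)
    show "a \<otimes>\<^bsub>?R\<^esub> x \<in> ?J" if "a \<in> ?J" "x \<in> carrier ?R" for a x
      using l[OF that] m_comm that by auto
  qed
  moreover have "S \<subseteq> ?J"
  proof
    fix p assume p: "p \<in> S"
    then obtain u v where uv: "keys u \<subseteq> edges G" "keys v \<subseteq> edges G"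
      "p = pure_binomial u v" using S by (auto simp: binomials_def)
    have "(0 + u, 0 + v) \<in> moves G S" unfolding moves_def using uv p by fastforce
    then have "saturated (moves G S) C \<Longrightarrow> u \<in> C \<longleftrightarrow> v \<in> C" for C
      by (auto simp: saturated_def)
    then have "saturated (moves G S) C \<Longrightarrow> class_sum C p = 0" for C
      by (auto simp: uv pure_binomial_def class_sum_diff)
    then show "p \<in> ?J" using S p binomials_carrier by blast
  qed
  ultimately have "genideal ?R S \<subseteq> ?J" by (rule genideal_minimal)
  then show ?thesis using p C by blast
qed

text \<open>Along a chain of moves the binomial is a telescoping sum of monomial multiples of
  elements of \<open>S\<close>, up to sign.\<close>

lemma moves_imp_genideal:
  fixes S :: "('v, 'k::field) edge_poly set"
  assumes S: "S \<subseteq> binomials G" and m: "(m, m') \<in> (moves G S)\<^sup>*"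
  shows "pure_binomial m m' \<in> genideal (edge_ring G) S"
proof -
  let ?R = "edge_ring G :: ('v, 'k) edge_poly ring"
  interpret cring ?R by (rule cring_edge_ring)
  have SC: "S \<subseteq> carrier ?R" using S binomials_carrier by blast
  interpret I: ideal "genideal ?R S" ?R by (rule genideal_ideal[OF SC])
  have ops: "x \<oplus>\<^bsub>?R\<^esub> y = x + y" "x \<otimes>\<^bsub>?R\<^esub> y = x * y" "\<zero>\<^bsub>?R\<^esub> = 0" for x y
    by (simp_all add: edge_ring_def)
  have neg: "- p \<in> genideal ?R S" if "p \<in> genideal ?R S" for p
  proof -
    have "- 1 \<in> carrier ?R" by (simp add: edge_ring_def)
    from I.I_l_closed[OF that this] show ?thesis by (simp add: ops)
  qed
  have step: "pure_binomial a b \<in> genideal ?R S" if ab: "(a, b) \<in> moves G S" for a b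
  proof -
    obtain t c d where t: "a = t + c" "b = t + d" "keys t \<subseteq> edges G"
      and cd: "pure_binomial c d \<in> S \<or> pure_binomial d c \<in> S"
      using ab by (auto simp: moves_def)
    have "pure_binomial c d = - (pure_binomial d c :: ('v, 'k) edge_poly)"
      by (simp add: pure_binomial_def)
    then have "pure_binomial c d \<in> genideal ?R S"
      using cd genideal_self[OF SC] neg by (metis subsetD)
    moreover have "Poly_Mapping.single t 1 \<in> carrier ?R" using t(3) by (simp add: edge_ring_def)
    ultimately have "Poly_Mapping.single t 1 \<otimes>\<^bsub>?R\<^esub> pure_binomial c d \<in> genideal ?R S"
      by (rule I.I_l_closed)
    moreover have "Poly_Mapping.single t 1 * pure_binomial c d = (pure_binomial a b :: ('v, 'k) edge_poly)"
      by (simp add: pure_binomial_def t algebra_simps mult_single)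
    ultimately show ?thesis by (simp add: ops)
  qed
  show ?thesis using m
  proof (induction rule: rtrancl_induct)
    case base
    have "pure_binomial m m = (0 :: ('v, 'k) edge_poly)" by (simp add: pure_binomial_def)
    then show ?case using I.zero_closed by (simp add: ops)
  next
    case (step y z)
    have "pure_binomial m y + pure_binomial y z = (pure_binomial m z :: ('v, 'k) edge_poly)"
      by (simp add: pure_binomial_def)
    then show ?case using I.a_closed[OF step.IH] step.hyps(2) \<open>\<And>b a. (a, b) \<in> moves G S \<Longrightarrow> pure_binomial a b \<in> genideal ?R S\<close>
      by (metis ops(1))
  qed
qed

lemma pure_binomial_in_genideal_iff:
  fixes S :: "('v, 'k::field) edge_poly set"
  assumes S: "S \<subseteq> binomials G"
  shows "pure_binomial m m' \<in> genideal (edge_ring G) S \<longleftrightarrow> (m, m') \<in> (moves G S)\<^sup>*"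
proof
  assume *: "pure_binomial m m' \<in> genideal (edge_ring G) S"
  \<comment> \<open>For the class of \<open>m\<close> itself the class sum of the binomial is one,
    unless \<open>m'\<close> belongs to the class as well.\<close>
  let ?C = "{z. (m, z) \<in> (moves G S)\<^sup>*}"
  have "saturated (moves G S) ?C" unfolding saturated_def
  proof safe
    fix a b assume ab: "(a, b) \<in> moves G S"
    show "(m, a) \<in> (moves G S)\<^sup>* \<Longrightarrow> (m, b) \<in> (moves G S)\<^sup>*"
      using r_into_rtrancl[OF ab] by (rule rtrancl_trans[rotated])
    show "(m, b) \<in> (moves G S)\<^sup>* \<Longrightarrow> (m, a) \<in> (moves G S)\<^sup>*"
      using moves_sym[OF r_into_rtrancl[OF ab]] by (rule rtrancl_trans[rotated])
  qed
  from genideal_imp_class_sum[OF S * this] show "(m, m') \<in> (moves G S)\<^sup>*"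
    by (auto simp: pure_binomial_def class_sum_diff split: if_splits)
qed (rule moves_imp_genideal[OF S])

text \<open>Only the unordered pair can be recovered, since in characteristic two a binomial equals
  its negative. The first alternative is the zero binomial.\<close>

lemma pure_binomial_eq:
  assumes "pure_binomial a b = (pure_binomial u v :: ('v, 'k::field) edge_poly)"
  shows "a = b \<or> {a, b} = {u, v}"
proof -
  have "Poly_Mapping.lookup (pure_binomial a b :: ('v, 'k) edge_poly) m =
      Poly_Mapping.lookup (pure_binomial u v :: ('v, 'k) edge_poly) m" for m
    by (simp add: assms)
  from this[of a] this[of b] this[of u] this[of v] show ?thesis
    by (auto simp: pure_binomial_def lookup_minus lookup_single when_def split: if_splits)
qed

lemma pure_binomial_toric_iff:
  assumes G: "finite_simple_graph G"
    and uv: "keys u \<subseteq> edges G" "keys v \<subseteq> edges G"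
  shows "(pure_binomial u v :: ('v, 'k::field) edge_poly) \<in> toric_ideal G \<longleftrightarrow> vdeg u = vdeg v"
proof -
  let ?R = "edge_ring G :: ('v, 'k) edge_poly ring"
  interpret cring ?R by (rule cring_edge_ring)
  let ?T = "{pure_binomial u v | u v. keys u \<subseteq> edges G \<and> keys v \<subseteq> edges G \<and>
        monom_degree u = monom_degree v} :: ('v, 'k) edge_poly set"
  have T: "?T \<subseteq> binomials G" by (auto simp: binomials_def)
  have deg: "vdeg a = vdeg b" if ab: "(a, b) \<in> moves G ?T" for a b
  proof -
    obtain t c d where t: "a = t + c" "b = t + d"
      and cd: "pure_binomial c d \<in> ?T \<or> pure_binomial d c \<in> ?T"
      using ab unfolding moves_def by blast
    have tt: "vdeg x = vdeg y" if xy: "pure_binomial x y \<in> ?T" for x y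
    proof -
      obtain p q where "keys p \<subseteq> edges G" "keys q \<subseteq> edges G"
        "monom_degree p = monom_degree q" "pure_binomial x y = (pure_binomial p q :: ('v, 'k) edge_poly)"
        using xy by blast
      then have "vdeg p = vdeg q" "x = y \<or> {x, y} = {p, q}"
        using monom_degree_eq_iff[OF G, of p q] pure_binomial_eq[of x y p q] by simp_all
      then show ?thesis by (metis doubleton_eq_iff)
    qed
    have "vdeg c = vdeg d" using cd by (rule disjE) (erule tt, erule tt[symmetric])
    then show ?thesis by (simp add: t vdeg_add fun_eq_iff)
  qed
  show ?thesis
  proof
    assume "(pure_binomial u v :: ('v, 'k) edge_poly) \<in> toric_ideal G"
    then have "(u, v) \<in> (moves G ?T)\<^sup>*"
      unfolding toric_ideal_def pure_binomial_in_genideal_iff[OF T] .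
    then show "vdeg u = vdeg v"
      by (induction rule: rtrancl_induct) (auto dest: deg)
  next
    assume "vdeg u = vdeg v"
    then have "pure_binomial u v \<in> ?T" using uv monom_degree_eq_iff[OF G uv] by blast
    then show "(pure_binomial u v :: ('v, 'k) edge_poly) \<in> toric_ideal G"
      unfolding toric_ideal_def using genideal_self T binomials_carrier by (meson subset_trans subsetD)
  qed
qed

lemma moves_toric:
  assumes G: "finite_simple_graph G" and S: "S \<subseteq> toric_ideal G"
    and m: "(m, m') \<in> moves G S"
  shows "keys m \<subseteq> edges G" "keys m' \<subseteq> edges G" "vdeg m = vdeg m'"
proof -
  obtain t a b where t: "m = t + a" "m' = t + b" "keys t \<subseteq> edges G"
    "keys a \<subseteq> edges G" "keys b \<subseteq> edges G"
    and "pure_binomial a b \<in> S \<or> pure_binomial b a \<in> S"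
    using m unfolding moves_def by blast
  then have "vdeg a = vdeg b"
    using pure_binomial_toric_iff[OF G, of a b] pure_binomial_toric_iff[OF G, of b a] S by auto
  then show "keys m \<subseteq> edges G" "keys m' \<subseteq> edges G" "vdeg m = vdeg m'"
    unfolding t(1,2) using t(3-5) by (simp_all add: keys_add_nat vdeg_add fun_eq_iff)
qed

text \<open>From here on generation is a purely combinatorial statement: the moves have to connect
  every fibre.\<close>

lemma binomial_generators_iff:
  assumes G: "finite_simple_graph G"
  shows "binomial_generators G (S :: ('v, 'k::field) edge_poly set) \<longleftrightarrow>
    S \<subseteq> binomials G \<and> S \<subseteq> toric_ideal G \<and>
    (\<forall>m m'. keys m \<subseteq> edges G \<longrightarrow> keys m' \<subseteq> edges G \<longrightarrow> vdeg m = vdeg m' \<longrightarrow>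
      (m, m') \<in> (moves G S)\<^sup>*)" (is "_ \<longleftrightarrow> _ \<and> _ \<and> ?P")
proof -
  let ?R = "edge_ring G :: ('v, 'k) edge_poly ring"
  interpret cring ?R by (rule cring_edge_ring)
  have "genideal ?R S = toric_ideal G \<longleftrightarrow> ?P" if S: "S \<subseteq> binomials G" "S \<subseteq> toric_ideal G"
  proof
    assume "genideal ?R S = toric_ideal G"
    then show ?P using pure_binomial_toric_iff[OF G] pure_binomial_in_genideal_iff[OF S(1)] by metis
  next
    assume P: ?P
    have "genideal ?R S \<subseteq> toric_ideal G"
      using S(2) ideal_toric_ideal by (rule genideal_minimal[rotated])
    moreover have "toric_ideal G \<subseteq> genideal ?R S" unfolding toric_ideal_def
    proof (rule genideal_minimal, rule genideal_ideal)
      show "S \<subseteq> carrier ?R" using S(1) binomials_carrier by blast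
      show "{pure_binomial u v | u v. keys u \<subseteq> edges G \<and> keys v \<subseteq> edges G \<and>
        monom_degree u = monom_degree v} \<subseteq> genideal ?R S"
        using P pure_binomial_in_genideal_iff[OF S(1)] monom_degree_eq_iff[OF G] by fastforce
    qed
    ultimately show "genideal ?R S = toric_ideal G" by blast
  qed
  then show ?thesis unfolding binomial_generators_def binomials_def by blast
qed

lemma keys_diff_single:
  fixes x :: "'a \<Rightarrow>\<^sub>0 nat"
  assumes "e \<in> keys x"
  shows "x = Poly_Mapping.single e 1 + (x - Poly_Mapping.single e 1)"
  using assms by (intro poly_mapping_eqI) (auto simp: lookup_add lookup_minus lookup_single when_def in_keys_iff)

lemma keys_minus_subset:
  fixes x :: "'a \<Rightarrow>\<^sub>0 nat"
  shows "keys (x - y) \<subseteq> keys x"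
  by (auto simp: in_keys_iff lookup_minus)

lemma fiber_stepE:
  assumes G: "finite_simple_graph G" and "(x, y) \<in> fiber_step G"
  obtains e x' y' where "x = Poly_Mapping.single e 1 + x'" "y = Poly_Mapping.single e 1 + y'" "e \<in> edges G"
    "keys x' \<subseteq> edges G" "keys y' \<subseteq> edges G" "vdeg x' = vdeg y'" "tdeg x' < tdeg x"
proof -
  obtain e where e: "e \<in> keys x" "e \<in> keys y"
    "keys x \<subseteq> edges G" "keys y \<subseteq> edges G" "vdeg x = vdeg y"
    using assms by (auto simp: fiber_step_def)
  let ?x = "x - Poly_Mapping.single e 1" and ?y = "y - Poly_Mapping.single e 1"
  have *: "x = Poly_Mapping.single e 1 + ?x" "y = Poly_Mapping.single e 1 + ?y"
    by (rule keys_diff_single[OF e(1)], rule keys_diff_single[OF e(2)])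
  have "vdeg (Poly_Mapping.single e 1 + ?x) = vdeg (Poly_Mapping.single e 1 + ?y)"
    by (simp only: *[symmetric] e(5))
  then have deg: "vdeg ?x = vdeg ?y" by (simp add: vdeg_add fun_eq_iff)
  have "tdeg (Poly_Mapping.single e 1 + ?x) = Suc (tdeg ?x)" by (simp add: tdeg_add)
  then have less: "tdeg ?x < tdeg x" by (simp only: *(1)[symmetric])
  show thesis
    by (rule that[OF * _ _ _ deg less])
      (use e keys_minus_subset[of x] keys_minus_subset[of y] in blast)+
qed

text \<open>A chain of moves that connects two monomials of smaller degree cannot use the binomial
  itself, so it survives the deletion of that binomial.\<close>

lemma minimal_imp_not_conn:
  assumes G: "finite_simple_graph G"
    and uv: "keys u \<subseteq> edges G" "keys v \<subseteq> edges G" "u \<noteq> v"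
    and min: "minimal_binomial G (pure_binomial u v :: ('v, 'k::field) edge_poly)"
  shows "\<not> fiber_conn G u v"
proof
  assume conn: "fiber_conn G u v"
  let ?B = "pure_binomial u v :: ('v, 'k) edge_poly"
  obtain S :: "('v, 'k) edge_poly set" where S: "binomial_generators G S" "?B \<in> S"
    and Smin: "\<And>T. T \<subset> S \<Longrightarrow> \<not> binomial_generators G T"
    using min unfolding minimal_binomial_def by blast
  note S' = S(1)[unfolded binomial_generators_iff[OF G]]
  let ?T = "S - {?B}"
  have T: "?T \<subseteq> binomials G" "?T \<subseteq> toric_ideal G" using S' by blast+
  have eq: "tdeg a = tdeg b" if "(a, b) \<in> moves G S" for a b
    using moves_toric[OF G _ that] S' tdeg_eq[OF G] by blast
  have low: "(a, b) \<in> (moves G ?T)\<^sup>*" if ab: "(a, b) \<in> (moves G S)\<^sup>*" and d: "tdeg a < tdeg u" for a b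
  proof -
    have "(a, b) \<in> (moves G ?T)\<^sup>* \<and> tdeg b = tdeg a"
      using ab
    proof (induction rule: rtrancl_induct)
      case (step y z)
      obtain t c d where t: "y = t + c" "z = t + d" "keys t \<subseteq> edges G"
        "keys c \<subseteq> edges G" "keys d \<subseteq> edges G"
        and cd: "pure_binomial c d \<in> S \<or> pure_binomial d c \<in> S"
        using step.hyps(2) unfolding moves_def by blast
      have yz: "tdeg z = tdeg a" "tdeg y = tdeg a" using step eq by metis+
      have "tdeg u = tdeg v" using conn uv fiber_conn_degree tdeg_eq[OF G] by blast
      moreover have "tdeg c \<le> tdeg a" "tdeg d \<le> tdeg a"
        using yz by (auto simp: t tdeg_add)
      ultimately have ne: "c \<noteq> u" "c \<noteq> v" using d by auto
      have "c = d \<or> (pure_binomial c d \<in> ?T \<or> pure_binomial d c \<in> ?T)"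
        using cd ne pure_binomial_eq[of c d u v] pure_binomial_eq[of d c u v]
        by (auto simp: doubleton_eq_iff)
      then have "y = z \<or> (y, z) \<in> moves G ?T" using t unfolding moves_def by blast
      then show ?case using step yz by (auto intro: rtrancl.rtrancl_into_rtrancl)
    qed simp
    then show ?thesis by simp
  qed
  have "(u, z) \<in> (moves G ?T)\<^sup>*" if "(u, z) \<in> (fiber_step G)\<^sup>*" for z
    using that
  proof (induction rule: rtrancl_induct)
    case (step x y)
    obtain e x' y' where e: "x = Poly_Mapping.single e 1 + x'" "y = Poly_Mapping.single e 1 + y'" "e \<in> edges G"
      "keys x' \<subseteq> edges G" "keys y' \<subseteq> edges G" "vdeg x' = vdeg y'" "tdeg x' < tdeg x"
      using fiber_stepE[OF G step.hyps(2)] by metis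
    have "tdeg x = tdeg u"
      using step.hyps(1) uv fiber_conn_degree[of G u x] tdeg_eq[OF G, of u x] by (simp add: fiber_conn_def)
    moreover have "(x', y') \<in> (moves G S)\<^sup>*" using S' e by blast
    ultimately have "(x', y') \<in> (moves G ?T)\<^sup>*" using low e(7) by metis
    then have "(x, y) \<in> (moves G ?T)\<^sup>*"
      unfolding e(1,2) by (rule moves_rtrancl_translate) (simp add: e(3))
    then show ?case using step.IH by simp
  qed simp
  then have uvT: "(u, v) \<in> (moves G ?T)\<^sup>*" using conn by (simp add: fiber_conn_def)
  \<comment> \<open>The chain from \<open>u\<close> to \<open>v\<close> just found replaces every
    use of the deleted binomial, so the smaller set still generates.\<close>
  have "moves G S \<subseteq> (moves G ?T)\<^sup>*"
  proof clarify
    fix a b assume "(a, b) \<in> moves G S"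
    then obtain t c d where t: "a = t + c" "b = t + d" "keys t \<subseteq> edges G"
      "keys c \<subseteq> edges G" "keys d \<subseteq> edges G"
      and cd: "pure_binomial c d \<in> S \<or> pure_binomial d c \<in> S"
      unfolding moves_def by blast
    show "(a, b) \<in> (moves G ?T)\<^sup>*"
    proof (cases "pure_binomial c d \<in> ?T \<or> pure_binomial d c \<in> ?T")
      case True
      then show ?thesis using t unfolding moves_def by blast
    next
      case False
      then have "c = d \<or> c = u \<and> d = v \<or> c = v \<and> d = u"
        using cd pure_binomial_eq[of c d u v] pure_binomial_eq[of d c u v]
        by (auto simp: doubleton_eq_iff)
      then have "(c, d) \<in> (moves G ?T)\<^sup>*" using uvT moves_sym[OF uvT] by auto
      then show ?thesis using moves_rtrancl_translate t by metis
    qed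
  qed
  then have sub: "(moves G S)\<^sup>* \<subseteq> (moves G ?T)\<^sup>*" by (rule rtrancl_subset_rtrancl)
  have "binomial_generators G ?T"
    unfolding binomial_generators_iff[OF G]
  proof (intro conjI T allI impI)
    fix m m' :: "'v edge_monom"
    assume "keys m \<subseteq> edges G" "keys m' \<subseteq> edges G" "vdeg m = vdeg m'"
    then have "(m, m') \<in> (moves G S)\<^sup>*" using S' by simp
    then show "(m, m') \<in> (moves G ?T)\<^sup>*" using sub by (rule rev_subsetD)
  qed
  moreover have "?T \<subset> S" using S(2) by blast
  ultimately show False using Smin by blast
qed

text \<open>The generating system takes one representative of every connected component of every fibre
  and joins a chosen one to all the others of its fibre.\<close>

lemma not_conn_imp_minimal:
  assumes G: "finite_simple_graph G"
    and uv: "keys u \<subseteq> edges G" "keys v \<subseteq> edges G" "vdeg u = vdeg v"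
    and nconn: "\<not> fiber_conn G u v"
  shows "minimal_binomial G (pure_binomial u v :: ('v, 'k::field) edge_poly)"
proof -
  define E :: "'v edge_monom set" where "E = {m. keys m \<subseteq> edges G}"
  \<comment> \<open>\<open>u\<close> and \<open>v\<close> are forced to represent their own
    components, so that their difference itself becomes a member of the generating system.\<close>
  define \<rho> where "\<rho> m = (if fiber_conn G u m then u else if fiber_conn G v m then v
    else SOME z. fiber_conn G m z)" for m
  have \<rho>1: "fiber_conn G m (\<rho> m)" for m
  proof -
    have "fiber_conn G m (SOME z. fiber_conn G m z)" by (rule someI[of _ m]) simp
    then show ?thesis by (auto simp: \<rho>_def intro: fiber_conn_sym)
  qed
  have \<rho>2: "\<rho> m = \<rho> m'" if "fiber_conn G m m'" for m m'
  proof -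
    have "fiber_conn G z m \<longleftrightarrow> fiber_conn G z m'" "fiber_conn G m z \<longleftrightarrow> fiber_conn G m' z" for z
      using that fiber_conn_trans fiber_conn_sym by blast+
    then have "fiber_conn G m = fiber_conn G m'" "fiber_conn G u m = fiber_conn G u m'"
      "fiber_conn G v m = fiber_conn G v m'" by blast+
    then show ?thesis by (simp only: \<rho>_def)
  qed
  have \<rho>u: "\<rho> u = u" and \<rho>v: "\<rho> v = v" using nconn by (simp_all add: \<rho>_def)
  have \<rho>E: "\<rho> m \<in> E" "vdeg (\<rho> m) = vdeg m" if "m \<in> E" for m
    using fiber_conn_degree[OF \<rho>1[of m]] that by (auto simp: E_def)
  have \<rho>\<rho>: "\<rho> (\<rho> m) = \<rho> m" for m by (rule \<rho>2[OF \<rho>1, symmetric])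
  \<comment> \<open>The centre of the star in the fibre of degree \<open>d\<close>; in the fibre of
    \<open>u\<close> and \<open>v\<close> it is \<open>u\<close>.\<close>
  define \<kappa> where "\<kappa> d = (if d = vdeg u then u else \<rho> (SOME m. m \<in> E \<and> vdeg m = d))" for d
  have \<kappa>: "\<kappa> (vdeg m) \<in> E" "vdeg (\<kappa> (vdeg m)) = vdeg m" "\<rho> (\<kappa> (vdeg m)) = \<kappa> (vdeg m)" if "m \<in> E" for m
  proof -
    let ?x = "SOME m'. m' \<in> E \<and> vdeg m' = vdeg m"
    have x: "?x \<in> E \<and> vdeg ?x = vdeg m"
      by (rule someI[of _ m]) (simp add: that)
    have "\<kappa> (vdeg m) \<in> E \<and> vdeg (\<kappa> (vdeg m)) = vdeg m \<and> \<rho> (\<kappa> (vdeg m)) = \<kappa> (vdeg m)"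
    proof (cases "vdeg m = vdeg u")
      case True
      then show ?thesis using uv(1) by (simp add: \<kappa>_def E_def \<rho>u)
    next
      case False
      then have "\<kappa> (vdeg m) = \<rho> ?x" by (simp add: \<kappa>_def)
      then show ?thesis using x \<rho>E[of ?x] \<rho>\<rho>[of ?x] by simp
    qed
    then show "\<kappa> (vdeg m) \<in> E" "vdeg (\<kappa> (vdeg m)) = vdeg m" "\<rho> (\<kappa> (vdeg m)) = \<kappa> (vdeg m)"
      by simp_all
  qed
  define S :: "('v, 'k) edge_poly set" where
    "S = {pure_binomial (\<kappa> (vdeg m)) (\<rho> m) | m. m \<in> E \<and> \<rho> m \<noteq> \<kappa> (vdeg m)}"
  have S1: "S \<subseteq> binomials G"
  proof
    fix p assume "p \<in> S"
    then obtain m where "m \<in> E" "p = pure_binomial (\<kappa> (vdeg m)) (\<rho> m)" unfolding S_def by blast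
    then show "p \<in> binomials G" using \<kappa>(1)[of m] \<rho>E(1)[of m] unfolding binomials_def E_def by blast
  qed
  have S2: "S \<subseteq> toric_ideal G"
  proof
    fix p assume "p \<in> S"
    then obtain m where m: "m \<in> E" "p = pure_binomial (\<kappa> (vdeg m)) (\<rho> m)" unfolding S_def by blast
    have "vdeg (\<kappa> (vdeg m)) = vdeg (\<rho> m)" using \<kappa>(2)[OF m(1)] \<rho>E(2)[OF m(1)] by simp
    then show "p \<in> toric_ideal G"
      using pure_binomial_toric_iff[OF G, of "\<kappa> (vdeg m)" "\<rho> m"] \<kappa>(1)[OF m(1)] \<rho>E(1)[OF m(1)]
      by (simp add: E_def m(2))
  qed
  have gen: "(m, m') \<in> (moves G S)\<^sup>*" if "m \<in> E" "m' \<in> E" "vdeg m = vdeg m'" for m m'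
    using that
  proof (induction "tdeg m" arbitrary: m m' rule: less_induct)
    case less
    \<comment> \<open>Neighbours inside a component have a common variable. Once it is cancelled
      they lie in a fibre of smaller degree, where the induction hypothesis connects them.\<close>
    have conn: "(x, y) \<in> (moves G S)\<^sup>*" if xy: "fiber_conn G x y" and x: "x \<in> E" "tdeg x = tdeg m" for x y
      using xy unfolding fiber_conn_def
    proof (induction rule: rtrancl_induct)
      case (step a b)
      obtain e a' b' where e: "a = Poly_Mapping.single e 1 + a'" "b = Poly_Mapping.single e 1 + b'" "e \<in> edges G"
        "keys a' \<subseteq> edges G" "keys b' \<subseteq> edges G" "vdeg a' = vdeg b'" "tdeg a' < tdeg a"
        using fiber_stepE[OF G step.hyps(2)] by metis
      have "tdeg a = tdeg m"
        using step.hyps(1) x fiber_conn_degree[of G x a] tdeg_eq[OF G, of x a] by (simp add: fiber_conn_def E_def)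
      then have "(a', b') \<in> (moves G S)\<^sup>*" using less(1)[of a' b'] e by (simp add: E_def)
      then have "(a, b) \<in> (moves G S)\<^sup>*"
        unfolding e(1,2) by (rule moves_rtrancl_translate) (simp add: e(3))
      then show ?case using step.IH by simp
    qed simp
    have to\<kappa>: "(x, \<kappa> (vdeg x)) \<in> (moves G S)\<^sup>*" if x: "x \<in> E" "tdeg x = tdeg m" for x
    proof -
      have "(\<rho> x, \<kappa> (vdeg x)) \<in> (moves G S)\<^sup>*"
      proof (cases "\<rho> x = \<kappa> (vdeg x)")
        case False
        then have "pure_binomial (\<kappa> (vdeg x)) (\<rho> x) \<in> S" using x unfolding S_def by blast
        then have "(0 + \<rho> x, 0 + \<kappa> (vdeg x)) \<in> moves G S"
          unfolding moves_def mem_Collect_eq using \<kappa>(1)[OF x(1)] \<rho>E(1)[OF x(1)]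
          by (intro exI[of _ 0] exI[of _ "\<rho> x"] exI[of _ "\<kappa> (vdeg x)"]) (simp add: E_def)
        then show ?thesis by auto
      qed simp
      then show ?thesis using conn[OF \<rho>1 x] by simp
    qed
    have "tdeg m' = tdeg m" using less.prems tdeg_eq[OF G, of m' m] by (simp add: E_def)
    then have "(m, \<kappa> (vdeg m)) \<in> (moves G S)\<^sup>*" "(m', \<kappa> (vdeg m)) \<in> (moves G S)\<^sup>*"
      using to\<kappa>[of m] to\<kappa>[of m'] less.prems by simp_all
    then show ?case using moves_sym by (meson rtrancl_trans)
  qed
  have SG: "binomial_generators G S"
    unfolding binomial_generators_iff[OF G] using S1 S2 gen by (simp add: E_def)
  have "\<not> binomial_generators G T" if TS: "T \<subset> S" for T
  proof
    assume T: "binomial_generators G T"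
    note T' = T[unfolded binomial_generators_iff[OF G]]
    obtain m where m: "m \<in> E" "\<rho> m \<noteq> \<kappa> (vdeg m)" "pure_binomial (\<kappa> (vdeg m)) (\<rho> m) \<notin> T"
      using TS unfolding S_def by blast
    \<comment> \<open>Without its ray of the star the component of \<open>\<rho> m\<close> cannot be
      left: a proper multiple of a binomial keeps a common variable, and a generator itself joins
      the centre to the representative of another component.\<close>
    have "fiber_conn G (\<rho> m) b \<and> b \<in> E" if "(\<rho> m, b) \<in> (moves G T)\<^sup>*" for b
      using that
    proof (induction rule: rtrancl_induct)
      case base
      then show ?case using m \<rho>E by simp
    next
      case (step y z)
      obtain t c d where t: "y = t + c" "z = t + d" "keys t \<subseteq> edges G"
        "keys c \<subseteq> edges G" "keys d \<subseteq> edges G"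
        and cd: "pure_binomial c d \<in> T \<or> pure_binomial d c \<in> T"
        using step.hyps(2) unfolding moves_def by blast
      have yz: "keys y \<subseteq> edges G" "keys z \<subseteq> edges G" "vdeg y = vdeg z"
        using moves_toric[OF G _ step.hyps(2)] T' by blast+
      show ?case
      proof (cases "t = 0 \<and> c \<noteq> d")
        case False
        have "fiber_conn G y z"
        proof (cases "c = d")
          case False
          with \<open>\<not> (t = 0 \<and> c \<noteq> d)\<close> have "t \<noteq> 0" by blast
          then obtain e where "e \<in> keys t" by (metis keys_eq_empty ex_in_conv)
          then show ?thesis using fiber_connI[OF yz, of e] t by (auto simp: keys_add_nat)
        qed (simp add: t)
        then show ?thesis using step.IH yz fiber_conn_trans[of G "\<rho> m" y z] by (simp add: E_def)
      next
        case True
        then have y: "y = c" "z = d" using t by simp_all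
        obtain p q where pq: "pure_binomial p q \<in> T" "{p, q} = {y, z}" "p \<noteq> q"
          using cd True y by (metis insert_commute)
        then obtain m' where m': "m' \<in> E" "\<rho> m' \<noteq> \<kappa> (vdeg m')"
          "pure_binomial p q = (pure_binomial (\<kappa> (vdeg m')) (\<rho> m') :: ('v, 'k) edge_poly)"
          using TS unfolding S_def by blast
        then have yz': "{y, z} = {\<kappa> (vdeg m'), \<rho> m'}"
          using pq pure_binomial_eq[OF m'(3)] by simp
        have ym: "\<rho> y = \<rho> m" using step.IH \<rho>2 \<rho>\<rho> by metis
        have vy: "vdeg y = vdeg m" using step.IH fiber_conn_degree \<rho>E m(1) by metis
        have "vdeg y = vdeg m'" using yz' \<kappa>(2)[OF m'(1)] \<rho>E(2)[OF m'(1)] yz(3)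
          by (auto simp: doubleton_eq_iff)
        then have "y = \<kappa> (vdeg m) \<or> y = \<rho> m'" "vdeg m' = vdeg m"
          using yz' vy by (auto simp: doubleton_eq_iff)
        then have "\<rho> m' = \<rho> m" using ym \<kappa>(3)[OF m(1)] m(2) \<rho>\<rho> by metis
        then have False using m' pq m(3) \<open>vdeg m' = vdeg m\<close> by simp
        then show ?thesis ..
      qed
    qed
    moreover have "(\<rho> m, \<kappa> (vdeg m)) \<in> (moves G T)\<^sup>*"
      using T' \<kappa>[OF m(1)] \<rho>E[OF m(1)] by (simp add: E_def)
    ultimately have "fiber_conn G (\<rho> m) (\<kappa> (vdeg m))" by blast
    then show False using \<rho>2 \<rho>\<rho> \<kappa>(3)[OF m(1)] m(2) by metis
  qed
  moreover have "pure_binomial u v \<in> S"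
  proof -
    have "\<kappa> (vdeg v) = u" using uv(3) by (simp add: \<kappa>_def)
    moreover have "u \<noteq> v" using nconn by auto
    ultimately show ?thesis unfolding S_def using uv \<rho>v by (force simp: E_def)
  qed
  ultimately show ?thesis unfolding minimal_binomial_def using SG by blast
qed

section \<open>Closed walks as periodic sequences\<close>

abbreviation mon :: "'v set \<Rightarrow> 'v edge_monom" where "mon f \<equiv> Poly_Mapping.single f 1"

definition delta :: "'v \<Rightarrow> 'v \<Rightarrow> int" where "delta a x = (if x = a then 1 else 0)"

lemma vdeg_mon: "a \<noteq> b \<Longrightarrow> int (vdeg (mon {a, b}) x) = delta a x + delta b x"
  by (auto simp: delta_def)

lemma vdeg_eqI: "(\<And>x. int (vdeg u x) = int (vdeg v x)) \<Longrightarrow> vdeg u = vdeg v"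
  by auto

text \<open>Indexing by all integers removes the distinguished start of the walk: the arc from
  \<open>j\<close> on to \<open>i + n\<close> is a segment of the same kind as the one from
  \<open>i\<close> to \<open>j\<close>. As \<open>n\<close> is even, parity is a property of the
  residue class of a position.\<close>

locale periodic_walk =
  fixes G :: "'v sgraph" and c :: "int \<Rightarrow> 'v" and n :: int
  assumes G: "finite_simple_graph G" and n_pos: "n > 0" and n_even: "even n"
    and per: "c (k + n) = c k" and edge: "{c k, c (k + 1)} \<in> edges G"
begin

definition e :: "int \<Rightarrow> 'v set" where "e k = {c k, c (k + 1)}"

lemma e_in: "e k \<in> edges G" using edge by (simp add: e_def)

lemma edge_ne: "{a, b} \<in> edges G \<Longrightarrow> a \<noteq> b"
  using edge_finite[OF G] by fastforce

lemma c_ne: "c k \<noteq> c (k + 1)" using edge_ne[OF edge] .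

lemma c_cong: "n dvd i - j \<Longrightarrow> c i = c j"
proof -
  assume "n dvd i - j"
  then obtain m where m: "i = j + n * m" by (metis dvdE add.commute diff_add_cancel)
  have "c (j + n * int t) = c j" for j t
  proof (induction t)
    case (Suc t)
    then show ?case using per[of "j + n * int t"] by (simp add: algebra_simps)
  qed simp
  from this[of j "nat m"] this[of i "nat (- m)"] show ?thesis
    by (cases "m \<ge> 0") (simp_all add: m)
qed

lemma e_cong: "n dvd i - j \<Longrightarrow> e i = e j"
  using c_cong[of i j] c_cong[of "i + 1" "j + 1"] by (simp add: e_def)

lemma residue: obtains m' where "p \<le> m'" "m' < p + n" "n dvd m' - m"
proof
  show "p \<le> p + (m - p) mod n" "p + (m - p) mod n < p + n" using n_pos by simp_all
  show "n dvd p + (m - p) mod n - m"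
    using mod_eq_dvd_iff[of "p + (m - p) mod n" n m] by (simp add: mod_simps)
qed

lemma dvd_even: "n dvd k \<Longrightarrow> even k" using n_even dvd_trans by blast

lemma dvd_window: "n dvd i - j \<Longrightarrow> \<bar>i - j\<bar> < n \<Longrightarrow> i = j"
  using zdvd_imp_le[of n "\<bar>i - j\<bar>"] by (cases "i = j") auto

text \<open>Over a full period \<open>True\<close> gives \<open>E_plus\<close> and
  \<open>False\<close> gives \<open>E_minus\<close>. The sum runs over positions, so an edge
  traversed twice counts twice.\<close>

definition P :: "bool \<Rightarrow> int \<Rightarrow> int \<Rightarrow> 'v edge_monom" where
  "P \<sigma> i j = (\<Sum>k | i \<le> k \<and> k < j \<and> even k = \<sigma>. mon (e k))"

lemma finite_idx [simp]: "finite {k::int. i \<le> k \<and> k < j \<and> Q k}"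
  by (rule finite_subset[of _ "{i..<j}"]) auto

lemma P_split: "i \<le> j \<Longrightarrow> j \<le> k \<Longrightarrow> P \<sigma> i k = P \<sigma> i j + P \<sigma> j k"
  unfolding P_def by (subst sum.union_disjoint[symmetric]) (auto intro!: sum.cong)

lemma P_empty [simp]: "P \<sigma> i i = 0" unfolding P_def by (rule sum.neutral) auto

lemma P_Suc: "P \<sigma> i (i + 1) = (if even i = \<sigma> then mon (e i) else 0)"
proof -
  have "{k. i \<le> k \<and> k < i + 1 \<and> even k = \<sigma>} = (if even i = \<sigma> then {i} else {})" by auto
  then show ?thesis by (simp add: P_def)
qed

lemma P_shift: "P \<sigma> (i + n) (j + n) = P \<sigma> i j"
proof -
  have "e (k - n) = e k" for k using e_cong[of "k - n" k] by simp
  then show ?thesis unfolding P_def using n_even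
    by (intro sum.reindex_bij_witness[of _ "\<lambda>k. k + n" "\<lambda>k. k - n"]) auto
qed

lemma P_full: "P \<sigma> i (i + n) = P \<sigma> 0 n"
proof -
  have step: "P \<sigma> (i + 1) (i + 1 + n) = P \<sigma> i (i + n)" for i
    using P_split[of i "i + 1" "i + n" \<sigma>] P_split[of "i + 1" "i + n" "i + 1 + n" \<sigma>]
      P_shift[of \<sigma> i "i + 1"] n_pos by (simp add: algebra_simps)
  show ?thesis
  proof (induction i rule: int_induct[of _ 0])
    case (step2 i)
    then show ?case using step[of "i - 1"] by simp
  qed (use step in simp_all)
qed

lemma P_full_split: "i \<le> j \<Longrightarrow> j \<le> i + n \<Longrightarrow> P \<sigma> 0 n = P \<sigma> i j + P \<sigma> j (i + n)"
  using P_split P_full by metis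

lemma keys_P: "keys (P \<sigma> i j) = e ` {k. i \<le> k \<and> k < j \<and> even k = \<sigma>}"
proof -
  have "keys (\<Sum>k\<in>A. mon (e k)) = e ` A" if "finite A" for A
    using that by (induction A) (auto simp: keys_add_nat)
  then show ?thesis by (simp add: P_def)
qed

lemma keys_P_edges: "keys (P \<sigma> i j) \<subseteq> edges G"
  using e_in by (auto simp: keys_P)

definition sg :: "bool \<Rightarrow> int \<Rightarrow> int" where "sg \<sigma> k = (if even k = \<sigma> then 1 else - 1)"

text \<open>Consecutive edges carry opposite signs and share a vertex, so every inner position
  cancels; the sign at an end depends on the parity of that end.\<close>

lemma telescope:
  assumes "i \<le> j"
  shows "int (vdeg (P \<sigma> i j) x) - int (vdeg (P (\<not> \<sigma>) i j) x) = sg \<sigma> i * delta (c i) x - sg \<sigma> j * delta (c j) x"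
  using assms
proof (induction j rule: int_ge_induct)
  case (step j)
  have "P \<tau> i (j + 1) = P \<tau> i j + (if even j = \<tau> then mon (e j) else 0)" for \<tau>
    using P_split[of i j "j + 1"] step.hyps P_Suc by simp
  moreover have "int (vdeg (mon (e j)) x) = delta (c j) x + delta (c (j + 1)) x"
    unfolding e_def by (rule vdeg_mon[OF c_ne])
  ultimately show ?case using step.IH by (auto simp: vdeg_add sg_def)
qed simp

lemma vdeg_full: "vdeg (P (\<not> \<sigma>) 0 n) = vdeg (P \<sigma> 0 n)"
proof (rule vdeg_eqI)
  fix x
  have "c n = c 0" using per[of 0] by simp
  then show "int (vdeg (P (\<not> \<sigma>) 0 n) x) = int (vdeg (P \<sigma> 0 n) x)"
    using telescope[of 0 n \<sigma> x] n_pos n_even by (simp add: sg_def)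
qed

text \<open>Ends on the walk are not demanded here; for sets of the form \<open>{c i, c j}\<close>
  this is automatic.\<close>

definition chd :: "'v set \<Rightarrow> bool" where "chd f \<longleftrightarrow> f \<in> edges G \<and> f \<notin> range e"

definition conn :: bool where "conn \<longleftrightarrow> fiber_conn G (P True 0 n) (P False 0 n)"

lemma connI: "fiber_conn G (P \<sigma> 0 n) (P (\<not> \<sigma>) 0 n) \<Longrightarrow> conn"
  by (cases \<sigma>) (auto simp: conn_def intro: fiber_conn_sym)

lemma key_full: "even k = \<sigma> \<Longrightarrow> e k \<in> keys (P \<sigma> 0 n)"
proof -
  assume k: "even k = \<sigma>"
  obtain m where m: "0 \<le> m" "m < 0 + n" "n dvd m - k" by (rule residue)
  then show ?thesis using k dvd_even[of "m - k"] e_cong[of m k] by (auto simp: keys_P)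
qed

lemma conn_mid:
  assumes "keys z \<subseteq> edges G" "vdeg z = vdeg (P \<sigma> 0 n)"
    "e a \<in> keys z" "even a = \<sigma>" "e b \<in> keys z" "even b \<noteq> \<sigma>"
  shows conn
proof (rule connI)
  have "fiber_conn G (P \<sigma> 0 n) z"
    using assms key_full[of a \<sigma>] keys_P_edges by (intro fiber_connI[of _ _ _ "e a"]) auto
  moreover have "fiber_conn G z (P (\<not> \<sigma>) 0 n)"
    using assms key_full[of b "\<not> \<sigma>"] keys_P_edges vdeg_full by (intro fiber_connI[of _ _ _ "e b"]) auto
  ultimately show "fiber_conn G (P \<sigma> 0 n) (P (\<not> \<sigma>) 0 n)" by (rule fiber_conn_trans)
qed

lemma chd_ne: "chd {c i, c j} \<Longrightarrow> c i \<noteq> c j"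
  using edge_ne by (simp add: chd_def)

lemma chd_dist: "chd {c i, c j} \<Longrightarrow> \<not> n dvd i - j - 1 \<and> \<not> n dvd i - j \<and> \<not> n dvd i - j + 1"
proof -
  assume f: "chd {c i, c j}"
  have 1: "\<not> n dvd i - j" using chd_ne[OF f] c_cong by blast
  have "\<not> n dvd i - (j + 1)"
  proof
    assume "n dvd i - (j + 1)"
    then have "{c i, c j} = e j" using c_cong by (auto simp: e_def)
    then show False using f by (simp add: chd_def)
  qed
  moreover have "\<not> n dvd (i + 1) - j"
  proof
    assume "n dvd (i + 1) - j"
    then have "{c i, c j} = e i" using c_cong by (auto simp: e_def)
    then show False using f by (simp add: chd_def)
  qed
  ultimately show ?thesis using 1 by (simp add: algebra_simps)
qed

lemma chd_window:
  assumes "chd {c i, c j}" "i < j" "j < i + n"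
  shows "i + 2 \<le> j" "j + 2 \<le> i + n"
proof -
  have "j \<noteq> i + 1" using chd_dist[OF assms(1)] by auto
  moreover have "j + 1 \<noteq> i + n" using chd_dist[OF assms(1)]
    by (metis add.commute add_diff_cancel_left' diff_diff_eq2 dvd_minus_iff dvd_refl minus_diff_eq diff_add_eq)
  ultimately show "i + 2 \<le> j" "j + 2 \<le> i + n" using assms by auto
qed

section \<open>Configurations connecting the two monomials of a walk\<close>

text \<open>On the odd segment from \<open>i\<close> to \<open>j\<close> the edges with the parity
  of \<open>i\<close> meet both ends and the others meet neither. Passing to the others therefore
  loses one degree at each end, which is what the chord supplies.\<close>

lemma conn_even_chord:
  assumes ij: "i < j" "j < i + n" "odd (j - i)" and f: "chd {c i, c j}"
  shows conn
proof -
  let ?\<sigma> = "even i"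
  let ?z = "P (\<not> ?\<sigma>) i j + mon {c i, c j} + P ?\<sigma> j (i + n)"
  note w = chd_window[OF f ij(1,2)]
  have fe: "{c i, c j} \<in> edges G" using f by (simp add: chd_def)
  have "vdeg ?z = vdeg (P ?\<sigma> 0 n)"
  proof (rule vdeg_eqI)
    fix x
    show "int (vdeg ?z x) = int (vdeg (P ?\<sigma> 0 n) x)"
      using telescope[of i j ?\<sigma> x] vdeg_mon[OF chd_ne[OF f], of x] ij
      by (simp add: P_full_split[of i j] vdeg_add sg_def)
  qed
  moreover have "keys ?z \<subseteq> edges G" using keys_P_edges fe by (simp add: keys_add_nat)
  moreover have "e (i + 1) \<in> keys ?z" "e (j + 1) \<in> keys ?z"
    using w ij by (auto simp: keys_add_nat keys_P)
  ultimately show ?thesis using conn_mid[of ?z ?\<sigma> "j + 1" "i + 1"] ij by simp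
qed

text \<open>The parity is exchanged from \<open>i\<close> to \<open>p'\<close> and from
  \<open>j\<close> to \<open>p + n\<close>. The ends \<open>p'\<close> and \<open>p + n\<close> are
  visits of the same vertex with opposite signs and cancel, while the chord makes up for the losses
  at \<open>i\<close> and \<open>j\<close>.\<close>

lemma conn_separated_chord:
  assumes o: "p < i" "i < p'" "p' < j" "j < p + n" and p: "c p = c p'" "odd (p' - p)"
    and f: "chd {c i, c j}" "even (j - i)"
  shows conn
proof -
  let ?\<sigma> = "even i"
  let ?z = "P ?\<sigma> p i + P ?\<sigma> p' j + P (\<not> ?\<sigma>) i p' + P (\<not> ?\<sigma>) j (p + n) + mon {c i, c j}"
  have fe: "{c i, c j} \<in> edges G" using f by (simp add: chd_def)
  have full: "P ?\<sigma> 0 n = P ?\<sigma> p i + P ?\<sigma> i p' + P ?\<sigma> p' j + P ?\<sigma> j (p + n)"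
    using P_full_split[of p p' ?\<sigma>] P_split[of p i p' ?\<sigma>] P_split[of p' j "p + n" ?\<sigma>] o by (simp add: add.assoc)
  have "vdeg ?z = vdeg (P ?\<sigma> 0 n)"
  proof (rule vdeg_eqI)
    fix x
    have "c (p + n) = c p'" using per p by simp
    then show "int (vdeg ?z x) = int (vdeg (P ?\<sigma> 0 n) x)"
      using telescope[of i p' ?\<sigma> x] telescope[of j "p + n" ?\<sigma> x] vdeg_mon[OF chd_ne[OF f(1)], of x] o p(2) f(2) n_even
      by (auto simp: full vdeg_add sg_def)
  qed
  moreover have "keys ?z \<subseteq> edges G" using keys_P_edges fe by (simp add: keys_add_nat)
  \<comment> \<open>If both unchanged segments had length one, \<open>j - i\<close> would equal the
    odd number \<open>p' - p\<close>.\<close>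
  moreover have "\<exists>a. even a = ?\<sigma> \<and> e a \<in> keys ?z"
  proof (cases "p + 2 \<le> i")
    case True
    then show ?thesis by (intro exI[of _ "i - 2"]) (auto simp: keys_add_nat keys_P)
  next
    case False
    then have "i = p + 1" using o by simp
    then have "p' + 2 \<le> j" using o p(2) f(2) by presburger
    then show ?thesis using f(2) by (intro exI[of _ "j - 2"]) (auto simp: keys_add_nat keys_P)
  qed
  moreover have "\<exists>a. even a \<noteq> ?\<sigma> \<and> e a \<in> keys ?z"
  proof (cases "i + 2 \<le> p'")
    case True
    then show ?thesis by (intro exI[of _ "i + 1"]) (auto simp: keys_add_nat keys_P)
  next
    case False
    then have "p' = i + 1" using o by simp
    then have "j + 2 \<le> p + n" using o p(2) f(2) n_even by presburger
    then show ?thesis using f(2) by (intro exI[of _ "j + 1"]) (auto simp: keys_add_nat keys_P)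
  qed
  ultimately show ?thesis using conn_mid[of ?z ?\<sigma>] by blast
qed

text \<open>The segments from \<open>i\<close> to \<open>k\<close> and from \<open>j\<close> to
  \<open>l\<close> have odd length; exchanging the parity there loses one degree at each of the four
  ends, and the two chords supply it. In the two exceptional cases the new monomial has no walk edge
  of one of the parities; these are the configurations of an \<open>F4\<close>.\<close>

lemma conn_crossing:
  assumes o: "i < k" "k < j" "j < l" "l < i + n" and par: "even (j - i)" "even (l - k)" "odd (k - i)"
    and f: "chd {c i, c j}" "chd {c k, c l}"
  shows "conn \<or> k = i + 1 \<and> l = j + 1 \<or> j = k + 1 \<and> l + 1 = i + n"
proof (rule disjCI)
  assume not: "\<not> (k = i + 1 \<and> l = j + 1 \<or> j = k + 1 \<and> l + 1 = i + n)"
  let ?\<sigma> = "even i"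
  let ?z = "P (\<not> ?\<sigma>) i k + P (\<not> ?\<sigma>) j l + P ?\<sigma> k j + P ?\<sigma> l (i + n) + mon {c i, c j} + mon {c k, c l}"
  have fe: "{c i, c j} \<in> edges G" "{c k, c l} \<in> edges G" using f by (simp_all add: chd_def)
  have full: "P ?\<sigma> 0 n = P ?\<sigma> i k + P ?\<sigma> k j + P ?\<sigma> j l + P ?\<sigma> l (i + n)"
    using P_full_split[of i j ?\<sigma>] P_split[of i k j ?\<sigma>] P_split[of j l "i + n" ?\<sigma>] o by (simp add: add.assoc)
  have "vdeg ?z = vdeg (P ?\<sigma> 0 n)"
  proof (rule vdeg_eqI)
    fix x
    show "int (vdeg ?z x) = int (vdeg (P ?\<sigma> 0 n) x)"
      using telescope[of i k ?\<sigma> x] telescope[of j l ?\<sigma> x] vdeg_mon[OF chd_ne[OF f(1)], of x]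
        vdeg_mon[OF chd_ne[OF f(2)], of x] o par by (auto simp: full vdeg_add sg_def)
  qed
  moreover have "keys ?z \<subseteq> edges G" using keys_P_edges fe by (simp add: keys_add_nat)
  moreover have "\<exists>a. even a \<noteq> ?\<sigma> \<and> e a \<in> keys ?z"
  proof (cases "k = i + 1")
    case False
    then show ?thesis using o by (intro exI[of _ "i + 1"]) (auto simp: keys_add_nat keys_P)
  next
    case True
    then have "j + 2 \<le> l" using not o by auto
    then show ?thesis using par by (intro exI[of _ "j + 1"]) (auto simp: keys_add_nat keys_P)
  qed
  moreover have "\<exists>a. even a = ?\<sigma> \<and> e a \<in> keys ?z"
  proof (cases "j = k + 1")
    case False
    then show ?thesis using o par by (intro exI[of _ "k + 1"]) (auto simp: keys_add_nat keys_P)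
  next
    case True
    then have "l + 2 \<le> i + n" using not o by auto
    then show ?thesis using par by (intro exI[of _ "l + 1"]) (auto simp: keys_add_nat keys_P)
  qed
  ultimately show conn using conn_mid[of ?z ?\<sigma>] by blast
qed

text \<open>The segments from \<open>k + 1\<close> to \<open>l\<close> and from \<open>m\<close> to
  \<open>k + n\<close> are closed walks of odd length. Changing the parity on them takes two degrees
  from \<open>c (k + 1)\<close> and two from \<open>c k\<close>, and the edge \<open>e k\<close>
  taken twice returns them.\<close>

lemma conn_adjacent_sinks:
  assumes o: "k + 1 < l" "l + 1 < m" "m < k + n" and eq: "c k = c m" "c (k + 1) = c l"
    and par: "odd (m - k)" "even (l - k)"
  shows conn
proof -
  let ?\<sigma> = "even k"
  let ?z = "P (\<not> ?\<sigma>) l m + P ?\<sigma> (k + 1) l + P ?\<sigma> m (k + n) + mon (e k) + mon (e k)"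
  have full: "P (\<not> ?\<sigma>) 0 n = P (\<not> ?\<sigma>) (k + 1) l + P (\<not> ?\<sigma>) l m + P (\<not> ?\<sigma>) m (k + n)"
    using P_full_split[of k m "\<not> ?\<sigma>"] P_split[of k l m "\<not> ?\<sigma>"] P_split[of k "k + 1" l "\<not> ?\<sigma>"] P_Suc[of "\<not> ?\<sigma>" k] o
    by (simp add: add.assoc)
  have "vdeg ?z = vdeg (P (\<not> ?\<sigma>) 0 n)"
  proof (rule vdeg_eqI)
    fix x
    have "c (k + n) = c m" using per eq by simp
    then show "int (vdeg ?z x) = int (vdeg (P (\<not> ?\<sigma>) 0 n) x)"
      using telescope[of "k + 1" l ?\<sigma> x] telescope[of m "k + n" ?\<sigma> x] vdeg_mon[OF c_ne, of k x] o par eq n_even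
      by (auto simp: full vdeg_add sg_def e_def)
  qed
  moreover have "keys ?z \<subseteq> edges G" using keys_P_edges e_in by (simp add: keys_add_nat)
  moreover have "e k \<in> keys ?z" "e (l + 1) \<in> keys ?z"
    using o par by (auto simp: keys_add_nat keys_P)
  ultimately show ?thesis using conn_mid[of ?z "\<not> ?\<sigma>" "l + 1" k] par by simp
qed

text \<open>Exchanging \<open>e i\<close>, \<open>e j\<close> for the two chords of the \<open>F4\<close> gives a walk for which the third
  chord is even.\<close>

lemma conn_crossed_F4:
  assumes ij: "i < j" "j < i + n" "even (j - i)"
    and f: "chd {c i, c j}" "chd {c (i + 1), c (j + 1)}" "chd {c k, c l}"
    and kl: "j + 1 \<le> k" "k \<le> i + n" "i + 1 \<le> l" "l \<le> j" "even (k - l)"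
    and ne: "{c k, c l} \<noteq> {c i, c j}" "{c k, c l} \<noteq> {c (i + 1), c (j + 1)}"
  shows conn
proof (rule connI)
  let ?\<sigma> = "even i"
  let ?f1 = "{c i, c j}" and ?f2 = "{c (i + 1), c (j + 1)}" and ?f = "{c k, c l}"
  have fe: "?f1 \<in> edges G" "?f2 \<in> edges G" "?f \<in> edges G" using f by (simp_all add: chd_def)
  have cin: "c (i + n) = c i" by (rule per)
  have ne1: "\<not> (k = i + n \<and> l = j)" using ne(1) cin by auto
  have ne2: "\<not> (k = j + 1 \<and> l = i + 1)" using ne(2) by auto
  let ?u = "P ?\<sigma> (i + 1) j + P ?\<sigma> (j + 1) (i + n) + mon ?f1 + mon ?f2"
  have full: "P ?\<sigma> 0 n = P ?\<sigma> (i + 1) j + P ?\<sigma> (j + 1) (i + n) + mon (e i) + mon (e j)"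
    using P_full_split[of i j ?\<sigma>] P_split[of i "i + 1" j ?\<sigma>] P_split[of j "j + 1" "i + n" ?\<sigma>]
      P_Suc[of ?\<sigma> i] P_Suc[of ?\<sigma> j] ij by (simp add: ac_simps)
  have split: "P \<tau> (i + 1) j = P \<tau> (i + 1) l + P \<tau> l j"
    "P \<tau> (j + 1) (i + n) = P \<tau> (j + 1) k + P \<tau> k (i + n)" for \<tau>
    by (rule P_split; use kl in linarith)+
  have full': "P (\<not> ?\<sigma>) 0 n = P (\<not> ?\<sigma>) (i + 1) j + P (\<not> ?\<sigma>) (j + 1) (i + n)"
    using P_full_split[of i j "\<not> ?\<sigma>"] P_split[of i "i + 1" j "\<not> ?\<sigma>"] P_split[of j "j + 1" "i + n" "\<not> ?\<sigma>"]
      P_Suc[of "\<not> ?\<sigma>" i] P_Suc[of "\<not> ?\<sigma>" j] ij by (simp add: ac_simps)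
  have vmon: "int (vdeg (mon ?f1) x) = delta (c i) x + delta (c j) x"
    "int (vdeg (mon ?f2) x) = delta (c (i + 1)) x + delta (c (j + 1)) x"
    "int (vdeg (mon ?f) x) = delta (c k) x + delta (c l) x"
    "int (vdeg (mon (e i)) x) = delta (c i) x + delta (c (i + 1)) x"
    "int (vdeg (mon (e j)) x) = delta (c j) x + delta (c (j + 1)) x" for x
    using vdeg_mon[OF chd_ne] f vdeg_mon[OF c_ne] unfolding e_def by blast+
  have vu: "vdeg ?u = vdeg (P ?\<sigma> 0 n)"
  proof (rule vdeg_eqI)
    fix x show "int (vdeg ?u x) = int (vdeg (P ?\<sigma> 0 n) x)" using vmon[of x] by (simp add: full vdeg_add)
  qed
  have ku: "keys ?u \<subseteq> edges G" using keys_P_edges fe by (simp add: keys_add_nat)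
  \<comment> \<open>\<open>X\<close> collects the segments between the third chord and the ends of
    \<open>?f1\<close>, \<open>Y\<close> those between it and the ends of \<open>?f2\<close>. If
    \<open>X\<close> is exchanged then \<open>?f\<close> takes the place of \<open>?f1\<close>, if
    \<open>Y\<close> is exchanged that of \<open>?f2\<close>; the parity of \<open>k - i\<close>
    decides which of the two balances the degrees.\<close>
  define X Y where "X \<tau> = P \<tau> k (i + n) + P \<tau> l j" and "Y \<tau> = P \<tau> (i + 1) l + P \<tau> (j + 1) k" for \<tau>
  have kXY: "keys (X \<tau>) \<subseteq> edges G" "keys (Y \<tau>) \<subseteq> edges G" for \<tau>
    using keys_P_edges by (simp_all add: keys_add_nat X_def Y_def)
  have fullXY: "P (\<not> ?\<sigma>) 0 n = X (\<not> ?\<sigma>) + Y (\<not> ?\<sigma>)"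
    unfolding full' X_def Y_def split by (simp add: ac_simps)
  have uXY: "?u = X ?\<sigma> + Y ?\<sigma> + mon ?f1 + mon ?f2"
    unfolding X_def Y_def split by (simp add: ac_simps)
  \<comment> \<open>The chain has two intermediate monomials: \<open>?u\<close> has a walk edge in
    common with the first monomial of the walk, \<open>z\<close> has an \<open>F4\<close> chord in
    common with \<open>?u\<close> and a walk edge with the second monomial.\<close>
  have "\<exists>z. keys z \<subseteq> edges G \<and> vdeg z = vdeg (P (\<not> ?\<sigma>) 0 n) \<and>
    (?f1 \<in> keys z \<or> ?f2 \<in> keys z) \<and> (\<exists>b. even b \<noteq> ?\<sigma> \<and> e b \<in> keys z)
    \<and> (\<exists>b. even b = ?\<sigma> \<and> e b \<in> keys ?u)"
  proof (cases "even (k - i)")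
    case True
    let ?z = "Y ?\<sigma> + X (\<not> ?\<sigma>) + mon ?f2 + mon ?f"
    have "vdeg ?z = vdeg (P (\<not> ?\<sigma>) 0 n)"
    proof (rule vdeg_eqI)
      fix x
      show "int (vdeg ?z x) = int (vdeg (P (\<not> ?\<sigma>) 0 n) x)"
        using telescope[of "i + 1" l ?\<sigma> x] telescope[of "j + 1" k ?\<sigma> x] vmon[of x] kl ij(3) True
        by (auto simp: fullXY X_def Y_def vdeg_add sg_def)
    qed
    moreover have "keys ?z \<subseteq> edges G" using kXY fe by (simp add: keys_add_nat)
    \<comment> \<open>As the third chord differs from \<open>?f1\<close>, one of the two segments in
      \<open>X\<close> has length at least two. It holds an exchanged edge next to an edge of
      \<open>?u\<close>.\<close>
    moreover have "\<exists>b. even b \<noteq> ?\<sigma> \<and> e b \<in> keys ?z \<and> e (b - 1) \<in> keys ?u"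
    proof (cases "k = i + n")
      case True
      then have "l + 2 \<le> j" using ne1 kl \<open>even (k - i)\<close> ij(3) by presburger
      then show ?thesis using kl(5) \<open>even (k - i)\<close> kl
        by (intro exI[of _ "l + 1"]) (auto simp: X_def uXY keys_add_nat keys_P)
    next
      case False
      then have "k + 2 \<le> i + n" using kl True n_even by presburger
      then show ?thesis using kl \<open>even (k - i)\<close>
        by (intro exI[of _ "k + 1"]) (auto simp: X_def uXY keys_add_nat keys_P)
    qed
    moreover have "?f2 \<in> keys ?z" by (simp add: keys_add_nat)
    ultimately show ?thesis by (metis even_diff odd_one diff_add_cancel even_plus_one_iff)
  next
    case False
    let ?z = "X ?\<sigma> + Y (\<not> ?\<sigma>) + mon ?f1 + mon ?f"
    have "vdeg ?z = vdeg (P (\<not> ?\<sigma>) 0 n)"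
    proof (rule vdeg_eqI)
      fix x
      show "int (vdeg ?z x) = int (vdeg (P (\<not> ?\<sigma>) 0 n) x)"
        using telescope[of l j ?\<sigma> x] telescope[of k "i + n" ?\<sigma> x] vmon[of x] kl ij(3) False n_even cin
        by (auto simp: fullXY X_def Y_def vdeg_add sg_def)
    qed
    moreover have "keys ?z \<subseteq> edges G" using kXY fe by (simp add: keys_add_nat)
    moreover have "\<exists>b. even b \<noteq> ?\<sigma> \<and> e b \<in> keys ?z \<and> e (b + 1) \<in> keys ?u"
    proof (cases "k = j + 1")
      case True
      then have "i + 3 \<le> l" using ne2 kl False ij(3) by presburger
      then show ?thesis using kl
        by (intro exI[of _ "i + 1"]) (auto simp: Y_def uXY keys_add_nat keys_P)
    next
      case False
      then have "j + 3 \<le> k" using kl \<open>odd (k - i)\<close> ij(3) by presburger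
      then show ?thesis using ij(3) kl
        by (intro exI[of _ "j + 1"]) (auto simp: Y_def uXY keys_add_nat keys_P)
    qed
    moreover have "?f1 \<in> keys ?z" by (simp add: keys_add_nat)
    ultimately show ?thesis by (metis even_plus_one_iff)
  qed
  then obtain z a b where z: "keys z \<subseteq> edges G" "vdeg z = vdeg (P (\<not> ?\<sigma>) 0 n)"
    "?f1 \<in> keys z \<or> ?f2 \<in> keys z"
    "even b \<noteq> ?\<sigma>" "e b \<in> keys z" "even a = ?\<sigma>" "e a \<in> keys ?u" by blast
  have 1: "fiber_conn G (P ?\<sigma> 0 n) ?u"
    using key_full[OF z(6)] z(7) ku vu keys_P_edges by (intro fiber_connI[of _ _ _ "e a"]) auto
  have 2: "fiber_conn G ?u z"
  proof -
    obtain g where "g \<in> keys z" "g \<in> keys ?u"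
      using z(3) by (auto simp: keys_add_nat)
    moreover have "vdeg ?u = vdeg z" using vu z(2) vdeg_full by metis
    ultimately show ?thesis using ku z(1) by (intro fiber_connI[of _ _ _ g]) auto
  qed
  have 3: "fiber_conn G z (P (\<not> ?\<sigma>) 0 n)"
    using key_full[of b "\<not> ?\<sigma>"] z keys_P_edges by (intro fiber_connI[of _ _ _ "e b"]) auto
  show "fiber_conn G (P ?\<sigma> 0 n) (P (\<not> ?\<sigma>) 0 n)"
    using fiber_conn_trans[OF fiber_conn_trans[OF 1 2] 3] .
qed

end

section \<open>The positions of a primitive walk\<close>

text \<open>What primitivity is used for, as statements on positions. By \<open>eq_even\<close> two
  visits in the same period have opposite parity, which excludes a third one.\<close>

locale noncrossing_walk = periodic_walk G c n for G :: "'v sgraph" and c n +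
  assumes n4: "n \<ge> 4"
    and eq_even: "c i = c j \<Longrightarrow> even (i - j) \<Longrightarrow> n dvd i - j"
    and no_crossing: "i < k \<Longrightarrow> k < j \<Longrightarrow> j < l \<Longrightarrow> l < i + n \<Longrightarrow> c i = c j \<Longrightarrow> c k = c l \<Longrightarrow> False"
begin

lemma c_ne2: "c k \<noteq> c (k + 2)"
  using eq_even[of k "k + 2"] dvd_window[of k "k + 2"] n4 by auto

lemma third_position:
  assumes "c i = c j" "c i = c k" "\<not> n dvd i - j" "\<not> n dvd i - k"
  shows "n dvd j - k"
proof -
  have "odd (i - j)" "odd (i - k)" using assms eq_even by blast+
  then have "even (j - k)" by presburger
  then show ?thesis using assms eq_even by simp
qed

definition once :: "int \<Rightarrow> bool" where "once k \<longleftrightarrow> (\<forall>m. c m = c k \<longrightarrow> n dvd m - k)"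

definition pair :: "int \<Rightarrow> int \<Rightarrow> bool" where "pair p q \<longleftrightarrow> p < q \<and> q < p + n \<and> c p = c q"

text \<open>One of the two arcs into which a repeated vertex cuts the walk. The other is
  \<open>side q (p + n)\<close>, so \<open>pair_flip\<close> carries each fact about one arc over to
  the other.\<close>

definition side :: "int \<Rightarrow> int \<Rightarrow> 'v set" where "side p q = c ` {m. p < m \<and> m < q}"

lemma sideI: "p < m \<Longrightarrow> m < q \<Longrightarrow> c m \<in> side p q" by (auto simp: side_def)

lemma position_cases:
  assumes "pair p q" "p \<le> m" "m \<le> p + n"
  shows "c m = c p \<or> (p < m \<and> m < q \<and> c m \<in> side p q) \<or> (q < m \<and> m < p + n \<and> c m \<in> side q (p + n))"
proof (cases "m = p \<or> m = q \<or> m = p + n")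
  case True
  then show ?thesis using assms(1) per by (auto simp: pair_def)
next
  case False
  then show ?thesis using assms sideI by (cases "m < q") auto
qed

lemma pair_flip: "pair p q \<Longrightarrow> pair q (p + n)"
  using per by (auto simp: pair_def)

lemma pair_dest:
  assumes "pair p q" shows "odd (q - p)" "p + 2 < q" "q + 2 < p + n"
proof -
  have pq: "p < q" "q < p + n" "c p = c q" using assms by (auto simp: pair_def)
  then show o: "odd (q - p)" using eq_even[of q p] dvd_window[of q p] by auto
  have "q \<noteq> p + 1" using c_ne[of p] pq by auto
  then show "p + 2 < q" using pq o by presburger
  have "p + n \<noteq> q + 1" using c_ne[of q] per[of p] pq by auto
  then show "q + 2 < p + n" using pq o n_even by presburger
qed

lemma not_onceE:
  assumes "\<not> once k" obtains q where "pair k q"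
proof -
  obtain m where m: "c m = c k" "\<not> n dvd m - k" using assms by (auto simp: once_def)
  obtain q where q: "k \<le> q" "q < k + n" "n dvd q - m" by (rule residue)
  then have "c q = c k" "q \<noteq> k" using m c_cong[of q m] by (auto simp: dvd_diff_commute)
  then show thesis using q by (intro that[of q]) (auto simp: pair_def)
qed

lemma pair_not_once: "pair p q \<Longrightarrow> c k = c p \<Longrightarrow> \<not> once k"
proof
  assume *: "pair p q" "c k = c p" "once k"
  then have "n dvd p - k" "n dvd q - k" by (auto simp: once_def pair_def)
  then have "n dvd q - p" using dvd_diff[of n "q - k" "p - k"] by simp
  then show False using dvd_window[of q p] * by (auto simp: pair_def)
qed

lemma once_cong: "c k = c l \<Longrightarrow> once k \<longleftrightarrow> once l"
  by (metis not_onceE pair_not_once)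

text \<open>A vertex on both arcs would have two visits crossing \<open>p\<close> and
  \<open>q\<close>, and an inner position with vertex \<open>c p\<close> would be a third
  visit.\<close>

lemma side_disjoint:
  assumes "pair p q" "x \<in> side p q"
  shows "x \<notin> side q (p + n)" "x \<noteq> c p"
proof -
  note d = pair_dest[OF assms(1)]
  obtain m where m: "p < m" "m < q" "x = c m" using assms(2) by (auto simp: side_def)
  show "x \<noteq> c p"
  proof
    assume "x = c p"
    then have "c m = c p" "c m = c q" using m assms(1) by (auto simp: pair_def)
    moreover have "\<not> n dvd m - p" "\<not> n dvd m - q" "\<not> n dvd p - q"
      using dvd_window[of m p] dvd_window[of m q] dvd_window[of p q] m d by auto
    ultimately show False using third_position by blast
  qed
  show "x \<notin> side q (p + n)"
    using m no_crossing[of p m q] assms(1) by (auto simp: side_def pair_def)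
qed

lemma side_cover: "pair p q \<Longrightarrow> c m \<in> side p q \<or> c m \<in> side q (p + n) \<or> c m = c p"
proof -
  assume pq: "pair p q"
  obtain m' where m': "p \<le> m'" "m' < p + n" "n dvd m' - m" by (rule residue)
  then show ?thesis using position_cases[OF pq, of m'] c_cong[of m' m] by auto
qed

text \<open>This is the cut vertex property: the walk changes from one arc to the other only at
  \<open>c p\<close>.\<close>

lemma side_edge:
  assumes pq: "pair p q" and m: "e m \<inter> side p q \<noteq> {}"
  shows "e m \<subseteq> side p q \<union> {c p}"
proof -
  obtain m' where m': "p \<le> m'" "m' < p + n" "n dvd m' - m" by (rule residue)
  have em: "e m = {c m', c (m' + 1)}" using e_cong[OF m'(3)] by (simp add: e_def)
  show ?thesis
  proof (cases "m' < q")
    case True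
    then have "c m' \<in> side p q \<union> {c p}" "c (m' + 1) \<in> side p q \<union> {c p}"
      using position_cases[OF pq, of m'] position_cases[OF pq, of "m' + 1"] m' pair_dest[OF pq] by auto
    then show ?thesis unfolding em by blast
  next
    case False
    then have "c m' \<in> side q (p + n) \<union> {c p}" "c (m' + 1) \<in> side q (p + n) \<union> {c p}"
      using position_cases[OF pq, of m'] position_cases[OF pq, of "m' + 1"] m' pair_dest[OF pq] by auto
    then have "e m \<subseteq> side q (p + n) \<union> {c p}" unfolding em by blast
    then show ?thesis using m side_disjoint[OF pq] by blast
  qed
qed

lemma pair_edges:
  assumes pq: "pair p q" and m: "c p \<in> e m"
  shows "((n dvd m - p \<or> n dvd m - (q - 1)) \<and> e m \<inter> side p q \<noteq> {}) \<or>
    ((n dvd m - (p - 1) \<or> n dvd m - q) \<and> e m \<inter> side q (p + n) \<noteq> {})"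
proof -
  note d = pair_dest[OF pq]
  have cq: "c q = c p" using pq by (auto simp: pair_def)
  have s: "c (p + 1) \<in> side p q" "c (q - 1) \<in> side p q" "c (q + 1) \<in> side q (p + n)" "c (p + n - 1) \<in> side q (p + n)"
    using d by (auto simp: side_def)
  have "c (p + n - 1) = c (p - 1)" by (rule c_cong) simp
  then have ee: "e p \<inter> side p q \<noteq> {}" "e (q - 1) \<inter> side p q \<noteq> {}" "e q \<inter> side q (p + n) \<noteq> {}" "e (p - 1) \<inter> side q (p + n) \<noteq> {}"
    using s by (auto simp: e_def)
  have "n dvd x - p \<or> n dvd x - q" if "c x = c p" for x
    using third_position[of x p q] that cq d dvd_window[of p q] by auto
  from this[of m] this[of "m + 1"] m
  have "n dvd m - p \<or> n dvd m - q \<or> n dvd m + 1 - p \<or> n dvd m + 1 - q" by (auto simp: e_def)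
  then consider "n dvd m - p" | "n dvd m - q" | "n dvd m - (p - 1)" | "n dvd m - (q - 1)"
    by (auto simp: algebra_simps)
  then show ?thesis using ee e_cong[of m] by cases auto
qed

lemma once_edges:
  assumes "once k" "c k \<in> e m" shows "n dvd m - k \<or> n dvd m - (k - 1)"
proof -
  have "c m = c k \<or> c (m + 1) = c k" using assms(2) by (auto simp: e_def)
  then have "n dvd m - k \<or> n dvd m + 1 - k" using assms(1) by (auto simp: once_def)
  then show ?thesis by (simp add: algebra_simps)
qed

text \<open>Two traversals in the same direction would give crossing pairs. Two in opposite
  directions at positions of different parity would put both \<open>i - j - 1\<close> and
  \<open>i - j + 1\<close> into the multiples of \<open>n\<close>. Hence no edge divides both
  monomials of the walk.\<close>

lemma e_eq:
  assumes "e i = e j" shows "n dvd i - j \<or> (c i = c (j + 1) \<and> c (i + 1) = c j \<and> even (i - j))"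
proof -
  consider (same) "c i = c j" "c (i + 1) = c (j + 1)" | (opp) "c i = c (j + 1)" "c (i + 1) = c j"
    using assms by (auto simp: e_def doubleton_eq_iff)
  then show ?thesis
  proof cases
    case same
    have "n dvd i - j"
    proof (rule ccontr)
      assume nd: "\<not> n dvd i - j"
      obtain m where m: "i \<le> m" "m < i + n" "n dvd m - j" by (rule residue)
      then have "m \<noteq> i" using nd by auto
      moreover have cm: "c m = c i" "c (m + 1) = c (i + 1)"
        using c_cong[of m j] c_cong[of "m + 1" "j + 1"] m same by auto
      ultimately have "pair i m" using m by (auto simp: pair_def)
      from pair_dest[OF this] show False
        using no_crossing[of i "i + 1" m "m + 1"] cm by auto
    qed
    then show ?thesis ..
  next
    case opp
    have "even (i - j)"
    proof (rule ccontr)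
      assume "odd (i - j)"
      then have "n dvd i - (j + 1)" "n dvd (i + 1) - j" using eq_even opp by auto
      then have "n dvd 2" using dvd_diff[of n "(i + 1) - j" "i - (j + 1)"] by simp
      then show False using n4 zdvd_imp_le[of n 2] by simp
    qed
    then show ?thesis using opp by blast
  qed
qed

lemma e_parity: "e i = e j \<Longrightarrow> even i = even j"
  using e_eq[of i j] dvd_even[of "i - j"] by auto

lemma e_ne: "e k \<noteq> e (k - 1)"
  using e_parity[of k "k - 1"] by auto

lemma twice_edge:
  assumes "e i = e j" "\<not> n dvd i - j"
  shows "c i = c (j + 1)" "c (i + 1) = c j"
  using assms e_eq by blast+

section \<open>The fibre of a walk satisfying the chord conditions\<close>

text \<open>Every position lies on exactly one edge of each parity, so the degree counts
  visits.\<close>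

lemma degree_count: "int (vdeg (P \<sigma> 0 n) x) = (\<Sum>k | p \<le> k \<and> k < p + n. delta (c k) x)"
proof -
  \<comment> \<open>Adding both parities avoids a case distinction at the ends. Over a full period
    the end terms cancel and both summands agree.\<close>
  have *: "int (vdeg (P \<sigma> i j) x) + int (vdeg (P (\<not> \<sigma>) i j) x) =
      2 * (\<Sum>k | i \<le> k \<and> k < j. delta (c k) x) - delta (c i) x + delta (c j) x" if "i \<le> j" for i j
    using that
  proof (induction j rule: int_ge_induct)
    case base
    have "{k. i \<le> k \<and> k < i} = {}" by auto
    then show ?case by (simp only: P_empty vdeg_0 sum.empty)
  next
    case (step j)
    have "P \<tau> i (j + 1) = P \<tau> i j + (if even j = \<tau> then mon (e j) else 0)" for \<tau>
      using P_split[of i j "j + 1"] step.hyps P_Suc by simp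
    moreover have "int (vdeg (mon (e j)) x) = delta (c j) x + delta (c (j + 1)) x"
      unfolding e_def by (rule vdeg_mon[OF c_ne])
    moreover have "{k. i \<le> k \<and> k < j + 1} = insert j {k. i \<le> k \<and> k < j}" using step.hyps by auto
    moreover have "finite {k. i \<le> k \<and> k < j}" using finite_idx[of i j "\<lambda>_. True"] by simp
    ultimately show ?case using step.IH by (auto simp: vdeg_add)
  qed
  have "c (p + n) = c p" by (rule per)
  then show ?thesis using *[of p "p + n"] n_pos vdeg_full[of \<sigma>] P_full[of _ p] by simp
qed

lemma finite_window [simp]: "finite {k::int. i \<le> k \<and> k < j}" "finite {k::int. i < k \<and> k < j}"
  by (rule finite_subset[of _ "{i..j}"]; auto)+

lemma degree_once: "once k \<Longrightarrow> vdeg (P \<sigma> 0 n) (c k) = 1"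
proof -
  assume o: "once k"
  have "int (vdeg (P \<sigma> 0 n) (c k)) = (\<Sum>i | k \<le> i \<and> i < k + n. delta (c i) (c k))"
    by (rule degree_count)
  also have "\<dots> = (\<Sum>i | k \<le> i \<and> i < k + n. if i = k then 1 else 0)"
  proof (rule sum.cong[OF refl])
    fix i assume i: "i \<in> {i. k \<le> i \<and> i < k + n}"
    have "c i = c k \<longleftrightarrow> i = k"
    proof
      assume "c i = c k"
      then have "n dvd i - k" using o by (simp add: once_def)
      then show "i = k" using i dvd_window[of i k] by auto
    qed simp
    then show "delta (c i) (c k) = (if i = k then 1 else 0)" by (auto simp: delta_def)
  qed
  also have "\<dots> = 1" using n_pos by simp
  finally show ?thesis by simp
qed

lemma degree_pair: "pair p q \<Longrightarrow> vdeg (P \<sigma> 0 n) (c p) = 2"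
proof -
  assume pq: "pair p q"
  have "int (vdeg (P \<sigma> 0 n) (c p)) = (\<Sum>i | p \<le> i \<and> i < p + n. delta (c i) (c p))"
    by (rule degree_count)
  also have "\<dots> = (\<Sum>i\<in>{p, q}. 1)"
  proof (rule sum.mono_neutral_cong_right)
    show "{p, q} \<subseteq> {i. p \<le> i \<and> i < p + n}" using pq by (auto simp: pair_def)
    show "\<forall>i\<in>{i. p \<le> i \<and> i < p + n} - {p, q}. delta (c i) (c p) = 0"
    proof
      fix i assume i: "i \<in> {i. p \<le> i \<and> i < p + n} - {p, q}"
      then have "c i \<in> side p q \<or> c i \<in> side q (p + n)" using sideI by (cases "i < q") auto
      then have "c i \<noteq> c p" using side_disjoint[OF pq] side_disjoint[OF pair_flip[OF pq]] pq
        by (metis pair_def)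
      then show "delta (c i) (c p) = 0" by (auto simp: delta_def)
    qed
    show "delta (c i) (c p) = 1" if "i \<in> {p, q}" for i using that pq by (auto simp: pair_def delta_def)
  qed simp
  also have "\<dots> = 2" using pq by (simp add: pair_def)
  finally show ?thesis by simp
qed

lemma finite_side [simp]: "finite (side p q)" by (simp add: side_def)

text \<open>The sum counts the positions strictly between \<open>p\<close> and \<open>q\<close>, and
  \<open>q - p\<close> is odd.\<close>

lemma degree_side:
  assumes pq: "pair p q" shows "even (\<Sum>x\<in>side p q. vdeg (P \<sigma> 0 n) x)"
proof -
  have "int (\<Sum>x\<in>side p q. vdeg (P \<sigma> 0 n) x) = (\<Sum>x\<in>side p q. \<Sum>k | p \<le> k \<and> k < p + n. delta (c k) x)"
    using degree_count[of \<sigma> _ p] by simp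
  also have "\<dots> = (\<Sum>k | p \<le> k \<and> k < p + n. \<Sum>x\<in>side p q. delta (c k) x)" by (rule sum.swap)
  also have "\<dots> = (\<Sum>k | p \<le> k \<and> k < p + n. if c k \<in> side p q then 1 else 0)"
    by (rule sum.cong[OF refl]) (simp add: delta_def)
  also have "\<dots> = (\<Sum>k | p < k \<and> k < q. 1)"
  proof (rule sum.mono_neutral_cong_right)
    show "{k. p < k \<and> k < q} \<subseteq> {k. p \<le> k \<and> k < p + n}" using pq by (auto simp: pair_def)
    show "\<forall>k\<in>{k. p \<le> k \<and> k < p + n} - {k. p < k \<and> k < q}. (if c k \<in> side p q then 1 else 0) = (0::int)"
    proof
      fix k assume k: "k \<in> {k. p \<le> k \<and> k < p + n} - {k. p < k \<and> k < q}"
      then have "c k \<in> side q (p + n) \<or> c k = c p" using position_cases[OF pq, of k] by auto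
      then show "(if c k \<in> side p q then 1 else 0) = (0::int)" using side_disjoint[OF pq] by auto
    qed
  qed (auto simp: side_def)
  also have "\<dots> = int (card {p<..<q})" by (simp add: greaterThanLessThan_def greaterThan_def lessThan_def Int_def)
  also have "\<dots> = q - p - 1" using pq by (simp add: pair_def)
  finally have "int (\<Sum>x\<in>side p q. vdeg (P \<sigma> 0 n) x) = q - p - 1" .
  moreover have "even (q - p - 1)" using pair_dest(1)[OF pq] by simp
  ultimately show ?thesis by (metis even_of_nat_iff)
qed

end

lemma (in noncrossing_walk) side_edge_disjoint:
  assumes pq: "pair p q" and m: "e m \<inter> side p q \<noteq> {}"
  shows "e m \<inter> side q (p + n) = {}"
proof (rule ccontr)
  assume "e m \<inter> side q (p + n) \<noteq> {}"
  then obtain x where x: "x \<in> e m" "x \<in> side q (p + n)" by blast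
  then have "x \<in> side p q \<or> x = c q" using side_edge[OF pq m] pq by (auto simp: pair_def)
  then show False using x side_disjoint(1)[OF pq] side_disjoint(2)[OF pair_flip[OF pq]] by blast
qed

text \<open>The conditions of the theorem in terms of positions. The first three assumptions exclude
  bridges and even chords. \<open>sinks\<close> expresses strong primitivity: an edge between two
  repeated vertices is traversed twice, hence in no cyclic block. \<open>chords_cross\<close> says
  that effectively crossing chords are parallel and so form an \<open>F4\<close>; its second
  alternative is the wrap-around at the end of the window.\<close>

locale chord_walk = noncrossing_walk G c n for G :: "'v sgraph" and c n +
  assumes chord_once: "chd {c i, c j} \<Longrightarrow> once i"
    and chord_even: "chd {c i, c j} \<Longrightarrow> even (i - j)"
    and chord_side: "pair p q \<Longrightarrow> p < i \<Longrightarrow> i < q \<Longrightarrow> q < j \<Longrightarrow> j < p + n \<Longrightarrow> \<not> chd {c i, c j}"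
    and sinks: "\<not> once k \<Longrightarrow> \<not> once (k + 1) \<Longrightarrow> \<exists>m. e m = e k \<and> \<not> n dvd m - k"
    and chords_cross: "chd {c i, c j} \<Longrightarrow> chd {c k, c l} \<Longrightarrow> 0 \<le> i \<Longrightarrow> i < k \<Longrightarrow> k < j \<Longrightarrow> j < l \<Longrightarrow> l < n \<Longrightarrow>
      odd (k - i) \<Longrightarrow> k = i + 1 \<and> l = j + 1 \<or> j = k + 1 \<and> i = 0 \<and> l = n - 1"
    and F4_uncrossed: "chd {c (a - 1), c (b - 1)} \<Longrightarrow> chd {c a, c b} \<Longrightarrow> chd {c (a + 1), c (b + 1)} \<Longrightarrow> n = 4"
begin

lemma chord_once2: "chd {c i, c j} \<Longrightarrow> once j"
  using chord_once[of j i] by (simp add: insert_commute)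

text \<open>The ends of a chord are visited once, so a chord determines its positions up to
  multiples of \<open>n\<close> and therefore also the neighbouring vertices on the walk.\<close>

lemma chord_shift:
  assumes "chd {c p, c q}" "{c p, c q} = {c i, c j}"
  shows "{c (p + m), c (q + m)} = {c (i + m), c (j + m)}"
proof -
  have *: "c (x + m) = c (y + m)" if "once y" "c x = c y" for x y
    using that c_cong[of "x + m" "y + m"] by (auto simp: once_def)
  have "chd {c i, c j}" using assms by simp
  then have o: "once i" "once j" using chord_once chord_once2 by blast+
  have "c p = c i \<and> c q = c j \<or> c p = c j \<and> c q = c i" using assms(2) by (auto simp: doubleton_eq_iff)
  then show ?thesis
  proof
    assume "c p = c i \<and> c q = c j"
    then have "c (p + m) = c (i + m)" "c (q + m) = c (j + m)" using *[OF o(1), of p] *[OF o(2), of q] by blast+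
    then show ?thesis by simp
  next
    assume "c p = c j \<and> c q = c i"
    then have "c (p + m) = c (j + m)" "c (q + m) = c (i + m)" using *[OF o(2), of p] *[OF o(1), of q] by blast+
    then show ?thesis by auto
  qed
qed

end

lemma even_sum_cong:
  fixes f h :: "'a \<Rightarrow> nat"
  assumes "finite A" "\<And>g. g \<in> A \<Longrightarrow> even (f g) \<longleftrightarrow> even (h g)"
  shows "even (sum f A) \<longleftrightarrow> even (sum h A)"
  using assms by (induction A) auto

lemma vdeg_lookup_le: "x \<in> g \<Longrightarrow> Poly_Mapping.lookup z g \<le> vdeg z x"
proof (cases "g \<in> keys z")
  case True
  assume "x \<in> g"
  then show ?thesis unfolding vdeg_def using True
    by (subst sum.remove[OF _ True]) auto
qed (simp add: in_keys_iff)

lemma vdeg_1_unique: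
  assumes "vdeg z x = 1" "x \<in> g" "x \<in> h" "g \<in> keys z" "h \<in> keys z"
  shows "g = h"
proof (rule ccontr)
  assume "g \<noteq> h"
  have "(\<Sum>f\<in>{g, h}. if x \<in> f then Poly_Mapping.lookup z f else 0) \<le> vdeg z x"
    unfolding vdeg_def using assms by (intro sum_mono2) auto
  moreover have "Poly_Mapping.lookup z g \<ge> 1" "Poly_Mapping.lookup z h \<ge> 1"
    using assms by (auto simp: in_keys_iff)
  ultimately show False using assms \<open>g \<noteq> h\<close> by simp
qed

lemma vdeg_pos: "g \<in> keys z \<Longrightarrow> x \<in> g \<Longrightarrow> vdeg z x > 0"
  using vdeg_lookup_le[of x g z] by (auto simp: in_keys_iff)

lemma vdeg_pos_iff: "vdeg z x > 0 \<longleftrightarrow> (\<exists>g\<in>keys z. x \<in> g)"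
proof
  assume pos: "vdeg z x > 0"
  show "\<exists>g\<in>keys z. x \<in> g"
  proof (rule ccontr)
    assume "\<not> ?thesis"
    then have "vdeg z x = 0" unfolding vdeg_def by (intro sum.neutral) auto
    then show False using pos by simp
  qed
qed (auto intro: vdeg_pos)

section \<open>How a monomial of the fibre matches the positions of the walk\<close>

locale fiber_element = chord_walk G c n for G :: "'v sgraph" and c n +
  fixes z :: "'v edge_monom"
  assumes z_edges: "keys z \<subseteq> edges G" and z_deg: "vdeg z = vdeg (P True 0 n)"
begin

abbreviation "lk \<equiv> Poly_Mapping.lookup z"

lemma deg_once: "once k \<Longrightarrow> vdeg z (c k) = 1"
  using degree_once z_deg by simp

lemma deg_pair: "pair p q \<Longrightarrow> vdeg z (c p) = 2"
  using degree_pair z_deg by simp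

lemma deg_range: "vdeg z x > 0 \<Longrightarrow> x \<in> range c"
  unfolding z_deg vdeg_pos_iff keys_P by (auto simp: e_def)

text \<open>A vertex of positive degree lies on the walk, since the degree is that of the walk
  monomial.\<close>

lemma z_cases:
  assumes "g \<in> keys z"
  obtains (edge) m where "g = e m" | (chord) i j where "g = {c i, c j}" "chd g"
proof (cases "g \<in> range e")
  case False
  have gE: "g \<in> edges G" using z_edges assms by blast
  then obtain x y where xy: "g = {x, y}" using G by (auto simp: finite_simple_graph_def)
  then have "x \<in> range c" "y \<in> range c" using vdeg_pos[OF assms] deg_range by simp_all
  then show thesis using chord xy gE False by (auto simp: chd_def)
qed (use edge in blast)

text \<open>Chords do not join the two sides and do not end at a repeated vertex, which leaves the
  two walk edges from \<open>c p\<close> into the side.\<close>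

lemma z_side:
  assumes pq: "pair p q" and g: "g \<in> keys z" "x \<in> g" "y \<in> g" "x \<in> side p q" "y \<notin> side p q"
  shows "g = e p \<or> g = e (q - 1)"
  using g(1)
proof (cases rule: z_cases)
  case (edge m)
  then have "e m \<subseteq> side p q \<union> {c p}" using side_edge[OF pq] g by blast
  then have y: "y = c p" using g edge by blast
  then have "c p \<in> e m" using g edge by blast
  moreover have "e m \<inter> side q (p + n) = {}"
    using side_edge_disjoint[OF pq] g edge by blast
  ultimately have "n dvd m - p \<or> n dvd m - (q - 1)" using pair_edges[OF pq] by blast
  then show ?thesis using edge e_cong by blast
next
  case (chord i0 j0)
  then obtain i1 j1 where ij: "g = {c i1, c j1}" "x = c i1" "y = c j1"
    using g by (metis insertE insert_commute singletonD)
  obtain i where i: "p < i" "i < q" "x = c i" using g(4) by (auto simp: side_def)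
  have f: "chd {c i, c j1}" using chord ij i by simp
  have "c j1 \<noteq> c p" using chord_once2[OF f] pair_not_once[OF pq] by metis
  then have "c j1 \<in> side q (p + n)" using side_cover[OF pq, of j1] g(5) ij(3) by simp
  then obtain j where j: "q < j" "j < p + n" "c j1 = c j" by (auto simp: side_def)
  then show ?thesis using chord_side[OF pq i(1,2) j(1,2)] f by simp
qed

text \<open>The share of one side in the degree of \<open>c p\<close>. The sum is over a set, so
  that it is not doubled if the walk enters and leaves the side through the same edge.\<close>

definition wt :: "int \<Rightarrow> int \<Rightarrow> nat" where "wt p q = (\<Sum>g\<in>{e p, e (q - 1)}. lk g)"

text \<open>The degrees on a side have an even sum. A variable inside the side contributes its
  exponent twice, one that leaves it contributes it once, and the latter are the two edges of
  \<open>wt\<close>.\<close>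

lemma wt_even:
  assumes pq: "pair p q" shows "even (wt p q)"
proof -
  have e1: "e p \<inter> side p q = {c (p + 1)}" "e (q - 1) \<inter> side p q = {c (q - 1)}"
    using pair_dest[OF pq] side_disjoint[OF pq] pq sideI[of p "p + 1" q] sideI[of p "q - 1" q]
    by (auto simp: e_def pair_def)
  have "(\<Sum>x\<in>side p q. vdeg z x) = (\<Sum>g\<in>keys z. \<Sum>x\<in>side p q. if x \<in> g then lk g else 0)"
    unfolding vdeg_def by (rule sum.swap)
  also have "\<dots> = (\<Sum>g\<in>keys z. lk g * card (g \<inter> side p q))"
    by (rule sum.cong[OF refl]) (simp add: sum.inter_restrict[symmetric] Int_commute)
  also have "even \<dots> \<longleftrightarrow> even (\<Sum>g\<in>keys z. if g \<in> {e p, e (q - 1)} then lk g else 0)"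
    (is "even (sum ?a _) = even (sum ?b _)")
  proof -
    have "even (?a g) = even (?b g)" if g: "g \<in> keys z" for g
    proof (cases "g \<in> {e p, e (q - 1)}")
      case True
      then show ?thesis using e1 by auto
    next
      case False
      have "g \<in> edges G" using z_edges g by blast
      then obtain x y where xy: "g = {x, y}" "x \<noteq> y"
        using G by (auto simp: finite_simple_graph_def)
      have xg: "x \<in> g" "y \<in> g" and ng: "\<not> (g = e p \<or> g = e (q - 1))" using xy(1) False by simp_all
      have "g \<inter> side p q = g \<or> g \<inter> side p q = {}"
      proof (cases "x \<in> side p q")
        case True
        then have "y \<in> side p q" using z_side[OF pq g xg] ng by (rule_tac ccontr) simp
        then have "g \<subseteq> side p q" using True xy(1) by simp
        then show ?thesis by (simp add: Int_absorb2)
      next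
        case False
        then have "y \<notin> side p q" using z_side[OF pq g xg(2,1)] ng by (rule_tac notI) simp
        then have "g \<inter> side p q = {}" using False xy(1) by simp
        then show ?thesis by (rule disjI2)
      qed
      moreover have "card g = 2" using xy by simp
      ultimately have "even (card (g \<inter> side p q))" by (elim disjE) simp_all
      then show ?thesis using False by simp
    qed
    then show ?thesis by (intro even_sum_cong) simp_all
  qed
  also have "(\<Sum>g\<in>keys z. if g \<in> {e p, e (q - 1)} then lk g else 0) = wt p q"
    unfolding wt_def by (rule sum.mono_neutral_cong) (auto simp: in_keys_iff)
  finally show ?thesis using degree_side[OF pq, of True] z_deg by simp
qed

text \<open>No chord ends at \<open>c p\<close>, so the two sides share its degree. Together with
  \<open>wt_even\<close> one of them gets everything.\<close>

lemma wt_total: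
  assumes pq: "pair p q" shows "wt p q + wt q (p + n) = 2"
proof -
  note qp = pair_flip[OF pq]
  have cq: "c q = c p" using pq by (simp add: pair_def)
  let ?A = "{e p, e (q - 1)}" and ?B = "{e q, e (p + n - 1)}"
  have "e (p + n - 1) = e (p - 1)" by (rule e_cong) simp
  have s: "c (p + 1) \<in> side p q" "c (q - 1) \<in> side p q" "c (q + 1) \<in> side q (p + n)" "c (p + n - 1) \<in> side q (p + n)"
    using pair_dest[OF pq] by (auto intro!: sideI)
  have dj: "?A \<inter> ?B = {}"
    using s side_disjoint[OF pq] side_disjoint[OF qp] cq per[of p] by (auto simp: e_def doubleton_eq_iff)
  have inA: "c p \<in> g" if "g \<in> ?A \<union> ?B" for g using that cq per[of p] by (auto simp: e_def)
  have "vdeg z (c p) = (\<Sum>g\<in>?A \<union> ?B. lk g)"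
    unfolding vdeg_def
  proof (rule sum.mono_neutral_cong)
    show "(if c p \<in> g then lk g else 0) = 0" if "g \<in> keys z - (?A \<union> ?B)" for g
    proof (rule ccontr)
      assume "(if c p \<in> g then lk g else 0) \<noteq> 0"
      then have cg: "c p \<in> g" by (simp split: if_splits)
      have "g \<in> keys z" using that by blast
      then show False
      proof (cases rule: z_cases)
        case (edge m)
        then show False using pair_edges[OF pq, of m] cg that e_cong[of m] \<open>e (p + n - 1) = e (p - 1)\<close> by auto
      next
        case (chord i j)
        then show False using cg chord_once[of i j] chord_once2[of i j] pair_not_once[OF pq] by auto
      qed
    qed
  qed (use inA in \<open>auto simp: in_keys_iff\<close>)
  also have "\<dots> = wt p q + wt q (p + n)" unfolding wt_def by (rule sum.union_disjoint) (use dj in auto)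
  finally show ?thesis using deg_pair[OF pq] by simp
qed

text \<open>Here strong primitivity enters: an edge traversed once has an end that is visited once,
  and the degree there is one.\<close>

lemma lk_le_1:
  assumes "\<And>m. e m = e k \<Longrightarrow> n dvd m - k" shows "lk (e k) \<le> 1"
proof -
  have "once k \<or> once (k + 1)" using sinks assms by blast
  then show ?thesis
  proof
    assume "once k"
    then show ?thesis using vdeg_lookup_le[of "c k" "e k" z] deg_once by (simp add: e_def)
  next
    assume "once (k + 1)"
    then show ?thesis using vdeg_lookup_le[of "c (k + 1)" "e k" z] deg_once by (simp add: e_def)
  qed
qed

lemma inner_edges_once:
  assumes pq: "pair p q" "e p \<noteq> e (q - 1)"
  shows "lk (e p) \<le> 1" "lk (e (q - 1)) \<le> 1"
proof -
  have s: "c (p + 1) \<in> side p q" "c (q - 1) \<in> side p q" using pair_dest[OF pq(1)] by (auto intro!: sideI)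
  have cq: "c q = c p" using pq by (simp add: pair_def)
  have *: "n dvd m - p \<or> n dvd m - (q - 1)" if "e m = e p \<or> e m = e (q - 1)" for m
  proof -
    have "c p \<in> e m" using that cq by (auto simp: e_def)
    moreover have "c (p + 1) \<in> e p" "c (q - 1) \<in> e (q - 1)" by (simp_all add: e_def)
    then have "e m \<inter> side p q \<noteq> {}" using that s by blast
    then have "e m \<inter> side q (p + n) = {}" by (rule side_edge_disjoint[OF pq(1)])
    ultimately show ?thesis using pair_edges[OF pq(1), of m] by blast
  qed
  show "lk (e p) \<le> 1"
    by (rule lk_le_1) (use * e_cong pq(2) in metis)
  show "lk (e (q - 1)) \<le> 1"
    by (rule lk_le_1) (use * e_cong pq(2) in metis)
qed

definition used :: "int \<Rightarrow> bool" where "used k \<longleftrightarrow> e k \<in> keys z"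

definition chpos :: "int \<Rightarrow> int \<Rightarrow> bool" where "chpos k l \<longleftrightarrow> {c k, c l} \<in> keys z \<and> chd {c k, c l}"

lemma used_cong: "n dvd k - l \<Longrightarrow> used k \<longleftrightarrow> used l"
  using e_cong by (simp add: used_def)

lemma wt_2_used: "pair p q \<Longrightarrow> wt p q = 2 \<Longrightarrow> used p \<and> used (q - 1)"
proof -
  assume pq: "pair p q" "wt p q = 2"
  show ?thesis
  proof (cases "e p = e (q - 1)")
    case True
    then have "lk (e p) = 2" using pq by (simp add: wt_def)
    then show ?thesis using True by (simp add: used_def in_keys_iff)
  next
    case False
    then have "lk (e p) + lk (e (q - 1)) = 2" using pq by (simp add: wt_def)
    then have "lk (e p) \<noteq> 0" "lk (e (q - 1)) \<noteq> 0" using inner_edges_once[OF pq(1) False] by auto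
    then show ?thesis by (simp add: used_def in_keys_iff)
  qed
qed

lemma wt_0_unused: "wt p q = 0 \<Longrightarrow> \<not> used p \<and> \<not> used (q - 1)"
  by (auto simp: wt_def used_def in_keys_iff)

lemma position_once: "once k \<Longrightarrow> \<not> (\<exists>l. chpos k l) \<Longrightarrow> used k \<longleftrightarrow> \<not> used (k - 1)"
proof -
  assume k: "once k" "\<not> (\<exists>l. chpos k l)"
  have d: "vdeg z (c k) = 1" using deg_once k by blast
  have "\<not> (used k \<and> used (k - 1))"
    using vdeg_1_unique[OF d, of "e k" "e (k - 1)"] e_ne[of k] by (auto simp: used_def e_def)
  moreover have "used k \<or> used (k - 1)"
  proof -
    obtain g where g: "g \<in> keys z" "c k \<in> g" using d vdeg_pos_iff[of z "c k"] by auto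
    from g(1) show ?thesis
    proof (cases rule: z_cases)
      case (edge m)
      then show ?thesis using once_edges[OF k(1), of m] g e_cong[of m] by (auto simp: used_def)
    next
      case (chord i j)
      then have "g = {c k, c i} \<or> g = {c k, c j}" using g by auto
      then show ?thesis using k(2) chord g unfolding chpos_def by metis
    qed
  qed
  ultimately show ?thesis by blast
qed

lemma position_chord: "chpos k l \<Longrightarrow> \<not> used k \<and> \<not> used (k - 1)"
proof -
  assume kl: "chpos k l"
  then have d: "vdeg z (c k) = 1" using deg_once chord_once by (auto simp: chpos_def)
  have "{c k, c l} \<notin> range e" using kl by (simp add: chpos_def chd_def)
  then have "{c k, c l} \<noteq> e k" "{c k, c l} \<noteq> e (k - 1)" by blast+
  moreover have "c k \<in> e k" "c k \<in> e (k - 1)" by (simp_all add: e_def)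
  ultimately show ?thesis
    using vdeg_1_unique[OF d, of "{c k, c l}" "e k"] vdeg_1_unique[OF d, of "{c k, c l}" "e (k - 1)"] kl
    unfolding used_def chpos_def by blast
qed

text \<open>The side of weight two has both of its edges at \<open>c k\<close> used, the other side
  none. One of the edges of either side starts or ends at the position \<open>k\<close>, so exactly
  one of the two neighbours of this position is chosen.\<close>

lemma position_pair:
  assumes "\<not> once k" shows "used k \<longleftrightarrow> \<not> used (k - 1)"
proof -
  obtain q where pq: "pair k q" using assms by (rule not_onceE)
  have u: "used (k + n - 1) = used (k - 1)" by (rule used_cong) simp
  have "wt k q = 2 \<and> wt q (k + n) = 0 \<or> wt k q = 0 \<and> wt q (k + n) = 2"
  proof -
    have "wt k q = 0 \<or> wt k q = 1 \<or> wt k q = 2" using wt_total[OF pq] by arith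
    then show ?thesis using wt_total[OF pq] wt_even[OF pq] by auto
  qed
  then show ?thesis
    using wt_2_used[OF pq] wt_2_used[OF pair_flip[OF pq]] wt_0_unused[of k q] wt_0_unused[of q "k + n"] u by auto
qed

lemma position: "\<not> (\<exists>l. chpos k l) \<Longrightarrow> used k \<longleftrightarrow> \<not> used (k - 1)"
  using position_once position_pair by blast

lemma chpos_sym: "chpos k l \<Longrightarrow> chpos l k"
  by (simp add: chpos_def insert_commute)

lemma chpos_unique: "chpos k l \<Longrightarrow> chpos k l' \<Longrightarrow> n dvd l - l'"
proof -
  assume kl: "chpos k l" "chpos k l'"
  then have d: "vdeg z (c k) = 1" using deg_once chord_once by (auto simp: chpos_def)
  have "{c k, c l} = {c k, c l'}"
    using vdeg_1_unique[OF d, of "{c k, c l}" "{c k, c l'}"] kl by (auto simp: chpos_def)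
  then have "c l = c l'" using kl by (auto simp: doubleton_eq_iff)
  then show ?thesis using kl chord_once2[of k l'] by (auto simp: chpos_def once_def)
qed

lemma chpos_even: "chpos k l \<Longrightarrow> even (k - l)"
  using chord_even by (auto simp: chpos_def)

lemma chpos_cong: "n dvd l - l' \<Longrightarrow> chpos k l \<longleftrightarrow> chpos k l'"
  using c_cong[of l l'] by (simp add: chpos_def)

text \<open>Otherwise every second edge of the segment from \<open>i\<close> to \<open>j\<close> would be used, including the last
  one, which meets the chord at \<open>j\<close>.\<close>

lemma inner_chord:
  assumes ij: "chpos i j" "i < j"
  shows "\<exists>k l. i < k \<and> k < j \<and> odd (k - i) \<and> chpos k l"
proof (rule ccontr)
  assume no: "\<not> ?thesis"
  have "i + 1 + 2 * int t < j \<Longrightarrow> used (i + 1 + 2 * int t)" for t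
  proof (induction t)
    case 0
    then have "\<not> (\<exists>l. chpos (i + 1) l)" using no by auto
    then show ?case using position[of "i + 1"] position_chord[OF ij(1)] by simp
  next
    case (Suc t)
    let ?m = "i + 1 + 2 * int t"
    have u: "used ?m" using Suc by simp
    have m: "?m + 1 - 1 = ?m" "?m + 2 - 1 = ?m + 1" by simp_all
    have "\<not> (\<exists>l. chpos (?m + 1) l)" using position_chord[of "?m + 1"] u unfolding m by blast
    then have u1: "\<not> used (?m + 1)" using position[of "?m + 1"] u unfolding m by blast
    have "i < ?m + 2" "?m + 2 < j" "odd (?m + 2 - i)" using Suc.prems by simp_all
    then have "\<not> (\<exists>l. chpos (?m + 2) l)" using no by blast
    then have "used (?m + 2)" using position[of "?m + 2"] u1 unfolding m by blast
    then show ?case by (simp add: algebra_simps)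
  qed
  moreover obtain t where "j - 1 = i + 1 + 2 * int t"
  proof -
    have "even (j - i)" using chpos_even[OF ij(1)] by simp
    moreover have "j - i \<ge> 1" using ij by simp
    ultimately have "(j - i - 2) mod 2 = 0" "j - i - 2 \<ge> 0" by presburger+
    then have "j - i - 2 = 2 * int (nat ((j - i - 2) div 2))" by (simp add: minus_mod_eq_mult_div[symmetric])
    then show thesis using that[of "nat ((j - i - 2) div 2)"] by linarith
  qed
  ultimately have "used (j - 1)" by (metis diff_less less_iff_diff_less_0 zle_diff1_eq order_refl)
  then show False using position_chord[OF chpos_sym[OF ij(1)]] by blast
qed

text \<open>An inner chord from \<open>inner_chord\<close> is either nested, and then shorter, or
  crosses the given chord at odd distance, and then \<open>chords_cross\<close> makes the two
  parallel.\<close>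

lemma chord_pair_window:
  "chpos i j \<Longrightarrow> 0 \<le> i \<Longrightarrow> i < j \<Longrightarrow> j < n \<Longrightarrow> \<exists>a b. chpos a b \<and> chpos (a + 1) (b + 1)"
proof (induction "nat (j - i)" arbitrary: i j rule: less_induct)
  case less
  obtain k l0 where k: "i < k" "k < j" "odd (k - i)" "chpos k l0"
    using inner_chord[OF less.prems(1,3)] by blast
  obtain l where l: "0 \<le> l" "l < 0 + n" "n dvd l - l0" by (rule residue)
  then have kl: "chpos k l" using k chpos_cong[of l l0 k] by simp
  have "l \<noteq> i"
  proof
    assume "l = i"
    then have "n dvd k - j" using chpos_unique[of i k j] chpos_sym[OF kl] less.prems by simp
    then show False using dvd_window[of k j] k less.prems by auto
  qed
  moreover have "l \<noteq> j"
  proof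
    assume "l = j"
    then have "n dvd k - i" using chpos_unique[of j k i] chpos_sym[OF kl] chpos_sym[OF less.prems(1)] by simp
    then show False using dvd_window[of k i] k less.prems by auto
  qed
  moreover have "l \<noteq> k" using kl chd_ne[of k k] by (auto simp: chpos_def)
  ultimately consider "i < l" "l < k" | "k < l" "l < j" | "j < l" | "l < i" by linarith
  then show ?case
  proof cases
    case 1
    then show ?thesis using less.hyps[of k l] chpos_sym[OF kl] k less.prems by auto
  next
    case 2
    then show ?thesis using less.hyps[of l k] kl k less.prems by auto
  next
    case 3
    then have "k = i + 1 \<and> l = j + 1 \<or> j = k + 1 \<and> i = 0 \<and> l = n - 1"
      using chords_cross[of i j k l] less.prems kl k l by (auto simp: chpos_def)
    then show ?thesis
    proof
      assume "k = i + 1 \<and> l = j + 1"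
      then show ?thesis using less.prems kl by blast
    next
      \<comment> \<open>Position \<open>n\<close> is position 0 again, so the successor of
        \<open>l = n - 1\<close> carries the end \<open>i = 0\<close> of the first chord.\<close>
      assume *: "j = k + 1 \<and> i = 0 \<and> l = n - 1"
      have "chpos j i \<longleftrightarrow> chpos j n" using * by (intro chpos_cong) simp
      then have "chpos (k + 1) (l + 1)" using * chpos_sym[OF less.prems(1)] by simp
      then show ?thesis using kl by blast
    qed
  next
    case 4
    have "even (l - k)" using chpos_even[OF kl] by simp
    then have "odd (i - l)" using k(3) by presburger
    then have "i = l + 1 \<and> j = k + 1 \<or> k = i + 1 \<and> l = 0 \<and> j = n - 1"
      using chords_cross[of l k i j] less.prems chpos_sym[OF kl] k l 4 by (auto simp: chpos_def)
    then show ?thesis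
    proof
      assume "i = l + 1 \<and> j = k + 1"
      then show ?thesis using less.prems chpos_sym[OF kl] by blast
    next
      assume *: "k = i + 1 \<and> l = 0 \<and> j = n - 1"
      have "chpos k l \<longleftrightarrow> chpos k n" using * by (intro chpos_cong) simp
      then have "chpos (i + 1) (j + 1)" using * kl by simp
      then show ?thesis using less.prems by blast
    qed
  qed
qed

lemma chord_pair:
  assumes "chpos i0 j0"
  obtains a b where "chpos a b" "chpos (a + 1) (b + 1)"
proof -
  obtain i where i: "0 \<le> i" "i < 0 + n" "n dvd i - i0" by (rule residue)
  obtain j where j: "0 \<le> j" "j < 0 + n" "n dvd j - j0" by (rule residue)
  have ij: "chpos i j" using assms c_cong[OF i(3)] c_cong[OF j(3)] by (simp add: chpos_def)
  then have "i \<noteq> j" using chd_ne by (auto simp: chpos_def)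
  then show thesis
    using chord_pair_window[OF ij] chord_pair_window[OF chpos_sym[OF ij]] i j that
    by (cases "i < j") force+
qed

end

section \<open>The two families obtained by exchanges along an \<open>F4\<close>\<close>

context chord_walk
begin

text \<open>A chord of an \<open>F4\<close> whose walk edges \<open>e a\<close> and
  \<open>e b\<close> both have parity \<open>\<sigma>\<close>; the parity of \<open>b\<close>
  follows from \<open>chord_even\<close>.\<close>

definition swap_chord :: "bool \<Rightarrow> 'v set \<Rightarrow> bool" where
  "swap_chord \<sigma> g \<longleftrightarrow> (\<exists>a b. even a = \<sigma> \<and> chd {c a, c b} \<and> chd {c (a + 1), c (b + 1)} \<and>
    (g = {c a, c b} \<or> g = {c (a + 1), c (b + 1)}))"

definition one_sided :: "bool \<Rightarrow> 'v edge_monom \<Rightarrow> bool" where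
  "one_sided \<sigma> z \<longleftrightarrow> (\<forall>g\<in>keys z. (\<exists>k. even k = \<sigma> \<and> g = e k) \<or> swap_chord \<sigma> g)"

lemma swap_chord_chd: "swap_chord \<sigma> g \<Longrightarrow> chd g"
  by (auto simp: swap_chord_def)

lemma one_sided_edge:
  assumes "one_sided \<sigma> z" "e k \<in> keys z" shows "even k = \<sigma>"
proof -
  have "\<not> swap_chord \<sigma> (e k)" using swap_chord_chd[of \<sigma> "e k"] by (auto simp: chd_def)
  then obtain k' where "even k' = \<sigma>" "e k = e k'" using assms unfolding one_sided_def by blast
  then show ?thesis using e_parity by blast
qed

lemma one_sided_cases:
  "keys z \<subseteq> edges G \<Longrightarrow> vdeg z = vdeg (P True 0 n) \<Longrightarrow> one_sided True z \<or> one_sided False z"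
proof (induction "card {g \<in> keys z. chd g}" arbitrary: z rule: less_induct)
  case less
  interpret fiber_element G c n z using less.prems by unfold_locales
  show ?case
  proof (cases "\<exists>i j. chpos i j")
    case False
    then have alt: "used k \<longleftrightarrow> \<not> used (k - 1)" for k using position by blast
    have par: "used k \<longleftrightarrow> (even k = used 0)" for k
    proof (induction k rule: int_induct[of _ 0])
      case (step1 i)
      then show ?case using alt[of "i + 1"] by auto
    next
      case (step2 i)
      then show ?case using alt[of i] by auto
    qed simp
    have "one_sided (used 0) z" unfolding one_sided_def
    proof
      fix g assume g: "g \<in> keys z"
      then show "(\<exists>k. even k = used 0 \<and> g = e k) \<or> swap_chord (used 0) g"
      proof (cases rule: z_cases)
        case (edge m)
        then show ?thesis using par[of m] g by (auto simp: used_def)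
      next
        case (chord i j)
        then show ?thesis using False g by (auto simp: chpos_def)
      qed
    qed
    then show ?thesis by (cases "used 0") simp_all
  next
    case True
    then obtain a b where ab: "chpos a b" "chpos (a + 1) (b + 1)" using chord_pair by metis
    let ?f1 = "{c a, c b}" and ?f2 = "{c (a + 1), c (b + 1)}"
    have f: "chd ?f1" "chd ?f2" "?f1 \<in> keys z" "?f2 \<in> keys z"
      using ab by (auto simp: chpos_def)
    have "c (a + 1) \<noteq> c b"
    proof
      assume "c (a + 1) = c b"
      then have "n dvd a + 1 - b" using chord_once2[OF f(1)] by (simp add: once_def)
      then show False using chord_even[OF f(1)] dvd_even[of "a + 1 - b"] by simp
    qed
    then have ne: "?f1 \<noteq> ?f2" using c_ne[of a] by (auto simp: doubleton_eq_iff)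
    define r where "r = z - mon ?f1 - mon ?f2"
    have z1: "z = mon ?f1 + (z - mon ?f1)" using keys_diff_single[OF f(3)] .
    have "?f2 \<in> keys (z - mon ?f1)"
      using f(4) ne by (simp add: in_keys_iff lookup_minus lookup_single)
    then have "z - mon ?f1 = mon ?f2 + r" unfolding r_def by (rule keys_diff_single)
    then have z: "z = mon ?f1 + mon ?f2 + r" using z1 by (simp add: add.assoc)
    \<comment> \<open>Undoing the exchange is compatible with the degrees because both pairs of
      edges cover the four vertices of the \<open>F4\<close> once.\<close>
    let ?z = "mon (e a) + mon (e b) + r"
    have dz: "vdeg ?z = vdeg (P True 0 n)" unfolding z_deg[symmetric]
    proof (rule vdeg_eqI)
      fix x
      show "int (vdeg ?z x) = int (vdeg z x)"
        using vdeg_mon[OF chd_ne[OF f(1)], of x] vdeg_mon[OF chd_ne[OF f(2)], of x]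
          vdeg_mon[OF c_ne, of a x] vdeg_mon[OF c_ne, of b x]
        by (subst z) (simp add: vdeg_add e_def)
    qed
    have kz: "keys z = insert ?f1 (insert ?f2 (keys r))"
      by (subst z) (auto simp: keys_add_nat)
    have kz': "keys ?z = insert (e a) (insert (e b) (keys r))"
      by (auto simp: keys_add_nat)
    \<comment> \<open>The end \<open>c a\<close> has degree one, hence \<open>?f1\<close> occurs
      with exponent one and disappears; this makes the number of chord variables drop.\<close>
    have "vdeg z (c a) = 1" using deg_once chord_once[OF f(1)] by blast
    then have "vdeg r (c a) = 0" by (subst (asm) z) (simp add: vdeg_add split: if_splits)
    then have r: "?f1 \<notin> keys r" using vdeg_pos[of ?f1 r "c a"] by auto
    have "{g \<in> keys ?z. chd g} \<subset> {g \<in> keys z. chd g}"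
    proof (rule psubsetI)
      have ne: "\<not> chd (e a)" "\<not> chd (e b)" by (simp_all add: chd_def)
      then show "{g \<in> keys ?z. chd g} \<subseteq> {g \<in> keys z. chd g}"
        unfolding kz kz' by blast
      have "?f1 \<notin> keys ?z" unfolding kz' using r f(1) ne by auto
      then show "{g \<in> keys ?z. chd g} \<noteq> {g \<in> keys z. chd g}"
        using f by blast
    qed
    then have "card {g \<in> keys ?z. chd g} < card {g \<in> keys z. chd g}"
      by (intro psubset_card_mono) auto
    moreover have "keys ?z \<subseteq> edges G" using z_edges e_in unfolding kz kz' by auto
    ultimately have "one_sided True ?z \<or> one_sided False ?z" using less.hyps dz by blast
    then obtain \<tau> where \<tau>: "one_sided \<tau> ?z" by blast
    \<comment> \<open>The restored edge \<open>e a\<close> reveals the family of \<open>?z\<close>,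
      and the two chords belong to the same family by definition.\<close>
    then have "even a = \<tau>" by (rule one_sided_edge) (unfold kz', blast)
    then have "swap_chord \<tau> ?f1" "swap_chord \<tau> ?f2" using f unfolding swap_chord_def by blast+
    then have "one_sided \<tau> z" using \<tau> unfolding one_sided_def kz kz' by blast
    then show ?thesis by (cases \<tau>) simp_all
  qed
qed

text \<open>In a walk of length four the two chords form an \<open>F4\<close> with either pair of opposite edges.\<close>

lemma swap_chord_both: "swap_chord True g \<Longrightarrow> swap_chord False g \<Longrightarrow> n = 4"
proof -
  assume "swap_chord True g" "swap_chord False g"
  then obtain a b a' b' where a: "even a" "chd {c a, c b}" "chd {c (a + 1), c (b + 1)}"
      "g = {c a, c b} \<or> g = {c (a + 1), c (b + 1)}"
    and a': "odd a'" "chd {c a', c b'}" "chd {c (a' + 1), c (b' + 1)}"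
      "g = {c a', c b'} \<or> g = {c (a' + 1), c (b' + 1)}"
    unfolding swap_chord_def by auto
  have b: "even b" "odd b'" using chord_even[OF a(2)] chord_even[OF a'(2)] a(1) a'(1) by auto
  have neq: "{c x, c y} \<noteq> {c x', c y'}"
    if "chd {c x, c y}" "even x" "odd x'" "odd y'" for x y x' y'
  proof
    assume eq: "{c x, c y} = {c x', c y'}"
    have "once x" using chord_once[OF that(1)] .
    moreover have "c x' = c x \<or> c y' = c x" using eq by (auto simp: doubleton_eq_iff)
    ultimately have "n dvd x' - x \<or> n dvd y' - x" by (auto simp: once_def)
    then show False using dvd_even[of "x' - x"] dvd_even[of "y' - x"] that by auto
  qed
  consider "{c a, c b} = {c (a' + 1), c (b' + 1)}" | "{c (a + 1), c (b + 1)} = {c a', c b'}"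
    using a a' b neq[of a b a' b'] neq[of "a' + 1" "b' + 1" "a + 1" "b + 1"] by auto
  then show "n = 4"
  proof cases
    case 1
    have "{c (a' + 1 - 1), c (b' + 1 - 1)} = {c (a - 1), c (b - 1)}"
      using chord_shift[OF a'(3) 1[symmetric], of "- 1"] by simp
    then show ?thesis using F4_uncrossed[of a b] a a' by simp
  next
    case 2
    have "{c (a' + 1), c (b' + 1)} = {c (a + 1 + 1), c (b + 1 + 1)}"
      using chord_shift[OF a'(2) 2[symmetric], of 1] by simp
    then show ?thesis using F4_uncrossed[of "a + 1" "b + 1"] a a' by simp
  qed
qed

lemma fiber_step_one_sided:
  assumes n: "n \<noteq> 4" and z: "one_sided True z" "vdeg z = vdeg (P True 0 n)" and st: "(z, z') \<in> fiber_step G"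
  shows "one_sided True z' \<and> vdeg z' = vdeg (P True 0 n)"
proof -
  have d: "vdeg z' = vdeg (P True 0 n)" "keys z' \<subseteq> edges G"
    and "keys z \<inter> keys z' \<noteq> {}" using st z by (auto simp: fiber_step_def)
  then obtain g where g: "g \<in> keys z" "g \<in> keys z'" by blast
  have "\<not> one_sided False z'"
  proof
    assume z': "one_sided False z'"
    from z(1) g(1) consider k where "even k" "g = e k" | "swap_chord True g" by (auto simp: one_sided_def)
    then show False
    proof cases
      case 1
      then show False using one_sided_edge[OF z'] g by auto
    next
      case 2
      then have "\<not> (\<exists>k. g = e k)" using swap_chord_chd by (auto simp: chd_def)
      then have "swap_chord False g" using z' g(2) by (auto simp: one_sided_def)
      then show False using swap_chord_both[OF 2] n by blast
    qed
  qed
  then show ?thesis using one_sided_cases[of z'] d by blast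
qed

lemma one_sided_P: "one_sided \<sigma> (P \<sigma> i j)"
  unfolding one_sided_def keys_P by blast

lemma P_neq: "\<not> one_sided True (P False 0 n)"
  using one_sided_edge[of True "P False 0 n" 1] key_full[of 1 False] by auto

lemma not_conn: "\<not> conn"
proof
  assume conn
  then have st: "(P True 0 n, P False 0 n) \<in> (fiber_step G)\<^sup>*" by (simp add: conn_def fiber_conn_def)
  show False
  proof (cases "n = 4")
    case False
    have "one_sided True z \<and> vdeg z = vdeg (P True 0 n)" if "(P True 0 n, z) \<in> (fiber_step G)\<^sup>*" for z
      using that by (induction rule: rtrancl_induct) (auto simp: one_sided_P dest: fiber_step_one_sided[OF False])
    then show False using st P_neq by blast
  next
    case True
    have "{k::int. 0 \<le> k \<and> k < 4 \<and> even k} = {0, 2}" by auto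
    then have "tdeg (P True 0 n) = 2"
      by (simp add: P_def True tdeg_add)
    \<comment> \<open>Monomials of degree two with a common variable agree in the fibre: the
      remaining variable is an edge, determined by the degrees at its ends. So the component is a
      single monomial.\<close>
    have "z = P True 0 n" if "(P True 0 n, z) \<in> (fiber_step G)\<^sup>*" for z
      using that
    proof (induction rule: rtrancl_induct)
      case (step y z)
      obtain g y' z' where g: "y = mon g + y'" "z = mon g + z'" "g \<in> edges G" "keys y' \<subseteq> edges G"
        "keys z' \<subseteq> edges G" "vdeg y' = vdeg z'"
        by (rule fiber_stepE[OF G step.hyps(2)])
      have "tdeg y = 2" using step.IH \<open>tdeg (P True 0 n) = 2\<close> by simp
      then have t: "tdeg y' = 1" using g(1) by (simp add: tdeg_add)
      then have t': "tdeg z' = 1" using tdeg_eq[OF G g(4,5,6)] by simp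
      have single: "\<exists>h. x = mon h" if x: "tdeg x = 1" for x :: "'v edge_monom"
      proof -
        have "x \<noteq> 0" using x by auto
        then obtain h where "h \<in> keys x" by (metis keys_eq_empty ex_in_conv)
        then have *: "x = mon h + (x - mon h)" by (rule keys_diff_single)
        have "tdeg (mon h + (x - mon h)) = 1" by (simp only: *[symmetric] x)
        then have "x - mon h = 0" by (simp add: tdeg_add tdeg_eq_0_iff)
        then show ?thesis using * by (metis add.right_neutral)
      qed
      obtain h h' where h: "y' = mon h" "z' = mon h'" using single t t' by blast
      have "x \<in> h \<longleftrightarrow> x \<in> h'" for x using g(6) by (simp add: h fun_eq_iff split: if_splits) meson
      then have "h = h'" by blast
      then show ?case using g h step.IH by simp
    qed simp
    then have "P False 0 n = P True 0 n" using st by blast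
    then show False using P_neq one_sided_P[of True 0 n] by simp
  qed
qed

end

section \<open>Blocks\<close>

definition nonseparable :: "'v sgraph \<Rightarrow> 'v sgraph \<Rightarrow> bool" where
  "nonseparable W B \<longleftrightarrow> subgraph B W \<and> connected_graph B \<and> (\<nexists>v. cut_vertex B v)"

lemma block_iff:
  "block W B \<longleftrightarrow> nonseparable W B \<and> (\<forall>B'. nonseparable W B' \<and> subgraph B B' \<longrightarrow> B' = B)"
  by (auto simp: block_def nonseparable_def)

lemma linked_refl [simp]: "linked H x x"
  by (simp add: linked_def)

lemma linked_trans: "linked H x y \<Longrightarrow> linked H y z \<Longrightarrow> linked H x z"
  by (simp add: linked_def)

lemma linked_sym: "linked H x y \<Longrightarrow> linked H y x"
proof -
  have "sym {(a, b). {a, b} \<in> edges H}" by (auto simp: sym_def insert_commute)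
  then show "linked H x y \<Longrightarrow> linked H y x"
    unfolding linked_def by (meson sym_rtrancl symD)
qed

lemma linked_edge: "{x, y} \<in> edges H \<Longrightarrow> linked H x y"
  by (auto simp: linked_def)

lemma linked_mono:
  assumes "edges H \<subseteq> edges H'" "linked H x y" shows "linked H' x y"
proof -
  have "{(a, b). {a, b} \<in> edges H} \<subseteq> {(a, b). {a, b} \<in> edges H'}" using assms(1) by auto
  from rtrancl_mono[OF this] show ?thesis using assms(2) unfolding linked_def by (rule subsetD)
qed

lemma connected_graphI:
  assumes "a \<in> verts H" "\<And>x. x \<in> verts H \<Longrightarrow> linked H a x" shows "connected_graph H"
  unfolding connected_graph_def
proof (intro conjI ballI)
  show "verts H \<noteq> {}" using assms(1) by blast
  fix x y assume "x \<in> verts H" "y \<in> verts H"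
  then show "linked H x y" using linked_trans[OF linked_sym[OF assms(2)] assms(2)] by simp
qed

lemma nonseparable_linked_del:
  assumes B: "nonseparable W B" and xy: "x \<in> verts B" "y \<in> verts B" "x \<noteq> v" "y \<noteq> v"
  shows "linked (del_vertex B v) x y"
proof (cases "v \<in> verts B")
  case True
  then show ?thesis using B xy by (auto simp: nonseparable_def cut_vertex_def connected_graph_def)
next
  case False
  then have "\<forall>e\<in>edges B. v \<notin> e" using B by (auto simp: nonseparable_def subgraph_def)
  then have "edges B \<subseteq> edges (del_vertex B v)" by (auto simp: del_vertex_def)
  moreover have "linked B x y" using B xy by (simp add: nonseparable_def connected_graph_def)
  ultimately show ?thesis by (rule linked_mono)
qed

text \<open>After the deletion of any vertex, one of the two common vertices survives and links both
  parts.\<close>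

lemma nonseparable_union:
  assumes B: "nonseparable W B1" "nonseparable W B2"
    and ab: "a \<in> verts B1" "a \<in> verts B2" "b \<in> verts B1" "b \<in> verts B2" "a \<noteq> b"
  shows "nonseparable W (verts B1 \<union> verts B2, edges B1 \<union> edges B2)" (is "nonseparable W ?H")
  unfolding nonseparable_def
proof (intro conjI notI)
  show "subgraph ?H W" using B by (auto simp: nonseparable_def subgraph_def)
  have c: "connected_graph B1" "connected_graph B2" using B by (simp_all add: nonseparable_def)
  show "connected_graph ?H"
  proof (rule connected_graphI)
    show "a \<in> verts ?H" using ab by simp
    fix x assume "x \<in> verts ?H"
    then have "linked B1 a x \<or> linked B2 a x" using c ab by (auto simp: connected_graph_def)
    then show "linked ?H a x" using linked_mono[of B1 ?H] linked_mono[of B2 ?H] by auto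
  qed
  assume "\<exists>v. cut_vertex ?H v"
  then obtain v x y where xy: "x \<in> verts ?H - {v}" "y \<in> verts ?H - {v}" "\<not> linked (del_vertex ?H v) x y"
    by (auto simp: cut_vertex_def)
  obtain s where s: "s \<in> verts B1" "s \<in> verts B2" "s \<noteq> v" using ab by (cases "a = v") auto
  have link: "linked (del_vertex ?H v) s z" if z: "z \<in> verts ?H - {v}" for z
  proof -
    have sub: "edges (del_vertex B1 v) \<subseteq> edges (del_vertex ?H v)"
      "edges (del_vertex B2 v) \<subseteq> edges (del_vertex ?H v)" by (auto simp: del_vertex_def)
    consider "z \<in> verts B1" | "z \<in> verts B2" using z by auto
    then show ?thesis
    proof cases
      case 1
      then have "linked (del_vertex B1 v) s z" using z s by (intro nonseparable_linked_del[OF B(1)]) auto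
      then show ?thesis by (rule linked_mono[OF sub(1)])
    next
      case 2
      then have "linked (del_vertex B2 v) s z" using z s by (intro nonseparable_linked_del[OF B(2)]) auto
      then show ?thesis by (rule linked_mono[OF sub(2)])
    qed
  qed
  from linked_trans[OF linked_sym[OF link[OF xy(1)]] link[OF xy(2)]] show False using xy(3) by simp
qed

lemma subgraph_refl: "subgraph B W \<Longrightarrow> subgraph B B"
  by (auto simp: subgraph_def)

lemma subgraph_trans: "subgraph A B \<Longrightarrow> subgraph B C \<Longrightarrow> subgraph A C"
  unfolding subgraph_def by blast

text \<open>Among the nonseparable subgraphs above \<open>B\<close> one with the largest number of
  vertices and edges is maximal.\<close>

lemma block_exists:
  assumes fin: "finite (verts W)" "finite (edges W)" and B: "nonseparable W B"
  obtains B' where "block W B'" "subgraph B B'"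
proof -
  let ?Q = "\<lambda>B'. nonseparable W B' \<and> subgraph B B'"
  let ?m = "\<lambda>B'. card (verts B') + card (edges B')"
  have bound: "?m B' < Suc (card (verts W) + card (edges W))" if "?Q B'" for B'
    using that fin card_mono[of "verts W" "verts B'"] card_mono[of "edges W" "edges B'"]
    by (auto simp: nonseparable_def subgraph_def)
  have "subgraph B W" using B by (simp add: nonseparable_def)
  then have "?Q B" using B subgraph_refl by blast
  then obtain M where M: "?Q M" "\<And>B'. ?Q B' \<Longrightarrow> ?m B' \<le> ?m M"
    using ex_has_greatest_nat[of ?Q B ?m] bound by blast
  have "B' = M" if B': "nonseparable W B'" "subgraph M B'" for B'
  proof -
    have "?Q B'" using M(1) B' subgraph_trans by blast
    then have le: "?m B' \<le> ?m M" by (rule M(2))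
    have sub: "verts M \<subseteq> verts B'" "edges M \<subseteq> edges B'" using B'(2) by (auto simp: subgraph_def)
    have f: "finite (verts B')" "finite (edges B')"
      using B'(1) fin by (auto simp: nonseparable_def subgraph_def intro: finite_subset)
    have "card (verts M) \<le> card (verts B')" "card (edges M) \<le> card (edges B')"
      using sub f card_mono by blast+
    then have "card (verts M) = card (verts B')" "card (edges M) = card (edges B')" using le by simp_all
    then have "verts M = verts B'" "edges M = edges B'" using sub f card_subset_eq by blast+
    then show ?thesis by (simp add: prod_eq_iff)
  qed
  then have "block W M" using M(1) by (auto simp: block_iff)
  then show thesis using that M(1) by blast
qed

lemma nonseparable_edge:
  assumes "{a, b} \<in> edges W" "a \<in> verts W" "b \<in> verts W"
  shows "nonseparable W ({a, b}, {{a, b}})" (is "nonseparable W ?H")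
  unfolding nonseparable_def
proof (intro conjI notI)
  show "subgraph ?H W" using assms by (auto simp: subgraph_def)
  show "connected_graph ?H" by (rule connected_graphI[of a]) (auto intro: linked_edge)
  assume "\<exists>v. cut_vertex ?H v"
  then show False by (auto simp: cut_vertex_def)
qed

section \<open>Paths and cycles\<close>

lemma walk_edges_Cons: "walk_edges (x # y # xs) = {x, y} # walk_edges (y # xs)"
proof -
  have "[0..<length (x # y # xs) - 1] = 0 # map Suc [0..<length xs]"
    by (simp add: map_Suc_upt upt_conv_Cons del: upt_Suc)
  then show ?thesis by (simp add: walk_edges_def)
qed

lemma walk_edges_simple [simp]: "walk_edges [] = []" "walk_edges [x] = []"
  by (simp_all add: walk_edges_def)

lemma walk_edges_append: "walk_edges (xs @ x # ys) = walk_edges (xs @ [x]) @ walk_edges (x # ys)"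
proof (induction xs)
  case (Cons a xs)
  then show ?case by (cases xs) (simp_all add: walk_edges_Cons)
qed simp

lemma hd_upto: "i \<le> j \<Longrightarrow> hd [i..j] = i"
  by (simp add: upto_rec1)

lemma last_upto: "i \<le> j \<Longrightarrow> last [i..j] = j"
  by (simp add: upto_rec2)

lemma shorten_path:
  assumes "ys \<noteq> []"
  shows "\<exists>zs. zs \<noteq> [] \<and> distinct zs \<and> hd zs = hd ys \<and> last zs = last ys \<and> set zs \<subseteq> set ys \<and>
    set (walk_edges zs) \<subseteq> set (walk_edges ys)"
  using assms
proof (induction "length ys" arbitrary: ys rule: less_induct)
  case less
  show ?case
  proof (cases "distinct ys")
    case True
    then show ?thesis using less.prems by blast
  next
    case False
    then obtain as x bs cs where ys: "ys = as @ [x] @ bs @ [x] @ cs" using not_distinct_decomp by blast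
    let ?y = "as @ x # cs"
    have "length ?y < length ys" "?y \<noteq> []" by (simp_all add: ys)
    then obtain zs where zs: "zs \<noteq> []" "distinct zs" "hd zs = hd ?y" "last zs = last ?y" "set zs \<subseteq> set ?y"
      "set (walk_edges zs) \<subseteq> set (walk_edges ?y)" using less.hyps by metis
    have "set (walk_edges ?y) \<subseteq> set (walk_edges ys)"
      using walk_edges_append[of as x cs] walk_edges_append[of as x "bs @ x # cs"] walk_edges_append[of "x # bs" x cs]
      by (auto simp: ys)
    moreover have "hd ?y = hd ys" "last ?y = last ys" "set ?y \<subseteq> set ys" by (auto simp: ys hd_append)
    ultimately show ?thesis using zs by (intro exI[of _ zs]) auto
  qed
qed

definition cycle_list :: "'v list \<Rightarrow> bool" where
  "cycle_list xs \<longleftrightarrow> distinct xs \<and> 3 \<le> length xs"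

definition cycle_graph :: "'v list \<Rightarrow> 'v sgraph" where
  "cycle_graph xs = (set xs, (\<lambda>i. {xs ! i, xs ! (Suc i mod length xs)}) ` {..<length xs})"

lemma cycle_graph_walk:
  assumes "xs \<noteq> []" shows "walk_graph (xs @ [hd xs]) = cycle_graph xs"
proof -
  have "(xs @ [hd xs]) ! i = xs ! i \<and> (xs @ [hd xs]) ! Suc i = xs ! (Suc i mod length xs)" if "i < length xs" for i
    using that assms by (cases "Suc i = length xs") (auto simp: nth_append hd_conv_nth)
  then have "set (walk_edges (xs @ [hd xs])) = (\<lambda>i. {xs ! i, xs ! (Suc i mod length xs)}) ` {..<length xs}"
    unfolding walk_edges_def by (auto simp: image_iff)
  moreover have "set (xs @ [hd xs]) = set xs" using assms by auto
  ultimately show ?thesis by (simp add: walk_graph_def cycle_graph_def)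
qed

lemma is_cycleD:
  assumes "is_cycle H" obtains xs where "cycle_list xs" "H = cycle_graph xs"
proof -
  obtain w where w: "closed_walk H w" "4 \<le> length w" "distinct (tl w)" "H = walk_graph w"
    using assms by (auto simp: is_cycle_def)
  obtain x ys where xy: "w = x # ys" "ys \<noteq> []" using w(2) by (cases w) (force, fastforce)
  have "last ys = x" using w(1) xy by (simp add: closed_walk_def)
  then have ys: "ys = butlast ys @ [x]" using xy by (metis append_butlast_last_id)
  let ?xs = "x # butlast ys"
  have "distinct (butlast ys @ [x])" using w(3) xy ys by simp
  then have "cycle_list ?xs" using w(2) xy by (auto simp: cycle_list_def)
  moreover have "w = ?xs @ [hd ?xs]" using xy ys by simp
  then have "H = cycle_graph ?xs" using w(4) cycle_graph_walk[of ?xs] by simp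
  ultimately show thesis by (rule that)
qed

lemma is_cycle_cycle_graph: "cycle_list xs \<Longrightarrow> is_cycle (cycle_graph xs)"
proof -
  assume xs: "cycle_list xs"
  then have ne: "xs \<noteq> []" by (auto simp: cycle_list_def)
  let ?w = "xs @ [hd xs]"
  have H: "cycle_graph xs = walk_graph ?w" using cycle_graph_walk[OF ne] by simp
  have "distinct (tl ?w)" using xs ne by (cases xs) (auto simp: cycle_list_def)
  moreover have "closed_walk (cycle_graph xs) ?w"
    using xs ne unfolding H closed_walk_def walk_def by (auto simp: walk_graph_def cycle_list_def)
  moreover have "4 \<le> length ?w" using xs by (simp add: cycle_list_def)
  ultimately show ?thesis unfolding is_cycle_def using H by blast
qed

lemma cycle_graph_edge:
  assumes "xs \<noteq> []"
  shows "{xs ! (k mod length xs), xs ! (Suc k mod length xs)} \<in> edges (cycle_graph xs)"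
proof -
  have "k mod length xs < length xs" using assms by simp
  then show ?thesis unfolding cycle_graph_def by (force simp: mod_Suc_eq)
qed

lemma cycle_graph_two_edges:
  assumes xs: "cycle_list xs" and x: "x \<in> set xs"
  obtains y z where "y \<noteq> z" "{x, y} \<in> edges (cycle_graph xs)" "{x, z} \<in> edges (cycle_graph xs)"
proof -
  let ?m = "length xs"
  have m: "distinct xs" "3 \<le> ?m" "xs \<noteq> []" using xs by (auto simp: cycle_list_def)
  obtain k where k: "k < ?m" "x = xs ! k" using x unfolding in_set_conv_nth by blast
  have 1: "{x, xs ! (Suc k mod ?m)} \<in> edges (cycle_graph xs)"
    using cycle_graph_edge[OF m(3), of k] k by simp
  \<comment> \<open>The predecessor on the cycle, written so that the subtraction does not truncate
    at zero.\<close>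
  have "Suc (k + ?m - 1) mod ?m = k" using k m by simp
  then have 2: "{x, xs ! ((k + ?m - 1) mod ?m)} \<in> edges (cycle_graph xs)"
    using cycle_graph_edge[OF m(3), of "k + ?m - 1"] k by (simp add: insert_commute)
  have "Suc k mod ?m \<noteq> (k + ?m - 1) mod ?m"
  proof (cases "k = 0")
    case True then show ?thesis using m by simp
  next
    case False
    then have "(k + ?m - 1) mod ?m = k - 1" using k by (simp add: mod_if)
    then show ?thesis using k m False by (auto simp: mod_if)
  qed
  then have "xs ! (Suc k mod ?m) \<noteq> xs ! ((k + ?m - 1) mod ?m)"
    using m by (simp add: nth_eq_iff_index_eq)
  then show thesis using that 1 2 by blast
qed

text \<open>Deleting a vertex leaves a path, and all its vertices are reached from the successor of
  the deleted one.\<close>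

lemma nonseparable_cycle:
  assumes xs: "cycle_list xs" and sub: "subgraph (cycle_graph xs) W"
  shows "nonseparable W (cycle_graph xs)" (is "nonseparable W ?H")
  unfolding nonseparable_def
proof (intro conjI notI sub)
  let ?m = "length xs"
  have m: "distinct xs" "3 \<le> ?m" "xs \<noteq> []" using xs by (auto simp: cycle_list_def)
  have vH: "verts ?H = set xs" by (simp add: cycle_graph_def)
  have idx: "\<exists>t<?m. x = xs ! ((k + t) mod ?m)" if xk: "x \<in> set xs" "k < ?m" for x k
  proof -
    obtain j where j: "j < ?m" "x = xs ! j" using xk(1) unfolding in_set_conv_nth by blast
    show ?thesis
    proof (cases "k \<le> j")
      case True then show ?thesis using j by (intro exI[of _ "j - k"]) auto
    next
      case False then show ?thesis using j xk by (intro exI[of _ "j + ?m - k"]) auto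
    qed
  qed
  have "linked ?H (xs ! 0) (xs ! (t mod ?m))" for t
  proof (induction t)
    case (Suc t)
    then show ?case using linked_trans[OF Suc linked_edge[OF cycle_graph_edge[OF m(3), of t]]] by simp
  qed simp
  then show "connected_graph ?H"
    using idx[of _ 0] m by (intro connected_graphI[of "xs ! 0"]) (auto simp: vH)
  assume "\<exists>v. cut_vertex ?H v"
  then obtain v x y where v: "v \<in> set xs" and xy: "x \<in> set xs - {v}" "y \<in> set xs - {v}"
    "\<not> linked (del_vertex ?H v) x y" by (auto simp: cut_vertex_def vH)
  obtain k where k: "k < ?m" "v = xs ! k" using v unfolding in_set_conv_nth by blast
  let ?a = "xs ! (Suc k mod ?m)"
  have neq: "xs ! ((k + t) mod ?m) \<noteq> v" if "0 < t" "t < ?m" for t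
  proof -
    have "(k + t) mod ?m \<noteq> k"
    proof (cases "k + t < ?m")
      case False
      then have "(k + t) mod ?m = k + t - ?m" using k that by (simp add: mod_if)
      then show ?thesis using that False by simp
    qed (use that in simp)
    then show ?thesis using k m by (simp add: nth_eq_iff_index_eq)
  qed
  have "Suc t < ?m \<Longrightarrow> linked (del_vertex ?H v) ?a (xs ! ((k + Suc t) mod ?m))" for t
  proof (induction t)
    case (Suc t)
    have "{xs ! ((k + Suc t) mod ?m), xs ! ((k + Suc (Suc t)) mod ?m)} \<in> edges ?H"
      using cycle_graph_edge[OF m(3), of "k + Suc t"] by simp
    then have "{xs ! ((k + Suc t) mod ?m), xs ! ((k + Suc (Suc t)) mod ?m)} \<in> edges (del_vertex ?H v)"
      using neq[of "Suc t"] neq[of "Suc (Suc t)"] Suc.prems by (auto simp: del_vertex_def)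
    moreover have "linked (del_vertex ?H v) ?a (xs ! ((k + Suc t) mod ?m))" using Suc by simp
    ultimately show ?case using linked_trans linked_edge by fast
  qed simp
  moreover have "\<exists>t. Suc t < ?m \<and> z = xs ! ((k + Suc t) mod ?m)" if z: "z \<in> set xs - {v}" for z
  proof -
    obtain t where t: "t < ?m" "z = xs ! ((k + t) mod ?m)" using idx[of z k] z k by auto
    have "t \<noteq> 0"
    proof
      assume "t = 0"
      then show False using t z k by simp
    qed
    then show ?thesis using t by (cases t) auto
  qed
  ultimately have link: "linked (del_vertex ?H v) ?a z" if "z \<in> set xs - {v}" for z using that by blast
  from linked_trans[OF linked_sym[OF link[OF xy(1)]] link[OF xy(2)]] show False using xy(3) by simp
qed

text \<open>Both ends are counted in both lists, so the bound 5 ensures three different vertices; it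
  excludes two parallel single edges.\<close>

lemma cycle_of_paths:
  assumes p: "distinct p" "hd p = a" "last p = b" "p \<noteq> []"
    and q: "distinct q" "hd q = b" "last q = a" "q \<noteq> []"
    and pq: "set p \<inter> set q \<subseteq> {a, b}" "a \<noteq> b" and len: "5 \<le> length p + length q"
  obtains xs where "cycle_list xs" "set xs = set p \<union> set q"
    "edges (cycle_graph xs) = set (walk_edges p) \<union> set (walk_edges q)"
proof -
  obtain q' where q': "q = b # q' @ [a]"
  proof -
    obtain r where "q = b # r" using q by (cases q) auto
    moreover from this have "r \<noteq> []" using q pq(2) by auto
    ultimately show thesis using that[of "butlast r"] q by (metis append_butlast_last_id last_ConsR)
  qed
  obtain p' where p': "p = p' @ [b]" using p by (metis append_butlast_last_id)
  let ?xs = "p @ q'"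
  have a: "a \<in> set p" using p by (metis hd_in_set)
  have "set p \<inter> set q' = {}" using pq q(1) by (auto simp: q')
  then have d: "distinct ?xs" using p q by (auto simp: q')
  have "cycle_list ?xs" using d len by (simp add: cycle_list_def q')
  moreover have "set ?xs = set p \<union> set q" using a by (auto simp: q' p')
  moreover have "edges (cycle_graph ?xs) = set (walk_edges p) \<union> set (walk_edges q)"
  proof -
    have "hd ?xs = a" using p by simp
    then have "cycle_graph ?xs = walk_graph (p' @ b # q' @ [a])"
      using cycle_graph_walk[of ?xs] by (simp add: p')
    then show ?thesis using walk_edges_append[of p' b "q' @ [a]"] by (simp add: walk_graph_def p' q')
  qed
  ultimately show thesis by (rule that)
qed

section \<open>Blocks of the graph of a primitive walk\<close>

lemma (in periodic_walk) walk_edges_map: "walk_edges (map c [i..j]) = map e [i..j - 1]"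
proof (rule nth_equalityI)
  show "length (walk_edges (map c [i..j])) = length (map e [i..j - 1])" by (simp add: walk_edges_def)
  fix k assume "k < length (walk_edges (map c [i..j]))"
  then have k: "k < nat (j - i + 1) - 1" by (simp add: walk_edges_def)
  then have "int k < j - i" by linarith
  then show "walk_edges (map c [i..j]) ! k = map e [i..j - 1] ! k"
    using k by (simp add: walk_edges_def e_def ac_simps)
qed

context noncrossing_walk
begin

definition W :: "'v sgraph" where "W = (range c, range e)"

lemma W_simps [simp]: "verts W = range c" "edges W = range e" by (simp_all add: W_def)

lemma finite_W: "finite (verts W)" "finite (edges W)"
proof -
  have "\<exists>m'\<in>{0..<n}. c m = c m' \<and> e m = e m'" for m
  proof -
    obtain m' where "0 \<le> m'" "m' < 0 + n" "n dvd m' - m" by (rule residue)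
    then show ?thesis using c_cong[of m' m] e_cong[of m' m] by (intro bexI[of _ m']) auto
  qed
  then have "range c \<subseteq> c ` {0..<n}" "range e \<subseteq> e ` {0..<n}" by blast+
  then show "finite (verts W)" "finite (edges W)"
    using finite_subset[of "range c" "c ` {0..<n}"] finite_subset[of "range e" "e ` {0..<n}"] by simp_all
qed

text \<open>A path that avoids \<open>c p\<close> never leaves the side on which it starts.\<close>

lemma nonseparable_one_side:
  assumes B: "nonseparable W B" and pq: "pair p q"
    and x: "x \<in> verts B" "x \<in> side p q" and y: "y \<in> verts B" "y \<in> side q (p + n)"
  shows False
proof -
  have cq: "c p = c q" using pq by (simp add: pair_def)
  have "x \<noteq> c p" "y \<noteq> c p"
    using x y side_disjoint(2)[OF pq] side_disjoint(2)[OF pair_flip[OF pq]] cq by auto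
  then have "linked (del_vertex B (c p)) x y" using nonseparable_linked_del[OF B] x y by blast
  then have "y \<in> side p q" unfolding linked_def
  proof (induction rule: rtrancl_induct)
    case (step s t)
    then have st: "{s, t} \<in> edges B" "t \<noteq> c p" by (auto simp: del_vertex_def)
    then obtain m where m: "{s, t} = e m" using B by (auto simp: nonseparable_def subgraph_def)
    have "e m \<inter> side p q \<noteq> {}" using step.IH m[symmetric] by auto
    then have "e m \<subseteq> side p q \<union> {c p}" by (rule side_edge[OF pq])
    then show ?case using st(2) m[symmetric] by auto
  qed (rule x)
  then show False using side_disjoint(1)[OF pq] y by blast
qed

lemma block_edges_pair:
  assumes B: "nonseparable W B" and pq: "pair p q"
  shows "(\<forall>m. e m \<in> edges B \<longrightarrow> c p \<in> e m \<longrightarrow> (n dvd m - p \<or> n dvd m - (q - 1)) \<and> e m \<inter> side p q \<noteq> {}) \<or>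
    (\<forall>m. e m \<in> edges B \<longrightarrow> c p \<in> e m \<longrightarrow> (n dvd m - (p - 1) \<or> n dvd m - q) \<and> e m \<inter> side q (p + n) \<noteq> {})"
proof -
  have sub: "e m \<subseteq> verts B" if "e m \<in> edges B" for m
    using B that by (auto simp: nonseparable_def subgraph_def)
  show ?thesis
  proof (rule ccontr)
    assume "\<not> ?thesis"
    then obtain m m' where m: "e m \<in> edges B" "c p \<in> e m" "\<not> ((n dvd m - p \<or> n dvd m - (q - 1)) \<and> e m \<inter> side p q \<noteq> {})"
      and m': "e m' \<in> edges B" "c p \<in> e m'" "\<not> ((n dvd m' - (p - 1) \<or> n dvd m' - q) \<and> e m' \<inter> side q (p + n) \<noteq> {})"
      by auto
    obtain y where "y \<in> e m" "y \<in> side q (p + n)" using pair_edges[OF pq m(2)] m(3) by blast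
    moreover obtain x where "x \<in> e m'" "x \<in> side p q" using pair_edges[OF pq m'(2)] m'(3) by blast
    ultimately show False using nonseparable_one_side[OF B pq, of x y] sub[OF m(1)] sub[OF m'(1)] by blast
  qed
qed

text \<open>At a vertex visited once there are only two walk edges, and at a repeated vertex the
  edges of \<open>B\<close> stay on one side. So nonseparable subgraphs have maximum degree at most
  two, which makes the cycles among them maximal.\<close>

lemma block_edges_le_2:
  assumes B: "nonseparable W B"
  shows "\<exists>g h. \<forall>f\<in>edges B. c p \<in> f \<longrightarrow> f = g \<or> f = h"
proof -
  have E: "\<exists>m. f = e m" if "f \<in> edges B" for f
    using B that by (auto simp: nonseparable_def subgraph_def)
  show ?thesis
  proof (cases "once p")
    case True
    have "f = e p \<or> f = e (p - 1)" if f: "f \<in> edges B" "c p \<in> f" for f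
      using E[OF f(1)] f(2) once_edges[OF True] e_cong by metis
    then show ?thesis by blast
  next
    case False
    then obtain q where pq: "pair p q" by (rule not_onceE)
    from block_edges_pair[OF B pq] show ?thesis
    proof
      assume *: "\<forall>m. e m \<in> edges B \<longrightarrow> c p \<in> e m \<longrightarrow> (n dvd m - p \<or> n dvd m - (q - 1)) \<and> e m \<inter> side p q \<noteq> {}"
      have "f = e p \<or> f = e (q - 1)" if f: "f \<in> edges B" "c p \<in> f" for f
        using E[OF f(1)] f * e_cong by metis
      then show ?thesis by blast
    next
      assume *: "\<forall>m. e m \<in> edges B \<longrightarrow> c p \<in> e m \<longrightarrow> (n dvd m - (p - 1) \<or> n dvd m - q) \<and> e m \<inter> side q (p + n) \<noteq> {}"
      have "f = e (p - 1) \<or> f = e q" if f: "f \<in> edges B" "c p \<in> f" for f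
        using E[OF f(1)] f * e_cong by metis
      then show ?thesis by blast
    qed
  qed
qed

text \<open>The two edges from a repeated vertex into one side sit at \<open>p\<close> and
  \<open>q - 1\<close>, and \<open>q - p\<close> is odd. This is why repeated vertices are
  sinks.\<close>

lemma block_edges_parity:
  assumes B: "nonseparable W B" and p: "\<not> once p"
    and ij: "e i \<in> edges B" "e j \<in> edges B" "c p \<in> e i" "c p \<in> e j"
  shows "even i = even j"
proof -
  obtain q where pq: "pair p q" using p by (rule not_onceE)
  have "odd (q - p)" using pair_dest[OF pq] by simp
  have "(n dvd i - p \<or> n dvd i - (q - 1)) \<and> (n dvd j - p \<or> n dvd j - (q - 1)) \<or>
      (n dvd i - (p - 1) \<or> n dvd i - q) \<and> (n dvd j - (p - 1) \<or> n dvd j - q)"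
    using block_edges_pair[OF B pq] ij by blast
  then have "(even (i - p) \<or> even (i - (q - 1))) \<and> (even (j - p) \<or> even (j - (q - 1))) \<or>
      (even (i - (p - 1)) \<or> even (i - q)) \<and> (even (j - (p - 1)) \<or> even (j - q))"
    using dvd_even by blast
  then show ?thesis using \<open>odd (q - p)\<close> by presburger
qed

text \<open>By the degree bound the cycle already contains all edges of \<open>B\<close> at its
  vertices, and \<open>B\<close> is connected.\<close>

lemma cycle_maximal:
  assumes xs: "cycle_list xs" and B: "nonseparable W B" and sub: "subgraph (cycle_graph xs) B"
  shows "B = cycle_graph xs"
proof -
  let ?H = "cycle_graph xs"
  have vH: "verts ?H = set xs" by (simp add: cycle_graph_def)
  have eB: "f \<subseteq> verts B" "verts B \<subseteq> range c" if "f \<in> edges B" for f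
    using B that by (auto simp: nonseparable_def subgraph_def)
  have sub': "set xs \<subseteq> verts B" "edges ?H \<subseteq> edges B" "\<And>f. f \<in> edges ?H \<Longrightarrow> f \<subseteq> set xs"
    using sub vH by (auto simp: subgraph_def)
  have at: "f \<in> edges ?H" if f: "f \<in> edges B" "x \<in> f" "x \<in> set xs" for f x
  proof -
    obtain y z where yz: "y \<noteq> z" "{x, y} \<in> edges ?H" "{x, z} \<in> edges ?H"
      using cycle_graph_two_edges[OF xs f(3)] by blast
    have "x \<in> range c" using eB(1)[OF f(1)] eB(2)[OF f(1)] f(2) by (meson subsetD)
    then obtain p where p: "x = c p" by (rule rangeE)
    obtain g h where gh: "\<forall>f\<in>edges B. c p \<in> f \<longrightarrow> f = g \<or> f = h"
      using block_edges_le_2[OF B, of p] by (elim exE)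
    have "{x, y} \<noteq> {x, z}" using yz(1) by (auto simp: doubleton_eq_iff)
    moreover have gh': "f' = g \<or> f' = h" if "f' \<in> edges B" "x \<in> f'" for f' using gh that p by simp
    have "{x, y} \<in> edges B" "{x, z} \<in> edges B" using yz(2,3) sub'(2) by (simp_all add: subset_iff)
    then have "{x, y} = g \<or> {x, y} = h" "{x, z} = g \<or> {x, z} = h" "f = g \<or> f = h"
      using gh'[of "{x, y}"] gh'[of "{x, z}"] gh'[of f] f by simp_all
    ultimately have "f = {x, y} \<or> f = {x, z}" by metis
    then show ?thesis using yz by metis
  qed
  have "xs \<noteq> []" using xs by (auto simp: cycle_list_def)
  then obtain a where a: "a \<in> set xs" by (metis ex_in_conv set_empty)
  have "verts B \<subseteq> set xs"
  proof
    fix x assume "x \<in> verts B"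
    then have "linked B a x" using B a sub' by (auto simp: nonseparable_def connected_graph_def)
    then show "x \<in> set xs" unfolding linked_def
    proof (induction rule: rtrancl_induct)
      case (step s t)
      then have "{s, t} \<in> edges ?H" using at[of "{s, t}" s] by simp
      then show ?case using sub'(3) by blast
    qed (rule a)
  qed
  then have v: "verts B = verts ?H" using sub' vH by blast
  have "edges B \<subseteq> edges ?H"
  proof
    fix f assume f: "f \<in> edges B"
    then obtain m where "f = e m" using B by (auto simp: nonseparable_def subgraph_def)
    then have "c m \<in> f" by (simp add: e_def)
    then show "f \<in> edges ?H" using at[OF f] eB(1)[OF f] v vH by blast
  qed
  then show ?thesis using v sub' by (simp add: prod_eq_iff)
qed

lemma cycle_block:
  assumes xs: "cycle_list xs" and sub: "subgraph (cycle_graph xs) W"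
  shows "block W (cycle_graph xs)"
  using nonseparable_cycle[OF assms] cycle_maximal[OF xs] by (auto simp: block_iff)

lemma edge_block:
  obtains B where "block W B" "c k \<in> verts B" "c (k + 1) \<in> verts B"
proof -
  have "nonseparable W ({c k, c (k + 1)}, {{c k, c (k + 1)}})"
    by (rule nonseparable_edge) (auto simp: e_def)
  then obtain B where "block W B" "subgraph ({c k, c (k + 1)}, {{c k, c (k + 1)}}) B"
    using block_exists[OF finite_W] by blast
  then show thesis using that by (auto simp: subgraph_def)
qed

definition diff_blocks :: "'v set \<Rightarrow> bool" where
  "diff_blocks f \<longleftrightarrow> (\<exists>x y B1 B2. f = {x, y} \<and> block W B1 \<and> block W B2 \<and> B1 \<noteq> B2 \<and> x \<in> verts B1 \<and> y \<in> verts B2)"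

text \<open>A repeated vertex lies in one block on each of its sides; at least one of these differs
  from a given block of the other end.\<close>

lemma diff_blocks_not_once:
  assumes "\<not> once i" shows "diff_blocks {c i, c j}"
proof -
  obtain q where pq: "pair i q" using assms by (rule not_onceE)
  note d = pair_dest[OF pq]
  have cq: "c i = c q" using pq by (simp add: pair_def)
  obtain B1 where B1: "block W B1" "c i \<in> verts B1" "c (i + 1) \<in> verts B1" by (rule edge_block)
  obtain B2 where B2: "block W B2" "c q \<in> verts B2" "c (q + 1) \<in> verts B2" by (rule edge_block)
  obtain B where B: "block W B" "c j \<in> verts B" by (rule edge_block)
  have "c (i + 1) \<in> side i q" "c (q + 1) \<in> side q (i + n)" using d by (auto intro!: sideI)
  then have "\<not> (c (i + 1) \<in> verts B1 \<and> c (q + 1) \<in> verts B1)"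
    using nonseparable_one_side[OF _ pq] B1(1) unfolding block_iff by blast
  then have "B1 \<noteq> B2" using B1 B2 by blast
  then have "B \<noteq> B1 \<or> B \<noteq> B2" by blast
  then show ?thesis unfolding diff_blocks_def using B1 B2 B cq by metis
qed

lemma diff_blocks_separated:
  assumes pq: "pair p q" and i: "p < i" "i < q" and j: "q < j" "j < p + n"
  shows "diff_blocks {c i, c j}"
proof -
  obtain B1 where B1: "block W B1" "c i \<in> verts B1" by (rule edge_block)
  obtain B2 where B2: "block W B2" "c j \<in> verts B2" by (rule edge_block)
  have "\<not> (c i \<in> verts B1 \<and> c j \<in> verts B1)"
    using nonseparable_one_side[OF _ pq] B1(1) sideI[OF i] sideI[OF j] unfolding block_iff by blast
  then have "B1 \<noteq> B2" using B1 B2 by blast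
  then show ?thesis unfolding diff_blocks_def using B1 B2 by blast
qed

lemma segment_path:
  assumes "i \<le> j"
  obtains zs where "zs \<noteq> []" "distinct zs" "hd zs = c i" "last zs = c j" "set zs \<subseteq> c ` {i..j}"
    "set (walk_edges zs) \<subseteq> e ` {i..j - 1}"
proof -
  have "map c [i..j] \<noteq> []" "hd (map c [i..j]) = c i" "last (map c [i..j]) = c j"
    using assms by (simp_all add: hd_map last_map hd_upto last_upto)
  then show thesis using shorten_path[of "map c [i..j]"] that unfolding walk_edges_map by auto
qed

lemma path_length:
  assumes "zs \<noteq> []" "hd zs = x" "last zs = y" "x \<noteq> y" "{x, y} \<notin> set (walk_edges zs)"
  shows "3 \<le> length zs"
proof (rule ccontr)
  assume "\<not> 3 \<le> length zs"
  then obtain a b where "zs = [a] \<or> zs = [a, b]" using assms(1)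
    by (cases zs; cases "tl zs"; cases "tl (tl zs)") auto
  then show False using assms by (auto simp: walk_edges_Cons)
qed

lemma subgraph_cycle:
  assumes "set xs \<subseteq> range c" "edges (cycle_graph xs) \<subseteq> range e" "xs \<noteq> []"
  shows "subgraph (cycle_graph xs) W"
proof -
  have "f \<subseteq> set xs" if "f \<in> edges (cycle_graph xs)" for f
    using that assms(3) by (auto simp: cycle_graph_def)
  then show ?thesis using assms by (auto simp: subgraph_def) (auto simp: cycle_graph_def)
qed

text \<open>Shortened to paths, the two arcs between \<open>i\<close> and \<open>j\<close> meet only
  at their ends since no repeated vertex separates them. They form a cycle, which is a block
  containing both ends.\<close>

lemma same_block:
  assumes ij: "i < j" "j < i + n" and f: "{c i, c j} \<notin> range e" "c i \<noteq> c j"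
    and once: "once i" "once j"
    and sep: "\<And>a b. i < a \<Longrightarrow> a < j \<Longrightarrow> j < b \<Longrightarrow> b < i + n \<Longrightarrow> c a \<noteq> c b"
  shows "\<not> diff_blocks {c i, c j}"
proof -
  obtain p where p: "p \<noteq> []" "distinct p" "hd p = c i" "last p = c j" "set p \<subseteq> c ` {i..j}"
    "set (walk_edges p) \<subseteq> e ` {i..j - 1}" using ij by (elim segment_path[of i j, rotated]) simp
  obtain q where q: "q \<noteq> []" "distinct q" "hd q = c j" "last q = c (i + n)" "set q \<subseteq> c ` {j..i + n}"
    "set (walk_edges q) \<subseteq> e ` {j..i + n - 1}" using ij by (elim segment_path[of j "i + n", rotated]) simp
  have cin: "c (i + n) = c i" by (rule per)
  have "set p \<inter> set q \<subseteq> {c i, c j}"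
  proof
    fix x assume "x \<in> set p \<inter> set q"
    then obtain a b where ab: "x = c a" "x = c b" "i \<le> a" "a \<le> j" "j \<le> b" "b \<le> i + n" using p q by force
    show "x \<in> {c i, c j}"
    proof (rule ccontr)
      assume "x \<notin> {c i, c j}"
      then have "a \<noteq> i" "a \<noteq> j" "b \<noteq> j" "b \<noteq> i + n" using ab cin by auto
      then show False using sep[of a b] ab by simp
    qed
  qed
  moreover have "3 \<le> length p" using path_length[OF p(1,3,4) f(2)] f(1) p(6) by blast
  moreover have "3 \<le> length q" 
  proof (rule path_length[OF q(1,3,4)])
    show "c j \<noteq> c (i + n)" using f cin by simp
    have "{c j, c (i + n)} \<notin> range e" using f cin by (simp add: insert_commute)
    then show "{c j, c (i + n)} \<notin> set (walk_edges q)" using q(6) by blast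
  qed
  ultimately obtain xs where xs: "cycle_list xs" "set xs = set p \<union> set q"
    "edges (cycle_graph xs) = set (walk_edges p) \<union> set (walk_edges q)"
    using cycle_of_paths[of p "c i" "c j" q] p q f cin by auto
  let ?H = "cycle_graph xs"
  have vH: "verts ?H = set xs" by (simp add: cycle_graph_def)
  have "xs \<noteq> []" using xs by (auto simp: cycle_list_def)
  moreover have eH: "edges ?H \<subseteq> range e" unfolding xs(3) using p(6) q(6) by blast
  moreover have "set xs \<subseteq> range c" unfolding xs(2) using p(5) q(5) by blast
  ultimately have sub: "subgraph ?H W" by (intro subgraph_cycle)
  have H: "block W ?H" using cycle_block[OF xs(1) sub] .
  have inH: "c i \<in> set xs" "c j \<in> set xs" using p xs(2) hd_in_set last_in_set by (metis UnCI)+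
  have nH: "nonseparable W ?H" and maxH: "\<And>B'. nonseparable W B' \<Longrightarrow> subgraph ?H B' \<Longrightarrow> B' = ?H"
    using H unfolding block_iff by blast+
  have eHv: "f \<subseteq> set xs" if "f \<in> edges ?H" for f using sub that vH by (simp add: subgraph_def)
  \<comment> \<open>Both walk edges at a vertex visited once are edges of the cycle. Another block
    through this vertex would share an edge with the cycle, and the union of the two would be
    nonseparable.\<close>
  have uniq: "B = ?H" if B: "block W B" "c k \<in> verts B" and k: "once k" "c k \<in> set xs" for B k
  proof -
    have nB: "nonseparable W B" and maxB: "\<And>B'. nonseparable W B' \<Longrightarrow> subgraph B B' \<Longrightarrow> B' = B"
      using B(1) unfolding block_iff by blast+
    have sB: "edges B \<subseteq> range e" "\<And>f. f \<in> edges B \<Longrightarrow> f \<subseteq> verts B"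
      using nB by (simp_all add: nonseparable_def subgraph_def)
    have "\<exists>b. b \<noteq> c k \<and> b \<in> verts B \<and> b \<in> set xs"
    proof (cases "verts B = {c k}")
      \<comment> \<open>A single vertex also counts as connected without cut vertex; next to the
        cycle it cannot be maximal.\<close>
      case True
      have "f \<notin> edges B" for f
      proof
        assume f: "f \<in> edges B"
        then obtain m where m: "f = e m" using sB(1) by blast
        have "e m \<subseteq> {c k}" using sB(2)[OF f] True m by simp
        then show False using c_ne[of m] by (simp add: e_def)
      qed
      then have "edges B = {}" by blast
      then have "subgraph B ?H" using True vH k(2) by (simp add: subgraph_def)
      then have "?H = B" using maxB[OF nH] by simp
      then have "set xs = {c k}" using True vH by simp
      then show ?thesis using inH f(2) by simp
    next
      case False
      then obtain b where b: "b \<in> verts B" "b \<noteq> c k" using B(2) by blast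
      then have "linked B (c k) b" using nB B(2) by (simp add: nonseparable_def connected_graph_def)
      then have "(c k, b) \<in> {(a, b). {a, b} \<in> edges B}\<^sup>*" by (simp add: linked_def)
      then obtain s where s: "{c k, s} \<in> edges B"
        using b(2) by (cases rule: converse_rtranclE) auto
      have s': "s \<in> verts B" "{c k, s} \<in> range e" using sB(2)[OF s] subsetD[OF sB(1) s] by simp_all
      have sk: "s \<noteq> c k"
      proof
        assume "s = c k"
        moreover obtain m where "{c k, s} = e m" using s'(2) by (rule rangeE)
        ultimately show False using c_ne[of m] by (simp add: e_def doubleton_eq_iff)
      qed
      obtain y z where yz: "y \<noteq> z" "{c k, y} \<in> edges ?H" "{c k, z} \<in> edges ?H"
        using cycle_graph_two_edges[OF xs(1) k(2)] .
      have cand: "f = e k \<or> f = e (k - 1)" if f: "f \<in> range e" "c k \<in> f" for f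
      proof -
        obtain m where m: "f = e m" using f(1) by (rule rangeE)
        then have "n dvd m - k \<or> n dvd m - (k - 1)" using once_edges[OF k(1), of m] f(2) by simp
        then show ?thesis using m e_cong by (elim disjE) simp_all
      qed
      have "{c k, y} \<noteq> {c k, z}" using yz(1) by (auto simp: doubleton_eq_iff)
      moreover have "{c k, y} \<in> range e" "{c k, z} \<in> range e"
        using subsetD[OF eH yz(2)] subsetD[OF eH yz(3)] .
      ultimately have "{c k, s} = {c k, y} \<or> {c k, s} = {c k, z}"
        using cand[of "{c k, y}"] cand[of "{c k, z}"] cand[of "{c k, s}"] s'(2) by (metis insertI1)
      then have "{c k, s} \<in> edges ?H" using yz by metis
      then have "s \<in> set xs" using eHv by blast
      then show ?thesis using s' sk by blast
    qed
    then obtain b where b: "b \<noteq> c k" "b \<in> verts B" "b \<in> set xs" by blast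
    let ?U = "(verts B \<union> verts ?H, edges B \<union> edges ?H)"
    have U: "nonseparable W ?U"
      by (rule nonseparable_union[OF nB nH B(2) _ b(2) _ b(1)[symmetric]]) (use b k vH in simp_all)
    have "subgraph B ?U" using sB(2) by (auto simp: subgraph_def)
    moreover have "subgraph ?H ?U" using eHv vH by (auto simp: subgraph_def)
    ultimately have "?U = B" "?U = ?H" using maxB[OF U] maxH[OF U] by simp_all
    then show ?thesis by simp
  qed
  show ?thesis
  proof
    assume "diff_blocks {c i, c j}"
    then obtain x y B1 B2 where xy: "{c i, c j} = {x, y}" "block W B1" "block W B2" "B1 \<noteq> B2" "x \<in> verts B1" "y \<in> verts B2"
      unfolding diff_blocks_def by blast
    then have "x = c i \<and> y = c j \<or> x = c j \<and> y = c i" by (auto simp: doubleton_eq_iff)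
    then show False using xy uniq[of B1 i] uniq[of B2 j] uniq[of B1 j] uniq[of B2 i] once inH by auto
  qed
qed

text \<open>An edge traversed back and forth is the only edge at \<open>c k\<close> on its side,
  whereas a cycle has two different edges at each vertex.\<close>

lemma cyclic_edge_once:
  assumes B: "block W B" "is_cycle B" and k: "e k \<in> edges B" and m: "e m = e k"
  shows "n dvd m - k"
proof (rule ccontr)
  assume nd: "\<not> n dvd m - k"
  obtain l where l: "k \<le> l" "l < k + n" "n dvd l - m" by (rule residue)
  have el: "e l = e k" using e_cong[OF l(3)] m by simp
  have ndl: "\<not> n dvd l - k" using nd dvd_diff[OF _ l(3), of "l - k"] by auto
  have cl: "c l = c (k + 1)" "c (l + 1) = c k" using twice_edge[OF el ndl] by auto
  have "l \<noteq> k" using ndl by auto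
  have "l + 1 \<noteq> k + n"
  proof
    assume "l + 1 = k + n"
    then have "n dvd l - (k - 1)" by (metis add_diff_cancel_left' diff_diff_eq2 dvd_refl)
    then have "c (k - 1) = c (k + 1)" using cl c_cong[of l "k - 1"] by simp
    moreover have "k - 1 + 2 = k + 1" by simp
    ultimately show False using c_ne2[of "k - 1"] by metis
  qed
  then have pq: "pair k (l + 1)" using l \<open>l \<noteq> k\<close> cl by (auto simp: pair_def)
  have nB: "nonseparable W B" using B by (simp add: block_iff)
  obtain xs where xs: "cycle_list xs" "B = cycle_graph xs" using is_cycleD[OF B(2)] .
  have ck: "c k \<in> verts B" using nB k by (auto simp: nonseparable_def subgraph_def e_def)
  obtain y z where yz: "y \<noteq> z" "{c k, y} \<in> edges B" "{c k, z} \<in> edges B"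
    using cycle_graph_two_edges[OF xs(1)] ck xs(2) by (metis cycle_graph_def fst_conv)
  have ek: "e k \<inter> side k (l + 1) \<noteq> {}"
    using pair_dest[OF pq] sideI[of k "k + 1" "l + 1"] by (auto simp: e_def)
  have "f = e k" if f: "f \<in> edges B" "c k \<in> f" for f
  proof -
    obtain r where r: "f = e r" using nB f by (auto simp: nonseparable_def subgraph_def)
    have "e k \<inter> side (l + 1) (k + n) = {}" using side_edge_disjoint[OF pq ek] .
    then have "n dvd r - k \<or> n dvd r - (l + 1 - 1)"
      using block_edges_pair[OF nB pq] k f r by (metis insertI1 e_def)
    then show ?thesis using e_cong[of r] el r by auto
  qed
  then have "{c k, y} = {c k, z}" using yz by (metis insertI1)
  then show False using yz(1) by (auto simp: doubleton_eq_iff)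
qed

text \<open>The pair of \<open>k\<close> encloses that of \<open>k + 1\<close> since the two do not
  cross, and \<open>l + 1 = m\<close> would make \<open>e l\<close> a second traversal of
  \<open>e k\<close>.\<close>

lemma adjacent_pairs:
  assumes k: "\<not> once k" "\<not> once (k + 1)" and single: "\<And>m. e m = e k \<Longrightarrow> n dvd m - k"
  obtains l m where "k + 1 < l" "l + 1 < m" "m < k + n" "c k = c m" "c (k + 1) = c l" "pair k m"
proof -
  obtain m where m: "pair k m" using k(1) by (rule not_onceE)
  obtain l where l: "pair (k + 1) l" using k(2) by (rule not_onceE)
  have eqs: "c k = c m" "c (k + 1) = c l" using l m by (auto simp: pair_def)
  note dm = pair_dest[OF m] and dl = pair_dest[OF l]
  have "l \<noteq> m" using eqs c_ne[of k] by auto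
  moreover have "\<not> m < l"
  proof
    assume "m < l"
    moreover have "l < k + n" using dl by simp
    ultimately show False using no_crossing[of k "k + 1" m l] dm eqs by simp
  qed
  moreover have "l + 1 \<noteq> m"
  proof
    assume "l + 1 = m"
    then have "e l = e k" using eqs by (auto simp: e_def)
    then have "n dvd l - k" by (rule single)
    then show False using dvd_window[of l k] dl by auto
  qed
  ultimately show thesis using that[of l m] dl dm eqs m by auto
qed

text \<open>A path from the second occurrence of \<open>c (k + 1)\<close> to that of \<open>c k\<close> closes up with \<open>e k\<close>.\<close>

lemma adjacent_pairs_cycle:
  assumes k: "\<not> once k" "\<not> once (k + 1)" and single: "\<And>m. e m = e k \<Longrightarrow> n dvd m - k"
  obtains B where "block W B" "is_cycle B" "e k \<in> edges B"
proof -
  obtain l m where lm: "k + 1 < l" "l + 1 < m" "m < k + n" "c k = c m" "c (k + 1) = c l"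
    using adjacent_pairs[OF assms] by blast
  have "l \<le> m" using lm by simp
  then obtain q where q: "q \<noteq> []" "distinct q" "hd q = c l" "last q = c m" "set q \<subseteq> c ` {l..m}"
    "set (walk_edges q) \<subseteq> e ` {l..m - 1}" by (rule segment_path)
  have "e k \<notin> e ` {l..m - 1}"
  proof
    assume "e k \<in> e ` {l..m - 1}"
    then obtain r where r: "l \<le> r" "r \<le> m - 1" "e r = e k" by auto
    then show False using single[of r] dvd_window[of r k] lm by auto
  qed
  then have "{c l, c m} \<notin> set (walk_edges q)" using q(6) lm by (auto simp: e_def insert_commute)
  then have "3 \<le> length q" using path_length[OF q(1,3,4)] lm c_ne[of k] by auto
  then obtain xs where xs: "cycle_list xs" "set xs = set [c k, c (k + 1)] \<union> set q"
    "edges (cycle_graph xs) = set (walk_edges [c k, c (k + 1)]) \<union> set (walk_edges q)"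
    using cycle_of_paths[of "[c k, c (k + 1)]" "c k" "c (k + 1)" q] q lm c_ne[of k] by auto
  have "xs \<noteq> []" using xs by (auto simp: cycle_list_def)
  moreover have "edges (cycle_graph xs) \<subseteq> range e"
    using xs(3) q(6) by (auto simp: walk_edges_Cons e_def[symmetric])
  moreover have "set xs \<subseteq> range c" using xs(2) q(5) by auto
  ultimately have "block W (cycle_graph xs)" using cycle_block[OF xs(1)] subgraph_cycle by blast
  moreover have "e k \<in> edges (cycle_graph xs)" using xs(3) by (simp add: walk_edges_Cons e_def)
  ultimately show thesis using that is_cycle_cycle_graph[OF xs(1)] by blast
qed

end

section \<open>Closed walks as lists\<close>

text \<open>One function for both monomials of a walk. Parity is counted from the head of the list,
  so concatenation and reversal become shifts of \<open>\<sigma>\<close>.\<close>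

definition alt_product :: "bool \<Rightarrow> 'v set list \<Rightarrow> 'v edge_monom" where
  "alt_product \<sigma> xs = edge_product (nths xs {i. even i = \<sigma>})"

lemma E_alt: "E_plus w = alt_product True (walk_edges w)" "E_minus w = alt_product False (walk_edges w)"
  by (simp_all add: E_plus_def E_minus_def alt_product_def)

lemma alt_product_Nil [simp]: "alt_product \<sigma> [] = 0"
  by (simp add: alt_product_def edge_product_def)

lemma alt_product_Cons: "alt_product \<sigma> (x # xs) = (if \<sigma> then mon x else 0) + alt_product (\<not> \<sigma>) xs"
proof -
  have "{j. Suc j \<in> {i. even i = \<sigma>}} = {j. even j = (\<not> \<sigma>)}" by auto
  then show ?thesis by (simp add: alt_product_def edge_product_def nths_Cons)
qed

lemma alt_product_append:
  "alt_product \<sigma> (xs @ ys) = alt_product \<sigma> xs + alt_product (\<sigma> = even (length xs)) ys"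
proof (induction xs arbitrary: \<sigma>)
  case (Cons x xs)
  have "((\<not> \<sigma>) = even (length xs)) = (\<sigma> = even (length (x # xs)))" by auto
  then show ?case using Cons.IH[of "\<not> \<sigma>"] by (simp add: alt_product_Cons add.assoc)
qed simp

lemma alt_product_rev: "alt_product \<sigma> (rev xs) = alt_product (\<sigma> = odd (length xs)) xs"
proof (induction xs arbitrary: \<sigma>)
  case (Cons x xs)
  have "(\<not> (\<sigma> = odd (length (x # xs)))) = (\<sigma> = odd (length xs))" by auto
  then show ?case using Cons.IH[of \<sigma>]
    by (simp add: alt_product_append alt_product_Cons ac_simps)
qed simp

lemma edge_product_alt: "edge_product xs = alt_product True xs + alt_product False xs"
proof (induction xs)
  case (Cons x xs)
  then show ?case by (simp add: alt_product_Cons edge_product_def ac_simps)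
qed (simp add: edge_product_def)

lemma tdeg_edge_product: "tdeg (edge_product xs) = length xs"
  by (induction xs) (simp_all add: edge_product_def tdeg_add)

lemma walk_edges_rev: "walk_edges (rev xs) = rev (walk_edges xs)"
proof (rule nth_equalityI)
  show "length (walk_edges (rev xs)) = length (rev (walk_edges xs))" by (simp add: walk_edges_def)
  fix i assume "i < length (walk_edges (rev xs))"
  then have i: "Suc i < length xs" by (simp add: walk_edges_def)
  then have "Suc (length xs - Suc (Suc i)) = length xs - Suc i" "i < length xs - 1"
    "length xs - Suc (Suc i) < length xs - 1" by simp_all
  then show "walk_edges (rev xs) ! i = rev (walk_edges xs) ! i"
    using i by (simp add: walk_edges_def rev_nth insert_commute)
qed

context periodic_walk
begin

lemma alt_product_map: "i \<le> j \<Longrightarrow> alt_product \<sigma> (map e [i..j - 1]) = P (\<sigma> = even i) i j"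
proof (induction "nat (j - i)" arbitrary: i \<sigma>)
  case (Suc m)
  then have ij: "i < j" by simp
  then have "[i..j - 1] = i # [i + 1..j - 1]" by (simp add: upto_rec1)
  moreover have "alt_product (\<not> \<sigma>) (map e [i + 1..j - 1]) = P ((\<not> \<sigma>) = even (i + 1)) (i + 1) j"
    using Suc ij by (intro Suc.hyps(1)) auto
  moreover have "((\<not> \<sigma>) = even (i + 1)) = (\<sigma> = even i)" by auto
  moreover have "(even i = (\<sigma> = even i)) = \<sigma>" by auto
  ultimately show ?case
    using P_split[of i "i + 1" j "\<sigma> = even i"] P_Suc[of "\<sigma> = even i" i] ij by (simp add: alt_product_Cons)
qed simp

end

definition walk_period :: "'v list \<Rightarrow> int" where "walk_period w = int (length w - 1)"

text \<open>The index stays below the period, hence the repeated last entry of the list is never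
  read.\<close>

definition walk_seq :: "'v list \<Rightarrow> int \<Rightarrow> 'v" where "walk_seq w k = w ! nat (k mod walk_period w)"

locale list_walk =
  fixes G :: "'v sgraph" and w :: "'v list"
  assumes fG: "finite_simple_graph G" and w: "even_closed_walk G w"
begin

abbreviation n :: int where "n \<equiv> walk_period w"
abbreviation c :: "int \<Rightarrow> 'v" where "c \<equiv> walk_seq w"

lemma len: "n > 0" "even n" "length w = nat n + 1" "length (walk_edges w) = nat n" "length w - 1 = nat n"
proof -
  have l: "2 \<le> length w" "even (length w - 1)" "length (walk_edges w) = length w - 1"
    using w by (auto simp: even_closed_walk_def closed_walk_def walk_def even_walk_def walk_edges_def)
  then show "n > 0" "even n" "length w = nat n + 1" "length (walk_edges w) = nat n" "length w - 1 = nat n"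
    by (auto simp: walk_period_def)
qed

lemma w_last: "w ! nat n = w ! 0"
proof -
  have "w \<noteq> []" "hd w = last w" using w len by (auto simp: even_closed_walk_def closed_walk_def walk_def)
  then show ?thesis using len by (simp add: hd_conv_nth last_conv_nth)
qed

lemma seq_nat: "i \<le> nat n \<Longrightarrow> c (int i) = w ! i"
proof -
  assume "i \<le> nat n"
  then consider "int i < n" | "int i = n" "i = nat n" using len(1) by linarith
  then show ?thesis
    using w_last by cases (simp_all add: walk_seq_def)
qed

lemma seq_edge: "\<exists>i<nat n. {c k, c (k + 1)} = walk_edges w ! i \<and> int i = k mod n"
proof (intro exI conjI)
  let ?i = "nat (k mod n)"
  show i: "?i < nat n" "int ?i = k mod n" using len(1) by simp_all
  have "c k = w ! ?i" by (simp add: walk_seq_def)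
  moreover have "c (k + 1) = c (int (Suc ?i))" using len(1) by (simp add: walk_seq_def mod_simps add.commute)
  then have "c (k + 1) = w ! Suc ?i" using seq_nat[of "Suc ?i"] i by simp
  ultimately show "{c k, c (k + 1)} = walk_edges w ! ?i" using i len by (simp add: walk_edges_def)
qed

end

sublocale list_walk \<subseteq> periodic_walk G "walk_seq w" "walk_period w"
proof
  show "walk_seq w (k + walk_period w) = walk_seq w k" for k by (simp add: walk_seq_def)
  show "{walk_seq w k, walk_seq w (k + 1)} \<in> edges G" for k
  proof -
    obtain i where "i < nat n" "{c k, c (k + 1)} = walk_edges w ! i" using seq_edge by blast
    moreover have "set (walk_edges w) \<subseteq> edges G"
      using w by (simp add: even_closed_walk_def closed_walk_def walk_def)
    ultimately show ?thesis using len by (metis nth_mem subsetD)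
  qed
qed (use fG len in auto)

context list_walk
begin

lemma walk_edges_nth: "i < nat n \<Longrightarrow> walk_edges w ! i = e (int i)"
  using seq_nat[of i] seq_nat[of "Suc i"] len by (simp add: walk_edges_def e_def add.commute)

lemma walk_edges_seq: "walk_edges w = map e [0..n - 1]"
  by (rule nth_equalityI) (simp_all add: len walk_edges_nth)

lemma range_residue: "\<exists>i<nat n. n dvd int i - k"
proof -
  obtain m where "0 \<le> m" "m < 0 + n" "n dvd m - k" by (rule residue)
  then show ?thesis by (intro exI[of _ "nat m"]) auto
qed

lemma set_walk: "set w = range c"
proof -
  have "c k \<in> set w" for k using range_residue[of k] c_cong seq_nat len(3)
    by (metis less_add_one less_imp_le nth_mem order_less_trans)
  moreover have "x \<in> range c" if x: "x \<in> set w" for x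
  proof -
    obtain i where "i < length w" "x = w ! i" using x by (metis in_set_conv_nth)
    then show ?thesis using seq_nat[of i] len(3) by (metis Suc_eq_plus1 less_Suc_eq_le rangeI)
  qed
  ultimately show ?thesis by blast
qed

lemma set_walk_edges: "set (walk_edges w) = range e"
proof -
  have "e k \<in> set (walk_edges w)" for k
    using seq_edge[of k] len(4) unfolding e_def by (metis nth_mem)
  moreover have "set (walk_edges w) \<subseteq> range e" unfolding walk_edges_seq by auto
  ultimately show ?thesis by blast
qed

lemma E_P: "E_plus w = P True 0 n" "E_minus w = P False 0 n"
  using alt_product_map[of 0 n True] alt_product_map[of 0 n False] len(1) by (simp_all add: E_alt walk_edges_seq)

lemma E_deg: "vdeg (E_minus w) = vdeg (E_plus w)"
  using vdeg_full[of True] by (simp add: E_P)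

lemma E_keys: "keys (E_plus w) \<subseteq> edges G" "keys (E_minus w) \<subseteq> edges G"
  using keys_P_edges by (simp_all add: E_P)

lemma E_tdeg: "2 * tdeg (E_plus w) = nat n" "2 * tdeg (E_minus w) = nat n"
proof -
  have "tdeg (E_plus w) = tdeg (E_minus w)" using tdeg_eq[OF fG E_keys] E_deg by simp
  moreover have "tdeg (E_plus w) + tdeg (E_minus w) = nat n"
    using tdeg_edge_product[of "walk_edges w"] by (simp add: edge_product_alt E_alt tdeg_add len)
  ultimately show "2 * tdeg (E_plus w) = nat n" "2 * tdeg (E_minus w) = nat n" by simp_all
qed

lemma conn_E: "conn \<longleftrightarrow> fiber_conn G (E_plus w) (E_minus w)"
  by (simp add: conn_def E_P)

text \<open>For a shorter walk \<open>z\<close> inside \<open>w\<close>, replacing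
  \<open>E_plus z\<close> by \<open>E_minus z\<close> in \<open>E_plus w\<close> gives a monomial
  that keeps the nontrivial rest \<open>t\<close> and acquires a variable of
  \<open>E_minus w\<close>.\<close>

lemma not_conn_primitive:
  assumes nc: "\<not> conn" shows "primitive_walk G w"
  unfolding primitive_walk_def
proof (intro conjI w notI)
  assume "\<exists>z. even_closed_walk G z \<and> subwalk z w \<and> length (walk_edges z) < length (walk_edges w) \<and>
    monom_dvd (E_plus z) (E_plus w) \<and> monom_dvd (E_minus z) (E_minus w)"
  then obtain z t s where z: "even_closed_walk G z" "length (walk_edges z) < length (walk_edges w)"
    and t: "E_plus w = E_plus z + t" and s: "E_minus w = E_minus z + s" by (auto simp: monom_dvd_def)
  interpret z: list_walk G z using z fG by unfold_locales
  have "nat z.n < nat n" using z(2) len(4) z.len(4) by simp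
  moreover have "nat z.n + 2 * tdeg t = nat n" using E_tdeg(1) z.E_tdeg(1) by (simp add: t tdeg_add)
  ultimately have "tdeg t > 0" by linarith
  then have "t \<noteq> 0" by auto
  then obtain g where g: "g \<in> keys t" by (metis keys_eq_empty ex_in_conv)
  have "tdeg (E_minus z) > 0" using z.E_tdeg(2) z.len(1) by (cases "tdeg (E_minus z)") auto
  then have "E_minus z \<noteq> 0" by auto
  then obtain h where h: "h \<in> keys (E_minus z)" by (metis keys_eq_empty ex_in_conv)
  let ?m = "E_minus z + t"
  have d: "vdeg ?m = vdeg (E_plus w)" using z.E_deg by (simp add: t vdeg_add fun_eq_iff)
  have k: "keys ?m \<subseteq> edges G" using z.E_keys E_keys by (simp add: t keys_add_nat)
  have "fiber_conn G (E_plus w) ?m"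
    using d k E_keys g by (intro fiber_connI[of _ _ _ g]) (auto simp: t keys_add_nat)
  moreover have "fiber_conn G ?m (E_minus w)"
    using d k E_keys E_deg h by (intro fiber_connI[of _ _ _ h]) (auto simp: s keys_add_nat)
  ultimately show False
    using nc fiber_conn_trans[of G "E_plus w" ?m "E_minus w"] by (simp add: conn_E)
qed

text \<open>A subwalk may fit with the two monomials interchanged. Reversal of an even walk
  interchanges them back.\<close>

lemma no_subwalk:
  assumes prim: "primitive_walk G w" and z: "even_closed_walk G z" "length (walk_edges z) < nat n"
    and dvd: "P \<sigma> 0 n = E_plus z + t" "P (\<not> \<sigma>) 0 n = E_minus z + s"
  shows False
proof -
  have main: False if y: "even_closed_walk G y" "length (walk_edges y) < nat n"
    "E_plus w = E_plus y + t'" "E_minus w = E_minus y + s'" for y t' s'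
  proof -
    have "edge_product (walk_edges w) = edge_product (walk_edges y) + (t' + s')"
      using y(3,4) by (simp add: edge_product_alt E_alt ac_simps)
    then have "subwalk y w" unfolding subwalk_def monom_dvd_def by blast
    moreover have "monom_dvd (E_plus y) (E_plus w)" "monom_dvd (E_minus y) (E_minus w)"
      using y unfolding monom_dvd_def by blast+
    ultimately show False using prim y len(4) unfolding primitive_walk_def by metis
  qed
  show False
  proof (cases \<sigma>)
    case True
    then show False using main[OF z, of t s] dvd by (simp add: E_P)
  next
    case False
    have ze: "even (length (walk_edges z))" using z by (simp add: even_closed_walk_def even_walk_def)
    have "z \<noteq> []" using z by (auto simp: even_closed_walk_def closed_walk_def walk_def)
    then have "even_closed_walk G (rev z)" using z(1)
      by (auto simp: even_closed_walk_def closed_walk_def walk_def even_walk_def walk_edges_rev hd_rev last_rev)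
    moreover have "E_plus (rev z) = E_minus z" "E_minus (rev z) = E_plus z"
      using ze by (simp_all add: E_alt walk_edges_rev alt_product_rev)
    ultimately show False using main[of "rev z" s t] z(2) dvd False by (simp add: E_P walk_edges_rev)
  qed
qed

lemma even_closed_walkI:
  assumes "2 \<le> length z" "set (walk_edges z) \<subseteq> range e" "hd z = last z" "even (length (walk_edges z))"
  shows "even_closed_walk G z"
  using assms e_in by (auto simp: even_closed_walk_def closed_walk_def walk_def even_walk_def)

text \<open>At even distance the segment between the two visits would itself be a shorter even
  closed walk, with every edge at its own parity.\<close>

lemma primitive_eq_odd:
  assumes prim: "primitive_walk G w" and ij: "i < j" "j < i + n" "c i = c j"
  shows "odd (j - i)"
proof
  assume ev: "even (j - i)"
  let ?z = "map c [i..j]"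
  have we: "walk_edges ?z = map e [i..j - 1]" by (rule walk_edges_map)
  have "hd ?z = last ?z" using ij by (simp add: hd_map last_map hd_upto last_upto)
  moreover have "2 \<le> length ?z" "even (length (walk_edges ?z))" using ij ev by (simp_all add: we even_nat_iff)
  ultimately have "even_closed_walk G ?z" by (intro even_closed_walkI) (auto simp: we)
  moreover have "length (walk_edges ?z) < nat n" using ij by (simp add: we)
  moreover have "E_plus ?z = P (even i) i j" "E_minus ?z = P (\<not> even i) i j"
    using ij by (simp_all add: E_alt we alt_product_map)
  ultimately show False
    using no_subwalk[OF prim, of ?z "even i" "P (even i) j (i + n)" "P (\<not> even i) j (i + n)"]
      P_full_split[of i j] ij by simp
qed

text \<open>If two pairs crossed, reversing the segment between the second occurrences would give a
  shorter alternating walk.\<close>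

lemma primitive_no_crossing:
  assumes prim: "primitive_walk G w" and o: "i < k" "k < j" "j < l" "l < i + n"
    and eq: "c i = c j" "c k = c l"
  shows False
proof -
  have par: "odd (j - i)" "odd (l - k)" using primitive_eq_odd[OF prim] o eq by auto
  \<comment> \<open>From \<open>c i\<close> forward to \<open>c k = c l\<close>, then backward to
    \<open>c j = c i\<close>. The first list stops at \<open>k - 1\<close> because
    \<open>c l\<close> already stands for \<open>c k\<close>.\<close>
  let ?z = "map c [i..k - 1] @ rev (map c [j..l])"
  have jl: "map c [j..l] = map c [j..l - 1] @ [c l]" using o by (simp add: upto_rec2)
  have ik: "map c [i..k] = map c [i..k - 1] @ [c k]" using o by (simp add: upto_rec2)
  have "walk_edges ?z = walk_edges (map c [i..k]) @ walk_edges (rev (map c [j..l]))"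
    unfolding ik jl using walk_edges_append[of "map c [i..k - 1]" "c k" "rev (map c [j..l - 1])"] eq by simp
  then have we: "walk_edges ?z = map e [i..k - 1] @ rev (map e [j..l - 1])"
    by (simp only: walk_edges_rev walk_edges_map)
  have len_z: "length (walk_edges ?z) = nat (k - i) + nat (l - j)" by (simp add: we)
  have "even (nat (k - i) + nat (l - j))" using par o by (simp add: even_nat_iff nat_add_distrib[symmetric])
  moreover have "hd ?z = c i" using o by (simp add: hd_append hd_map hd_upto)
  moreover have "last ?z = c j" using o by (simp add: last_rev hd_map hd_upto)
  moreover have "2 \<le> length ?z" using o by simp
  moreover have "set (walk_edges ?z) \<subseteq> range e" by (auto simp: we)
  ultimately have z: "even_closed_walk G ?z" using eq len_z by (intro even_closed_walkI) simp_all
  have alt: "alt_product \<sigma> (walk_edges ?z) = P (\<sigma> = even i) i k + P (\<sigma> = even i) j l" for \<sigma>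
  proof -
    have "alt_product \<sigma> (walk_edges ?z) = P (\<sigma> = even i) i k + P (((\<sigma> = even (nat (k - i))) = odd (nat (l - j))) = even j) j l"
      using o by (simp add: we alt_product_append alt_product_rev alt_product_map)
    moreover have "(((\<sigma> = even (nat (k - i))) = odd (nat (l - j))) = even j) = (\<sigma> = even i)"
      using par o by (auto simp: even_nat_iff)
    ultimately show ?thesis by simp
  qed
  have full: "P \<sigma> 0 n = (P \<sigma> i k + P \<sigma> j l) + (P \<sigma> k j + P \<sigma> l (i + n))" for \<sigma>
    using P_full_split[of i j \<sigma>] P_split[of i k j \<sigma>] P_split[of j l "i + n" \<sigma>] o by (simp add: ac_simps)
  have "length (walk_edges ?z) < nat n" using len_z o by simp
  then show False
    using no_subwalk[OF prim z, of "even i" "P (even i) k j + P (even i) l (i + n)"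
        "P (\<not> even i) k j + P (\<not> even i) l (i + n)"] full[of "even i"] full[of "\<not> even i"] alt[of True] alt[of False]
    by (simp add: E_alt)
qed

lemma primitive_noncrossing:
  assumes prim: "primitive_walk G w" and ne: "E_plus w \<noteq> E_minus w"
  shows "noncrossing_walk G c n"
proof
  \<comment> \<open>A walk of length two runs along one edge and back, so its two monomials
    coincide.\<close>
  show "4 \<le> n"
  proof (rule ccontr)
    assume "\<not> 4 \<le> n"
    then have n2: "n = 2" using len(1,2) by presburger
    have "e 1 = e 0" using per[of 0] n2 by (auto simp: e_def)
    moreover have "P \<sigma> 0 2 = P \<sigma> 0 (0 + 1) + P \<sigma> 1 (1 + 1)" for \<sigma> using P_split[of 0 1 2 \<sigma>] by simp
    ultimately have "P True 0 n = P False 0 n" unfolding n2 P_Suc by simp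
    then show False using ne by (simp add: E_P)
  qed
  show "n dvd i - j" if eq: "c i = c j" "even (i - j)" for i j
  proof (rule ccontr)
    assume nd: "\<not> n dvd i - j"
    obtain m where m: "i \<le> m" "m < i + n" "n dvd m - j" by (rule residue)
    then have "m \<noteq> i" "c i = c m" using nd eq c_cong by auto
    then have "odd (m - i)" using primitive_eq_odd[OF prim, of i m] m by simp
    then show False using dvd_even[OF m(3)] eq(2) by presburger
  qed
  show False if "i < k" "k < j" "j < l" "l < i + n" "c i = c j" "c k = c l" for i k j l
    using primitive_no_crossing[OF prim that] .
qed

end

section \<open>Chords, crossings and sinks in terms of positions\<close>

locale noncrossing_list_walk = list_walk G w for G :: "'v sgraph" and w :: "'v list" +
  assumes noncrossing: "noncrossing_walk G (walk_seq w) (walk_period w)"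

sublocale noncrossing_list_walk \<subseteq> noncrossing_walk G "walk_seq w" "walk_period w"
  by (rule noncrossing)

context noncrossing_list_walk
begin

lemma walk_graph_W: "walk_graph w = W"
  by (simp add: walk_graph_def W_def set_walk set_walk_edges)

lemma chord_iff: "chord G w f \<longleftrightarrow> chd f \<and> f \<subseteq> range c"
  by (auto simp: chord_def chd_def set_walk set_walk_edges)

lemma chord_chd: "chd {c i, c j} \<longleftrightarrow> chord G w {c i, c j}"
  by (simp add: chord_iff)

lemma chordE:
  assumes "chord G w f"
  obtains i j where "0 \<le> i" "i < j" "j < n" "f = {c i, c j}" "chd {c i, c j}"
proof -
  have f: "chd f" "f \<subseteq> range c" using assms by (simp_all add: chord_iff)
  then obtain x y where xy: "f = {x, y}" using fG by (auto simp: chd_def finite_simple_graph_def)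
  then obtain i' j' where ij': "x = c i'" "y = c j'" using f by auto
  obtain i where i: "0 \<le> i" "i < 0 + n" "n dvd i - i'" by (rule residue)
  obtain j where j: "0 \<le> j" "j < 0 + n" "n dvd j - j'" by (rule residue)
  have fc: "f = {c i, c j}" using xy ij' c_cong[OF i(3)] c_cong[OF j(3)] by simp
  then have "i \<noteq> j" using chd_ne f by blast
  then show thesis
    using that[of i j] that[of j i] fc f(1) i j by (cases "i < j") (auto simp: insert_commute)
qed

lemma bridge_iff: "bridge G w f \<longleftrightarrow> chord G w f \<and> diff_blocks f"
  by (simp add: bridge_def diff_blocks_def walk_graph_W)

lemma chord_at_iff: "chord_at w f i j \<longleftrightarrow> i < j \<and> int j < n \<and> f = {c (int i), c (int j)}"
proof -
  have "j < length w - 1 \<longleftrightarrow> int j < n" using len by auto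
  moreover have "i < j \<Longrightarrow> int j < n \<Longrightarrow> c (int i) = w ! i \<and> c (int j) = w ! j" using seq_nat by simp
  ultimately show ?thesis unfolding chord_at_def by metis
qed

lemma parts_parity:
  assumes "i < j" "int j < n"
  shows "even_walk (outer_part w i j) \<longleftrightarrow> odd (j - i)" "even_walk (inner_part w i j) \<longleftrightarrow> odd (j - i)"
proof -
  \<comment> \<open>The chord contributes one edge to each of the two parts.\<close>
  have "length (outer_part w i j) - 1 = i + nat n + 1 - j" "length (inner_part w i j) - 1 = j + 1 - i"
    using assms len by (simp_all add: outer_part_def inner_part_def)
  moreover obtain d where d: "j = i + d" using assms(1) by (metis less_imp_add_positive)
  moreover obtain t where t: "nat n = j + t" using assms(2) by (metis le_Suc_ex less_imp_le zless_nat_eq_int_zless)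
  moreover have "even (nat n)" using len(1,2) by (simp add: even_nat_iff)
  ultimately have l: "length (outer_part w i j) - 1 = i + t + 1" "length (inner_part w i j) - 1 = d + 1"
    "even (i + d + t)" "j - i = d" by simp_all
  have "length (walk_edges xs) = length xs - 1" for xs :: "'v list" by (simp add: walk_edges_def)
  then show "even_walk (outer_part w i j) \<longleftrightarrow> odd (j - i)" "even_walk (inner_part w i j) \<longleftrightarrow> odd (j - i)"
    using l unfolding even_walk_def by auto
qed

lemma odd_chord_iff:
  "odd_chord G w f \<longleftrightarrow> chord G w f \<and> \<not> diff_blocks f \<and>
    (\<exists>i j. 0 \<le> i \<and> i < j \<and> j < n \<and> f = {c i, c j} \<and> even (j - i))"
proof -
  have "(\<exists>i j. chord_at w f i j \<and> \<not> even_walk (outer_part w i j) \<and> \<not> even_walk (inner_part w i j)) \<longleftrightarrow>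
    (\<exists>i j. 0 \<le> i \<and> i < j \<and> j < n \<and> f = {c i, c j} \<and> even (j - i))" (is "?l \<longleftrightarrow> ?r")
  proof
    assume ?l
    then obtain i j where ij: "i < j" "int j < n" "f = {c (int i), c (int j)}" "\<not> even_walk (outer_part w i j)"
      by (auto simp: chord_at_iff)
    then have "even (j - i)" using parts_parity by simp
    then have "even (int j - int i)" using ij(1) by simp
    then show ?r using ij by (rule_tac exI[of _ "int i"], rule_tac exI[of _ "int j"]) simp
  next
    assume ?r
    then obtain i j where ij: "0 \<le> i" "i < j" "j < n" "f = {c i, c j}" "even (j - i)" by blast
    then have *: "nat i < nat j" "int (nat j) < n" "int (nat i) = i" "int (nat j) = j" by simp_all
    have "nat j - nat i = nat (j - i)" using ij by (simp add: nat_diff_distrib)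
    then have "even (nat j - nat i)" using ij by (simp add: even_nat_iff)
    then show ?l using ij * parts_parity[OF *(1,2)]
      by (rule_tac exI[of _ "nat i"], rule_tac exI[of _ "nat j"]) (simp add: chord_at_iff)
  qed
  then show ?thesis unfolding odd_chord_def bridge_iff by blast
qed

lemma cross_iff:
  "cross_effectively G w f f' \<longleftrightarrow> odd_chord G w f \<and> odd_chord G w f' \<and>
    (\<exists>i j k l. 0 \<le> i \<and> i < j \<and> j < n \<and> 0 \<le> k \<and> k < l \<and> l < n \<and> f = {c i, c j} \<and> f' = {c k, c l} \<and>
      odd (k - i) \<and> (i < k \<and> k < j \<and> j < l \<or> k < i \<and> i < l \<and> l < j))"
proof -
  have "(\<exists>s j s' j'. chord_at w f s j \<and> chord_at w f' s' j' \<and> odd (int s' - int s) \<and>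
        (s < s' \<and> s' < j \<and> j < j' \<or> s' < s \<and> s < j' \<and> j' < j)) \<longleftrightarrow>
    (\<exists>i j k l. 0 \<le> i \<and> i < j \<and> j < n \<and> 0 \<le> k \<and> k < l \<and> l < n \<and> f = {c i, c j} \<and> f' = {c k, c l} \<and>
      odd (k - i) \<and> (i < k \<and> k < j \<and> j < l \<or> k < i \<and> i < l \<and> l < j))" (is "?l \<longleftrightarrow> ?r")
  proof
    assume ?l
    then obtain s j s' j' where "chord_at w f s j" "chord_at w f' s' j'" "odd (int s' - int s)"
      "s < s' \<and> s' < j \<and> j < j' \<or> s' < s \<and> s < j' \<and> j' < j" by blast
    then show ?r unfolding chord_at_iff
      by (rule_tac exI[of _ "int s"], rule_tac exI[of _ "int j"], rule_tac exI[of _ "int s'"],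
        rule_tac exI[of _ "int j'"]) auto
  next
    assume ?r
    then obtain i j k l where ij: "0 \<le> i" "i < j" "j < n" "0 \<le> k" "k < l" "l < n" "f = {c i, c j}" "f' = {c k, c l}"
      "odd (k - i)" "i < k \<and> k < j \<and> j < l \<or> k < i \<and> i < l \<and> l < j" by blast
    have "chord_at w f (nat i) (nat j)" "chord_at w f' (nat k) (nat l)" using ij by (simp_all add: chord_at_iff)
    moreover have "odd (int (nat k) - int (nat i))" using ij by simp
    moreover have "nat i < nat k \<and> nat k < nat j \<and> nat j < nat l \<or> nat k < nat i \<and> nat i < nat l \<and> nat l < nat j"
      using ij by auto
    ultimately show ?l by blast
  qed
  then show ?thesis unfolding cross_effectively_def by blast
qed

lemma cross_sym: "cross_effectively G w f f' \<Longrightarrow> cross_effectively G w f' f"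
proof -
  assume "cross_effectively G w f f'"
  then obtain i j k l where "odd_chord G w f" "odd_chord G w f'" "0 \<le> i" "i < j" "j < n" "0 \<le> k" "k < l" "l < n"
    "f = {c i, c j}" "f' = {c k, c l}" "odd (k - i)" "i < k \<and> k < j \<and> j < l \<or> k < i \<and> i < l \<and> l < j"
    unfolding cross_iff by blast
  note ij = this
  have "\<exists>i' j' k' l'. 0 \<le> i' \<and> i' < j' \<and> j' < n \<and> 0 \<le> k' \<and> k' < l' \<and> l' < n \<and> f' = {c i', c j'} \<and> f = {c k', c l'} \<and>
      odd (k' - i') \<and> (i' < k' \<and> k' < j' \<and> j' < l' \<or> k' < i' \<and> i' < l' \<and> l' < j')"
    by (rule exI[of _ k], rule exI[of _ l], rule exI[of _ i], rule exI[of _ j]) (use ij in auto)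
  then show ?thesis unfolding cross_iff using ij(1,2) by simp
qed

lemma F4_sym: "F4 G w e1 f e2 f' \<Longrightarrow> F4 G w e1 f' e2 f"
proof -
  assume F: "F4 G w e1 f e2 f'"
  then obtain a b c' d where d: "distinct [a, b, c', d]" "e1 = {a, b}" "f = {b, c'}" "e2 = {c', d}" "f' = {d, a}"
    unfolding F4_def by blast
  then have "distinct [b, a, d, c'] \<and> e1 = {b, a} \<and> f' = {a, d} \<and> e2 = {d, c'} \<and> f = {c', b}"
    by (auto simp: insert_commute)
  then show ?thesis using F cross_sym unfolding F4_def by blast
qed

definition chords_odd :: bool where "chords_odd \<longleftrightarrow> (\<forall>f. chord G w f \<longrightarrow> odd_chord G w f)"

text \<open>Since an odd chord is not a bridge, its ends have unique positions modulo
  \<open>n\<close>; therefore its parity does not depend on the chosen positions.\<close>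

lemma chords_odd_dest:
  assumes odd: chords_odd and f: "chd {c i, c j}"
  shows "once i" "once j" "even (i - j)" "odd_chord G w {c i, c j}" "\<not> diff_blocks {c i, c j}"
proof -
  show o: "odd_chord G w {c i, c j}" using odd f by (simp add: chords_odd_def chord_chd)
  then show nd: "\<not> diff_blocks {c i, c j}" by (simp add: odd_chord_iff)
  then show i: "once i" using diff_blocks_not_once by blast
  show j: "once j" using diff_blocks_not_once[of j i] nd by (auto simp: insert_commute)
  obtain i0 j0 where ij: "{c i, c j} = {c i0, c j0}" "even (j0 - i0)" using o unfolding odd_chord_iff by blast
  then have "c i0 = c i \<and> c j0 = c j \<or> c i0 = c j \<and> c j0 = c i" by (auto simp: doubleton_eq_iff)
  then have "n dvd i0 - i \<and> n dvd j0 - j \<or> n dvd i0 - j \<and> n dvd j0 - i" using i j unfolding once_def by blast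
  then have "even (i0 - i) \<and> even (j0 - j) \<or> even (i0 - j) \<and> even (j0 - i)" using dvd_even by blast
  then show "even (i - j)" using ij(2) by presburger
qed

section \<open>Disconnected monomials force the conditions\<close>

lemma not_conn_chord:
  assumes nc: "\<not> conn" and f: "chd {c i, c j}"
  shows "even (i - j)" "once i"
proof -
  have ev: "even (i - j)" if "chd {c i, c j}" for i j
  proof (rule ccontr)
    assume od: "odd (i - j)"
    obtain m where m: "i \<le> m" "m < i + n" "n dvd m - j" by (rule residue)
    have cm: "chd {c i, c m}" using that c_cong[OF m(3)] by simp
    then have "m \<noteq> i" using chd_ne by auto
    moreover have "odd (m - i)" using od dvd_even[OF m(3)] by presburger
    ultimately show False using conn_even_chord[of i m] m cm nc by simp
  qed
  show "even (i - j)" using ev f .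
  show "once i"
  proof (rule ccontr)
    assume "\<not> once i"
    \<comment> \<open>The two visits have opposite parity, so from one of them the chord would be
      even.\<close>
    then obtain q where q: "pair i q" by (rule not_onceE)
    then have "chd {c q, c j}" using f by (simp add: pair_def)
    then have "even (q - j)" "even (i - j)" using ev f by blast+
    then show False using pair_dest(1)[OF q] by presburger
  qed
qed

lemma not_conn_chords_odd:
  assumes nc: "\<not> conn" shows chords_odd
  unfolding chords_odd_def
proof (intro allI impI)
  fix f assume f: "chord G w f"
  then obtain i j where ij: "0 \<le> i" "i < j" "j < n" "f = {c i, c j}" "chd {c i, c j}" by (rule chordE)
  have ji: "chd {c j, c i}" using ij(5) by (simp add: insert_commute)
  have ev: "even (j - i)" using not_conn_chord(1)[OF nc ji] .
  have "\<not> diff_blocks {c i, c j}"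
  proof (rule same_block)
    show "i < j" "j < i + n" using ij by simp_all
    show "{c i, c j} \<notin> range e" using ij(5) by (simp add: chd_def)
    show "c i \<noteq> c j" using chd_ne[OF ij(5)] .
    show "once i" "once j" using not_conn_chord(2)[OF nc ij(5)] not_conn_chord(2)[OF nc ji] .
    show "c a \<noteq> c b" if ab: "i < a" "a < j" "j < b" "b < i + n" for a b
    proof
      assume eq: "c a = c b"
      then have "pair a b" using ab ij by (auto simp: pair_def)
      moreover have "c (i + n) = c i" by (rule per)
      \<comment> \<open>The chord is read from \<open>j\<close> to \<open>i + n\<close>, so that its
        ends alternate with the two visits \<open>a\<close> and \<open>b\<close>.\<close>
      ultimately show False
        using conn_separated_chord[of a j b "i + n"] ab eq ji ev n_even pair_dest(1)[of a b] nc by simp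
    qed
  qed
  then show "odd_chord G w f" unfolding odd_chord_iff using f ij ev by blast
qed

lemma cross_pair:
  assumes odd: chords_odd and f: "chd {c a, c b}" "chd {c (a + 1), c (b + 1)}" and ab: "0 \<le> a" "a < b" "b < n"
  shows "cross_effectively G w {c a, c b} {c (a + 1), c (b + 1)}"
proof -
  have w: "a + 2 \<le> b" "b + 2 \<le> a + n" using chd_window[OF f(1)] ab by auto
  have ev: "even (a - b)" using chords_odd_dest(3)[OF odd f(1)] .
  have "\<exists>k l. 0 \<le> k \<and> k < l \<and> l < n \<and> {c (a + 1), c (b + 1)} = {c k, c l} \<and>
      odd (k - a) \<and> (a < k \<and> k < b \<and> b < l \<or> k < a \<and> a < l \<and> l < b)"
  proof (cases "b + 1 < n")
    case True
    then show ?thesis using w ab by (rule_tac exI[of _ "a + 1"], rule_tac exI[of _ "b + 1"]) simp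
  next
    \<comment> \<open>Position \<open>n\<close> does not belong to the window; the end
      \<open>c (b + 1)\<close> sits at position 0 and the two chords change order.\<close>
    case False
    then have b: "b + 1 = n" using ab by simp
    then have "c (b + 1) = c 0" using per[of 0] by simp
    moreover have "odd a" using ev b n_even by presburger
    ultimately show ?thesis using w ab b by (rule_tac exI[of _ 0], rule_tac exI[of _ "a + 1"]) auto
  qed
  then show ?thesis
    unfolding cross_iff using chords_odd_dest(4)[OF odd f(1)] chords_odd_dest(4)[OF odd f(2)] ab by blast
qed

lemma F4I:
  assumes odd: chords_odd and f: "chd {c a, c b}" "chd {c (a + 1), c (b + 1)}"
  shows "F4 G w (e a) {c a, c b} (e b) {c (a + 1), c (b + 1)}"
proof -
  note d1 = chords_odd_dest[OF odd f(1)] and d2 = chords_odd_dest[OF odd f(2)]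
  have n1: "c (a + 1) \<noteq> c b"
  proof
    assume "c (a + 1) = c b"
    then have "n dvd a + 1 - b" using d1(2) by (simp add: once_def)
    then show False using d1(3) dvd_even[of "a + 1 - b"] by simp
  qed
  have n2: "c (b + 1) \<noteq> c a"
  proof
    assume "c (b + 1) = c a"
    then have "n dvd b + 1 - a" using d1(1) by (simp add: once_def)
    then have "even (b + 1 - a)" by (rule dvd_even)
    then show False using d1(3) by presburger
  qed
  have "distinct [c (a + 1), c a, c b, c (b + 1)]"
    using n1 n2 c_ne[of a] c_ne[of b] chd_ne[OF f(1)] chd_ne[OF f(2)] by auto
  then have 1: "\<exists>A B C D. distinct [A, B, C, D] \<and> e a = {A, B} \<and> {c a, c b} = {B, C} \<and> e b = {C, D} \<and>
      {c (a + 1), c (b + 1)} = {D, A}"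
    by (rule_tac exI[of _ "c (a + 1)"], rule_tac exI[of _ "c a"], rule_tac exI[of _ "c b"],
      rule_tac exI[of _ "c (b + 1)"]) (auto simp: e_def)
  obtain i where i: "i < nat n" "n dvd int i - a" using range_residue by blast
  obtain j where j: "j < nat n" "n dvd int j - b" using range_residue by blast
  have "even i = even j" using dvd_even[OF i(2)] dvd_even[OF j(2)] d1(3) by presburger
  then have 2: "\<exists>i j. i < length (walk_edges w) \<and> j < length (walk_edges w) \<and> (even i \<longleftrightarrow> even j) \<and>
      e a = walk_edges w ! i \<and> e b = walk_edges w ! j"
    using i j walk_edges_nth e_cong[OF i(2)] e_cong[OF j(2)] len(4) by (rule_tac exI[of _ i], rule_tac exI[of _ j]) simp
  have ci: "c (int i) = c a" "c (int i + 1) = c (a + 1)" "c (int j) = c b" "c (int j + 1) = c (b + 1)"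
    using c_cong[OF i(2)] c_cong[OF j(2)] c_cong[of "int i + 1" "a + 1"] c_cong[of "int j + 1" "b + 1"] i j by simp_all
  have "i \<noteq> j" using ci chd_ne[OF f(1)] by auto
  have 3: "cross_effectively G w {c a, c b} {c (a + 1), c (b + 1)}"
  proof (cases "i < j")
    case True
    then show ?thesis using cross_pair[OF odd, of "int i" "int j"] f ci j by simp
  next
    case False
    then show ?thesis using cross_pair[OF odd, of "int j" "int i"] f ci i \<open>i \<noteq> j\<close> by (simp add: insert_commute)
  qed
  show ?thesis unfolding F4_def using 1 2 3 by blast
qed

text \<open>The other way of joining the ends of the two walk edges would use chords between
  positions of different parity.\<close>

lemma F4D:
  assumes odd: chords_odd and F: "F4 G w e1 f1 e2 f2"
  obtains a b where "e1 = e a" "e2 = e b" "even (a - b)" "chd {c a, c b}" "chd {c (a + 1), c (b + 1)}"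
    "f1 = {c a, c b} \<and> f2 = {c (a + 1), c (b + 1)} \<or> f1 = {c (a + 1), c (b + 1)} \<and> f2 = {c a, c b}"
proof -
  obtain A B C D where d: "e1 = {A, B}" "f1 = {B, C}" "e2 = {C, D}" "f2 = {D, A}"
    using F unfolding F4_def by blast
  obtain i j where ij: "i < nat n" "j < nat n" "even i = even j" "e1 = walk_edges w ! i" "e2 = walk_edges w ! j"
    using F len(4) unfolding F4_def by metis
  have "cross_effectively G w f1 f2" using F unfolding F4_def by blast
  then have ch: "chd f1" "chd f2" by (simp_all add: cross_iff odd_chord_iff chord_iff)
  let ?a = "int i" and ?b = "int j"
  have e12: "e1 = e ?a" "e2 = e ?b" using ij walk_edges_nth by simp_all
  have ev: "even (?a - ?b)" using ij(3) by simp
  have no: "\<not> chd {c ?a, c (?b + 1)}" "\<not> chd {c (?a + 1), c ?b}"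
    using chords_odd_dest(3)[OF odd, of ?a "?b + 1"] chords_odd_dest(3)[OF odd, of "?a + 1" ?b] ev by auto
  have "A = c ?a \<and> B = c (?a + 1) \<or> A = c (?a + 1) \<and> B = c ?a"
    using d(1) e12(1) by (auto simp: e_def doubleton_eq_iff)
  moreover have "C = c ?b \<and> D = c (?b + 1) \<or> C = c (?b + 1) \<and> D = c ?b"
    using d(3) e12(2) by (auto simp: e_def doubleton_eq_iff)
  ultimately consider "B = c ?a" "A = c (?a + 1)" "C = c ?b" "D = c (?b + 1)"
    | "B = c (?a + 1)" "A = c ?a" "C = c (?b + 1)" "D = c ?b"
    using ch(1) no d(2) by auto
  then show thesis
  proof cases
    case 1
    then have "f1 = {c ?a, c ?b}" "f2 = {c (?a + 1), c (?b + 1)}" using d by (auto simp: insert_commute)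
    then show thesis using that[OF e12 ev] ch by simp
  next
    case 2
    then have "f1 = {c (?a + 1), c (?b + 1)}" "f2 = {c ?a, c ?b}" using d by (auto simp: insert_commute)
    then show thesis using that[OF e12 ev] ch by simp
  qed
qed

lemma not_conn_crossing_F4:
  assumes nc: "\<not> conn" and f: "chd {c i, c j}" "chd {c k, c l}"
    and o: "0 \<le> i" "i < k" "k < j" "j < l" "l < n" "odd (k - i)"
  shows "\<exists>e1 e2. F4 G w e1 {c i, c j} e2 {c k, c l}"
proof -
  note odd = not_conn_chords_odd[OF nc]
  have "even (j - i)" "even (l - k)"
    using chords_odd_dest(3)[OF odd f(1)] chords_odd_dest(3)[OF odd f(2)] by simp_all
  then have "k = i + 1 \<and> l = j + 1 \<or> j = k + 1 \<and> l + 1 = i + n"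
    using conn_crossing[of i k j l] f o nc by simp
  then show ?thesis
  proof
    assume "k = i + 1 \<and> l = j + 1"
    then show ?thesis using F4I[OF odd f(1)] f(2) by auto
  next
    assume *: "j = k + 1 \<and> l + 1 = i + n"
    then have "{c (k + 1), c (l + 1)} = {c i, c j}" using per[of i] by (auto simp: insert_commute)
    then have "F4 G w (e k) {c k, c l} (e l) {c i, c j}" using F4I[OF odd f(2)] f(1) by simp
    then show ?thesis using F4_sym by blast
  qed
qed

lemma not_conn_no_strong_crossing:
  assumes nc: "\<not> conn" shows "\<not> cross_strongly_effectively G w f f'"
proof
  assume "cross_strongly_effectively G w f f'"
  then have cr: "cross_effectively G w f f'" and no: "\<nexists>e1 e2. F4 G w e1 f e2 f'"
    by (simp_all add: cross_strongly_effectively_def)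
  obtain i j k l where ij: "0 \<le> i" "j < n" "0 \<le> k" "l < n" "f = {c i, c j}" "f' = {c k, c l}" "odd (k - i)"
    "i < k \<and> k < j \<and> j < l \<or> k < i \<and> i < l \<and> l < j" using cr unfolding cross_iff by blast
  have ch: "chd {c i, c j}" "chd {c k, c l}" using cr ij(5,6) by (simp_all add: cross_iff odd_chord_iff chord_iff)
  from ij(8) show False
  proof
    assume "i < k \<and> k < j \<and> j < l"
    then show False using not_conn_crossing_F4[OF nc ch] ij no by blast
  next
    assume "k < i \<and> i < l \<and> l < j"
    moreover have "odd (i - k)" using ij(7) by simp
    ultimately have "\<exists>e1 e2. F4 G w e1 f' e2 f" using not_conn_crossing_F4[OF nc ch(2,1)] ij by blast
    then show False using no F4_sym by blast
  qed
qed

lemma rotate_seq: "t < nat n \<Longrightarrow> rotate r (butlast w) ! t = c (int r + int t)"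
proof -
  assume t: "t < nat n"
  have l: "length (butlast w) = nat n" using len by simp
  have m: "(r + t) mod nat n < nat n" using t by simp
  have "rotate r (butlast w) ! t = butlast w ! ((r + t) mod nat n)" using t l by (simp add: nth_rotate)
  also have "\<dots> = w ! ((r + t) mod nat n)" using m l by (simp add: nth_butlast)
  also have "\<dots> = c (int ((r + t) mod nat n))" using seq_nat[of "(r + t) mod nat n"] m by simp
  also have "\<dots> = c (int r + int t)"
  proof (rule c_cong)
    have "int ((r + t) mod nat n) = (int r + int t) mod n" using len(1) by (simp add: zmod_int)
    then show "n dvd int ((r + t) mod nat n) - (int r + int t)" by (simp add: mod_eq_dvd_iff[symmetric])
  qed
  finally show ?thesis .
qed

lemma same_edge_once:
  assumes "e a = e i" "once (a + 1)" shows "n dvd i - a"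
proof -
  from e_eq[of i a] assms(1) consider "n dvd i - a" | "c i = c (a + 1)" "even (i - a)" by auto
  then show ?thesis
  proof cases
    case 2
    then have "n dvd i - (a + 1)" using assms(2) by (simp add: once_def)
    then show ?thesis using 2(2) dvd_even[of "i - (a + 1)"] by simp
  qed
qed

lemma not_conn_no_crossed_F4:
  assumes nc: "\<not> conn" and F: "F4 G w e1 f1 e2 f2" shows "\<not> crosses_F4 G w f e1 f1 e2 f2"
proof
  assume cr: "crosses_F4 G w f e1 f1 e2 f2"
  note odd = not_conn_chords_odd[OF nc]
  obtain r w1 w2 x y where rot: "rotate r (butlast w) = w1 @ w2" and ww: "walk G w1" "walk G w2"
    and e12: "e1 = {last w1, hd w2}" "e2 = {last w2, hd w1}"
    and xy: "f = {x, y}" "x \<in> set w1" "y \<in> set w2" and f: "odd_chord G w f" "f \<noteq> f1" "f \<noteq> f2"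
    using cr unfolding crosses_F4_def by blast
  let ?p = "length w1"
  have pl: "?p > 0" "length w2 > 0" using ww by (auto simp: walk_def)
  have lenr: "?p + length w2 = nat n" using arg_cong[OF rot, of length] len by simp
  have nth: "(w1 @ w2) ! t = c (int r + int t)" if "t < nat n" for t
    using rotate_seq[OF that, of r] rot by simp
  have n1: "w1 ! t = c (int r + int t)" if "t < ?p" for t
    using nth[of t] that lenr by (simp add: nth_append)
  have n2: "w2 ! t = c (int r + int ?p + int t)" if "t < length w2" for t
    using nth[of "?p + t"] that lenr by (simp add: nth_append add.assoc)
  define i where "i = int r + int ?p - 1"
  define j where "j = int r + int ?p + int (length w2) - 1"
  have nn: "int (nat n) = n" using len(1) by simp
  have lenr': "int ?p + int (length w2) = n" using lenr nn by linarith
  then have jn: "j = int r + n - 1" by (simp add: j_def)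
  have l1: "last w1 = c i" "hd w1 = c (int r)" "last w2 = c j" "hd w2 = c (i + 1)"
    using n1[of "?p - 1"] n1[of 0] n2[of "length w2 - 1"] n2[of 0] pl lenr nn
    by (auto simp: last_conv_nth hd_conv_nth i_def j_def algebra_simps of_nat_diff)
  have "c (j + 1) = c (int r)" by (rule c_cong) (simp add: jn)
  then have ee: "e1 = e i" "e2 = e j" using e12 l1 by (simp_all add: e_def)
  obtain a b where ab: "e1 = e a" "e2 = e b" "even (a - b)" "chd {c a, c b}" "chd {c (a + 1), c (b + 1)}"
    "f1 = {c a, c b} \<and> f2 = {c (a + 1), c (b + 1)} \<or> f1 = {c (a + 1), c (b + 1)} \<and> f2 = {c a, c b}"
    using F4D[OF odd F] .
  have d: "n dvd i - a" "n dvd j - b"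
    using same_edge_once[of a i] same_edge_once[of b j] ab ee chords_odd_dest(1,2)[OF odd ab(5)] by simp_all
  have cc: "c i = c a" "c j = c b" "c (i + 1) = c (a + 1)" "c (j + 1) = c (b + 1)"
    using c_cong[OF d(1)] c_cong[OF d(2)] c_cong[of "i + 1" "a + 1"] c_cong[of "j + 1" "b + 1"] d by simp_all
  have ev: "even (j - i)" using ab(3) dvd_even[OF d(1)] dvd_even[OF d(2)] by presburger
  obtain t where t: "t < ?p" "x = w1 ! t" using xy(2) by (metis in_set_conv_nth)
  obtain s where s: "s < length w2" "y = w2 ! s" using xy(3) by (metis in_set_conv_nth)
  \<comment> \<open>The position of \<open>x\<close> is moved up by one period, behind that of
    \<open>y\<close>, to fit the windows of \<open>conn_crossed_F4\<close>.\<close>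
  let ?k = "int r + int t + n" and ?l = "int r + int ?p + int s"
  have xy': "x = c ?k" "y = c ?l" using t s n1 n2 per by simp_all
  have chf: "chd {c ?k, c ?l}" using f(1) xy(1) xy' by (simp add: odd_chord_iff chord_iff)
  have conn
  proof (rule conn_crossed_F4)
    show "i < j" "j < i + n" unfolding i_def jn using pl lenr' by linarith+
    show "even (j - i)" by (rule ev)
    show "chd {c i, c j}" "chd {c (i + 1), c (j + 1)}" using ab cc by simp_all
    show "chd {c ?k, c ?l}" by (rule chf)
    show "j + 1 \<le> ?k" "?k \<le> i + n" "i + 1 \<le> ?l" "?l \<le> j"
      using t(1) s(1) lenr' by (simp_all add: i_def j_def)
    show "even (?k - ?l)" using chords_odd_dest(3)[OF odd chf] .
    show "{c ?k, c ?l} \<noteq> {c i, c j}" "{c ?k, c ?l} \<noteq> {c (i + 1), c (j + 1)}"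
      using f ab(6) cc xy(1) xy' by auto
  qed
  then show False using nc by simp
qed

text \<open>The two cycle edges at a repeated vertex lie on one side of it and so have the same
  parity.\<close>

lemma sink_cycle:
  assumes B: "block W B" "is_cycle B" and p: "c p \<in> verts B" "\<not> once p"
  shows "sink w B (c p)"
proof -
  obtain xs where xs: "cycle_list xs" "B = cycle_graph xs" using is_cycleD[OF B(2)] .
  have nB: "nonseparable W B" using B by (simp add: block_iff)
  have "c p \<in> set xs" using p(1) xs(2) by (simp add: cycle_graph_def)
  then obtain y z where yz: "y \<noteq> z" "{c p, y} \<in> edges B" "{c p, z} \<in> edges B"
    using cycle_graph_two_edges[OF xs(1)] xs(2) by metis
  have pos: "\<exists>i<nat n. g = e (int i)" if "g \<in> edges B" for g
  proof -
    have "g \<in> range e" using nB that by (auto simp: nonseparable_def subgraph_def)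
    then obtain m where m: "g = e m" by (rule rangeE)
    obtain i where "i < nat n" "n dvd int i - m" using range_residue by blast
    then show ?thesis using m e_cong by metis
  qed
  obtain i where i: "i < nat n" "{c p, y} = e (int i)" using pos[OF yz(2)] by blast
  obtain j where j: "j < nat n" "{c p, z} = e (int j)" using pos[OF yz(3)] by blast
  have "i \<noteq> j"
  proof
    assume "i = j"
    then have "{c p, y} = {c p, z}" using i j by simp
    then show False using yz(1) by (auto simp: doubleton_eq_iff)
  qed
  moreover have at: "e (int i) \<in> edges B" "e (int j) \<in> edges B" "c p \<in> e (int i)" "c p \<in> e (int j)"
    unfolding i(2)[symmetric] j(2)[symmetric] using yz by simp_all
  moreover have "even i = even j" using block_edges_parity[OF nB p(2) at] by simp
  moreover have "walk_edges w ! i = e (int i)" "walk_edges w ! j = e (int j)" using i(1) j(1) walk_edges_nth by simp_all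
  ultimately show ?thesis unfolding sink_def len(4) using i(1) j(1) by metis
qed

text \<open>The edge occurrences at a vertex visited once are consecutive and of opposite
  parity.\<close>

lemma sink_not_once:
  assumes "sink w B x" obtains p where "x = c p" "\<not> once p"
proof -
  obtain i j where ij: "i < nat n" "j < nat n" "i \<noteq> j" "even i = even j" "x \<in> e (int i)" "x \<in> e (int j)"
    using assms walk_edges_nth len(4) unfolding sink_def by metis
  obtain p where p: "x = c p" using ij(5) by (auto simp: e_def)
  have "\<not> once p"
  proof
    assume o: "once p"
    have pos: "n dvd int i - p \<or> n dvd int i - (p - 1)" "n dvd int j - p \<or> n dvd int j - (p - 1)"
      using once_edges[OF o] ij p by blast+
    have ev: "even (int i - int j)" using ij(4) by simp
    have mixed: False if "n dvd s - p" "n dvd t - (p - 1)" "even (s - t)" for s t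
      using dvd_even[OF that(1)] dvd_even[OF that(2)] that(3) by presburger
    have "n dvd (int i - p) - (int j - p) \<or> n dvd (int i - (p - 1)) - (int j - (p - 1))"
      using pos mixed[of "int i" "int j"] mixed[of "int j" "int i"] ev 
        dvd_diff[of n "int i - p" "int j - p"] dvd_diff[of n "int i - (p - 1)" "int j - (p - 1)"] by fastforce
    then have "n dvd int i - int j" by simp
    moreover have "int i < n" "int j < n" using ij(1,2) by simp_all
    moreover from this have "\<bar>int i - int j\<bar> < n" by linarith
    ultimately show False using dvd_window[of "int i" "int j"] ij(3) by simp
  qed
  then show thesis using that p by blast
qed

lemma not_conn_strongly_primitive:
  assumes nc: "\<not> conn" shows "strongly_primitive_walk G w"
  unfolding strongly_primitive_walk_def
proof (intro conjI not_conn_primitive[OF nc] notI)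
  assume "\<exists>B x y. block (walk_graph w) B \<and> is_cycle B \<and> sink w B x \<and> sink w B y \<and> x \<noteq> y \<and> {x, y} \<in> edges B"
  then obtain B x y where B: "block W B" "is_cycle B" and s: "sink w B x" "sink w B y" "{x, y} \<in> edges B"
    unfolding walk_graph_W by blast
  obtain p q where p: "x = c p" "\<not> once p" and q: "y = c q" "\<not> once q"
    using sink_not_once[OF s(1)] sink_not_once[OF s(2)] by metis
  have "{x, y} \<in> range e" using B s(3) by (auto simp: block_iff nonseparable_def subgraph_def)
  then obtain k where k: "{x, y} = e k" by (rule rangeE)
  then have "c k = x \<and> c (k + 1) = y \<or> c k = y \<and> c (k + 1) = x" by (auto simp: e_def doubleton_eq_iff)
  then have o: "\<not> once k" "\<not> once (k + 1)" using p q once_cong by metis+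
  have single: "n dvd m - k" if "e m = e k" for m
    using cyclic_edge_once[OF B _ that] s(3) k by simp
  obtain l m where lm: "k + 1 < l" "l + 1 < m" "m < k + n" "c k = c m" "c (k + 1) = c l" "pair k m"
    using adjacent_pairs[OF o single] by blast
  have "pair (k + 1) l" using lm by (auto simp: pair_def)
  then have "odd (l - (k + 1))" "odd (m - k)" using pair_dest(1) lm(6) by blast+
  then have conn using conn_adjacent_sinks[of k l m] lm by simp
  then show False using nc by simp
qed

section \<open>From the conditions of the theorem to positions\<close>

lemma conditions_chord_walk:
  assumes sp: "strongly_primitive_walk G w" and odd: chords_odd
    and cross: "\<And>f f'. chord G w f \<Longrightarrow> chord G w f' \<Longrightarrow> \<not> cross_strongly_effectively G w f f'"
    and F4: "\<And>f e1 f1 e2 f2. odd_chord G w f \<Longrightarrow> F4 G w e1 f1 e2 f2 \<Longrightarrow> \<not> crosses_F4 G w f e1 f1 e2 f2"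
  shows "chord_walk G c n"
proof
  note dest = chords_odd_dest[OF odd]
  show "once i" "even (i - j)" if "chd {c i, c j}" for i j using dest[OF that] by simp_all
  show "\<not> chd {c i, c j}" if "pair p q" "p < i" "i < q" "q < j" "j < p + n" for p q i j
    using diff_blocks_separated[OF that] dest(5) by blast
  show "\<exists>m. e m = e k \<and> \<not> n dvd m - k" if o: "\<not> once k" "\<not> once (k + 1)" for k
  proof (rule ccontr)
    assume no: "\<not> ?thesis"
    then obtain B where B: "block W B" "is_cycle B" "e k \<in> edges B"
      using adjacent_pairs_cycle[OF o] by blast
    have "c k \<in> verts B" "c (k + 1) \<in> verts B"
      using B by (auto simp: block_iff nonseparable_def subgraph_def e_def)
    then have "sink w B (c k)" "sink w B (c (k + 1))" using sink_cycle[OF B(1,2)] o by blast+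
    then show False using sp B c_ne[of k] unfolding strongly_primitive_walk_def walk_graph_W e_def by blast
  qed
  show "k = i + 1 \<and> l = j + 1 \<or> j = k + 1 \<and> i = 0 \<and> l = n - 1"
    if f: "chd {c i, c j}" "chd {c k, c l}" and o: "0 \<le> i" "i < k" "k < j" "j < l" "l < n" "odd (k - i)" for i j k l
  proof -
    have "cross_effectively G w {c i, c j} {c k, c l}"
      unfolding cross_iff using dest(4)[OF f(1)] dest(4)[OF f(2)]
      by (intro conjI) (assumption | rule exI[of _ i], rule exI[of _ j], rule exI[of _ k], rule exI[of _ l], use o in simp)+
    then obtain e1 e2 where F: "F4 G w e1 {c i, c j} e2 {c k, c l}"
      using cross f unfolding cross_strongly_effectively_def chord_chd by blast
    obtain a b where ab: "chd {c a, c b}" "chd {c (a + 1), c (b + 1)}"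
      "{c i, c j} = {c a, c b} \<and> {c k, c l} = {c (a + 1), c (b + 1)} \<or>
       {c i, c j} = {c (a + 1), c (b + 1)} \<and> {c k, c l} = {c a, c b}"
      using F4D[OF odd F] by metis
    \<comment> \<open>An \<open>F4\<close> is given by sets of vertices. Since the ends of its
      chords are visited once, their positions can be read off modulo \<open>n\<close>.\<close>
    have neigh: "n dvd x' - x - 1 \<and> n dvd y' - y - 1 \<or> n dvd x' - y - 1 \<and> n dvd y' - x - 1"
      if "{c x, c y} = {c a, c b}" "{c x', c y'} = {c (a + 1), c (b + 1)}" for x y x' y'
    proof -
      have res: "n dvd x - a \<and> n dvd y - b \<or> n dvd x - b \<and> n dvd y - a"
        if "{c x, c y} = {c a, c b}" "once a" "once b" for x y a b
        using that by (auto simp: doubleton_eq_iff once_def)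
      have 1: "n dvd x - a \<and> n dvd y - b \<or> n dvd x - b \<and> n dvd y - a"
        using res[OF that(1)] dest(1,2)[OF ab(1)] by simp
      have 2: "n dvd x' - (a + 1) \<and> n dvd y' - (b + 1) \<or> n dvd x' - (b + 1) \<and> n dvd y' - (a + 1)"
        using res[OF that(2)] dest(1,2)[OF ab(2)] by simp
      have diff: "n dvd s - t - 1" if "n dvd t - u" "n dvd s - (u + 1)" for s t u
        using dvd_diff[OF that(2,1)] by (simp add: algebra_simps)
      from 1 2 show ?thesis using diff by blast
    qed
    have zero: "s = 0" if "n dvd s" "- n < s" "s < n" for s using dvd_window[of s 0] that by auto
    have one: "s = n" if "n dvd s" "0 < s" "s \<le> n" for s using zdvd_imp_le[of n s] that by auto
    from ab(3) show ?thesis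
    proof
      assume "{c i, c j} = {c a, c b} \<and> {c k, c l} = {c (a + 1), c (b + 1)}"
      then have "n dvd k - i - 1 \<and> n dvd l - j - 1 \<or> n dvd k - j - 1 \<and> n dvd l - i - 1" using neigh by blast
      then show ?thesis
      proof
        assume "n dvd k - i - 1 \<and> n dvd l - j - 1"
        then show ?thesis using zero[of "k - i - 1"] zero[of "l - j - 1"] o by auto
      next
        assume "n dvd k - j - 1 \<and> n dvd l - i - 1"
        then show ?thesis using zero[of "l - i - 1"] o by auto
      qed
    next
      assume "{c i, c j} = {c (a + 1), c (b + 1)} \<and> {c k, c l} = {c a, c b}"
      then have "n dvd i - k - 1 \<and> n dvd j - l - 1 \<or> n dvd i - l - 1 \<and> n dvd j - k - 1" using neigh by blast
      then show ?thesis
      proof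
        assume *: "n dvd i - k - 1 \<and> n dvd j - l - 1"
        have "i - k - 1 = 0" using * o by (intro zero) auto
        then show ?thesis using o by auto
      next
        assume *: "n dvd i - l - 1 \<and> n dvd j - k - 1"
        have "n dvd l + 1 - i" using * dvd_minus_iff[of n "i - l - 1"] by (simp add: algebra_simps)
        then have "l + 1 - i = n" using o by (intro one) auto
        moreover have "j - k - 1 = 0" using * o by (intro zero) auto
        ultimately show ?thesis using o by auto
      qed
    qed
  qed
  show "n = 4" if f: "chd {c (a - 1), c (b - 1)}" "chd {c a, c b}" "chd {c (a + 1), c (b + 1)}" for a b
  proof (rule ccontr)
    assume n: "n \<noteq> 4"
    obtain b' where b': "a \<le> b'" "b' < a + n" "n dvd b' - b" by (rule residue)
    have cb: "c b' = c b" "c (b' + 1) = c (b + 1)" "c (b' - 1) = c (b - 1)" "e b' = e b"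
      using c_cong[of b' b] c_cong[of "b' + 1" "b + 1"] c_cong[of "b' - 1" "b - 1"] e_cong[of b' b] b'(3) by simp_all
    have "a \<noteq> b'" using chd_ne[OF f(2)] cb by auto
    then have ab: "a < b'" using b' by simp
    have win: "a + 2 \<le> b'" "b' + 2 \<le> a + n" using chd_window[of a b'] f(2) cb ab b' by simp_all
    have F: "F4 G w (e a) {c a, c b} (e b) {c (a + 1), c (b + 1)}" using F4I[OF odd f(2,3)] .
    \<comment> \<open>The walk is started just behind \<open>e b\<close>: the first part ends at
      \<open>c a\<close>, the second runs from \<open>c (a + 1)\<close> to \<open>c b\<close>. The
      chord at \<open>a - 1\<close> and \<open>b - 1\<close> then has one end in each part.\<close>
    let ?w1 = "map c [b' + 1..a + n]" and ?w2 = "map c [a + n + 1..b' + n]"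
    obtain r where r: "r < nat n" "n dvd int r - (b' + 1)" using range_residue by blast
    have app: "[b' + 1..a + n] @ [a + n + 1..b' + n] = [b' + 1..b' + n]"
      using upto_split2[of "b' + 1" "a + n" "b' + n"] win by simp
    have rot: "rotate r (butlast w) = ?w1 @ ?w2" unfolding map_append[symmetric] app
    proof (rule nth_equalityI)
      show "length (rotate r (butlast w)) = length (map c [b' + 1..b' + n])" using len by simp
      fix t assume "t < length (rotate r (butlast w))"
      then have t: "t < nat n" using len by simp
      have "c (int r + int t) = c (b' + 1 + int t)" using r(2) by (intro c_cong) (simp add: algebra_simps)
      then show "rotate r (butlast w) ! t = map c [b' + 1..b' + n] ! t"
        using rotate_seq[OF t, of r] t by simp
    qed
    have ww: "walk G ?w1" "walk G ?w2"
      using win e_in by (auto simp: walk_def walk_edges_map)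
    have l: "last ?w1 = c a" "hd ?w2 = c (a + 1)" "last ?w2 = c b" "hd ?w1 = c (b + 1)"
      using win per[of a] per[of "a + 1"] per[of b'] cb by (simp_all add: last_map hd_map hd_upto last_upto ac_simps)
    have e12: "e a = {last ?w1, hd ?w2}" "e b = {last ?w2, hd ?w1}" by (simp_all only: l e_def)
    have "c (a - 1) = c (a - 1 + n)" "c (b - 1) = c (b' - 1 + n)" using per cb by simp_all
    moreover have "a - 1 + n \<in> set [b' + 1..a + n]" "b' - 1 + n \<in> set [a + n + 1..b' + n]" using win by auto
    ultimately have xy: "c (a - 1) \<in> set ?w1" "c (b - 1) \<in> set ?w2" by (simp_all only: set_map image_eqI)
    have ne1: "{c (a - 1), c (b - 1)} \<noteq> {c a, c b}"
    proof
      assume eq: "{c (a - 1), c (b - 1)} = {c a, c b}"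
      have "c (a - 1) \<noteq> c a" using c_ne[of "a - 1"] by simp
      then have "c (b - 1) = c a" using eq by (auto simp: doubleton_eq_iff)
      then have "n dvd b - 1 - a" using dest(1)[OF f(2)] by (simp add: once_def)
      then have "even (b - 1 - a)" by (rule dvd_even)
      then show False using dest(3)[OF f(2)] by presburger
    qed
    \<comment> \<open>Equal sets would have to match crosswise, and the two resulting congruences
      add up to \<open>n dvd 4\<close>. This is where length four is special.\<close>
    have ne2: "{c (a - 1), c (b - 1)} \<noteq> {c (a + 1), c (b + 1)}"
    proof
      assume eq: "{c (a - 1), c (b - 1)} = {c (a + 1), c (b + 1)}"
      have "c (a - 1) \<noteq> c (a + 1)" using c_ne2[of "a - 1"] by (simp add: add.commute)
      then have "c (b - 1) = c (a + 1)" "c (a - 1) = c (b + 1)" using eq by (auto simp: doubleton_eq_iff)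
      then have "n dvd (b - 1) - (a + 1)" "n dvd (a - 1) - (b + 1)"
        using dest(1,2)[OF f(3)] unfolding once_def by blast+
      then have "n dvd ((b - 1) - (a + 1)) + ((a - 1) - (b + 1))" by (rule dvd_add)
      then have "n dvd 4" by simp
      then show False using zdvd_imp_le[of n 4] n n4 by simp
    qed
    have "crosses_F4 G w {c (a - 1), c (b - 1)} (e a) {c a, c b} (e b) {c (a + 1), c (b + 1)}"
      unfolding crosses_F4_def using F dest(4)[OF f(1)] ne1 ne2 rot ww e12 xy by blast
    then show False using F4 F dest(4)[OF f(1)] by blast
  qed
qed

lemma not_conn_iff:
  "\<not> conn \<longleftrightarrow> strongly_primitive_walk G w \<and> (\<forall>f. chord G w f \<longrightarrow> odd_chord G w f) \<and>
    (\<nexists>f f'. chord G w f \<and> chord G w f' \<and> cross_strongly_effectively G w f f') \<and>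
    (\<nexists>f e1 f1 e2 f2. odd_chord G w f \<and> F4 G w e1 f1 e2 f2 \<and> crosses_F4 G w f e1 f1 e2 f2)"
  (is "_ \<longleftrightarrow> ?R")
proof
  assume nc: "\<not> conn"
  show ?R
    using not_conn_strongly_primitive[OF nc] not_conn_chords_odd[OF nc] not_conn_no_strong_crossing[OF nc]
      not_conn_no_crossed_F4[OF nc] unfolding chords_odd_def by blast
next
  assume R: ?R
  then have "chord_walk G c n" by (intro conditions_chord_walk) (auto simp: chords_odd_def)
  then show "\<not> conn" by (rule chord_walk.not_conn)
qed

end

theorem theorem4p13:
  fixes G :: "'v sgraph" and w :: "'v list"
  assumes "finite_simple_graph G" and "connected_graph G"
    and "even_closed_walk G w"
    and "walk_binomial w \<noteq> (0 :: ('v, 'k::field) edge_poly)"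
  shows "minimal_binomial G (walk_binomial w :: ('v, 'k) edge_poly) \<longleftrightarrow>
    strongly_primitive_walk G w \<and>
    (\<forall>f. chord G w f \<longrightarrow> odd_chord G w f) \<and>
    (\<nexists>f f'. chord G w f \<and> chord G w f' \<and> cross_strongly_effectively G w f f') \<and>
    (\<nexists>f e1 f1 e2 f2. odd_chord G w f \<and> F4 G w e1 f1 e2 f2 \<and> crosses_F4 G w f e1 f1 e2 f2)"
  (is "?M \<longleftrightarrow> ?R")
proof -
  interpret list_walk G w using assms by unfold_locales
  have ne: "E_plus w \<noteq> E_minus w" using assms(4) by (auto simp: walk_binomial_def pure_binomial_def)
  have M: "?M \<longleftrightarrow> \<not> conn"
    unfolding walk_binomial_def conn_E
    using minimal_imp_not_conn[OF assms(1) E_keys ne] not_conn_imp_minimal[OF assms(1) E_keys E_deg[symmetric]] by blast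
  have R: "\<not> conn \<longleftrightarrow> ?R" if "primitive_walk G w"
  proof -
    interpret noncrossing_list_walk G w
      by (intro noncrossing_list_walk.intro list_walk_axioms noncrossing_list_walk_axioms.intro
        primitive_noncrossing[OF that ne])
    show ?thesis by (rule not_conn_iff)
  qed
  show ?thesis
  proof (cases "primitive_walk G w")
    case True
    then show ?thesis using M R by simp
  next
    case False
    \<comment> \<open>For a walk that is not primitive both sides of the equivalence fail.\<close>
    then have conn using not_conn_primitive by blast
    moreover have "\<not> ?R" using False by (simp add: strongly_primitive_walk_def)
    ultimately show ?thesis using M by blast
  qed
qed

end
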